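(* Let $R$ be a nonzero ring with a proper ideal $\mathfrak{i}$, an automorphism $\tau$ and a left $\tau$-derivation $\delta$ satisfying the standing assumptions (1)–(5) listed in the context, and let $T = R[[y;\tau,\delta]]$ be the skew power series ring. Assume that $\delta = \tau - \mathrm{id}$. Then: (i) If $P$ is a prime ideal of $T$, then $P \cap R$ is a $\tau$-prime ideal of $R$. In particular, $P \cap R = Q \cap \tau(Q) \cap \cdots \cap \tau^{n-1}(Q)$ for some prime ideal $Q$ of $R$ and some positive integer $n$ such that $\tau^n(Q) = Q$. (ii) If $Q$ is a $\tau$-prime ideal of $R$, then there exists a prime ideal $P$ of $T$ such that $P \cap R = Q$.
   Context: All rings are associative with identity $1$; "ideal" means two-sided ideal; "noetherian" means left and right noetherian. Standing assumptions. (1) $R$ is a nonzero ring containing a proper ideal $\mathfrak{i}$. (2) The $\mathfrak{i}$-adic filtration of $R$ is separated ($\bigcap_n \mathfrak{i}^n = 0$) and complete (Cauchy sequences in the $\mathfrak{i}$-adic topology converge). (3) The associated graded ring $\operatorname{gr} R = \bigoplus_{n\ge 0} \mathfrak{i}^n/\mathfrak{i}^{n+1}$ is noetherian (it follows that $R$ is noetherian and that all one-sided ideals of $R$ are closed). (4) $\tau$ is an automorphism of $R$ and $\delta$ is a left $\tau$-derivation of $R$, i.e. an additive map with $\delta(ab) = \tau(a)\delta(b) + \delta(a)b$ for all $a,b\in R$; moreover $\tau(\mathfrak{i}) = \mathfrak{i}$ and $\tau$ induces an automorphism $\overline{\tau}$ of $\operatorname{gr} R$ with $\overline{\tau}(\operatorname{gr}(a))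 = \operatorname{gr}(\tau(a))$ for $a \in R$, where $\operatorname{gr}(a)$ is the class of $a$ in $\mathfrak{i}^m/\mathfrak{i}^{m+1}$ for $a \in \mathfrak{i}^m\setminus \mathfrak{i}^{m+1}$ and $\operatorname{gr}(0)=0$. (5) $\delta(R) \subseteq \mathfrak{i}$ and $\delta(\mathfrak{i}) \subseteq \mathfrak{i}^2$. Skew polynomial ring. $S = R[y;\tau,\delta]$ consists of the polynomials $r_0 + r_1 y + \cdots + r_n y^n$ ($r_i\in R$), with multiplication determined by $yr = \tau(r)y + \delta(r)$ for $r \in R$. For $i \ge 0$ define maps $\theta_{i,k}: R\to R$ by $y^i r = \sum_{k=0}^{i} \theta_{i,k}(r) y^k$ in $S$, with $\theta_{i,k} = 0$ for $k<0$ or $k>i$. Skew power series ring. $T = R[[y;\tau,\delta]]$ is the set of formal series $\sum_{i=0}^\infty r_i y^i$ ($r_i \in R$), with coefficientwise addition and multiplication $$\Big(\sum a_i y^i\Big)\Big(\sum b_j y^j\Big) = \sum_{n=0}^\infty \Big(\sum_{j=0}^n \Big(\sum_{i=0}^\infty a_i\theta_{i,n-j}(b_j)\Big)\Big) y^n ;$$ since $\theta_{i,k}(R)\subseteq \mathfrak{i}^{i-k}$ for $i \geq k$, the inner sums converge in the $\mathfrak{i}$-adic topology, and $T$ is an associative unital ring containing $S$ (hence $R$) as a subring. $\tau$-prime ideals. An ideal $I$ of $R$ is a $\tau$-ideal if $\tau(I)\subseteq I$ (equivalently $\tau(I)=I$, as $R$ is noetherian). A nonzero ring with an automorphism $\tau$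 is $\tau$-prime if the product of two nonzero $\tau$-ideals is always nonzero; a proper $\tau$-ideal $Q$ of $R$ is $\tau$-prime if $R/Q$ is $\tau$-prime under the induced action of $\tau$. *)

theory Defs
  imports "HOL-Algebra.Ideal_Product" "HOL-Algebra.QuotRing" "HOL-Algebra.UnivPoly"
begin

section \<open>Ideals and chain conditions in noncommutative rings\<close>

definition left_ideal :: "('a, 'm) ring_scheme \<Rightarrow> 'a set \<Rightarrow> bool"
  where "left_ideal A L \<longleftrightarrow>
    additive_subgroup L A \<and> (\<forall>r\<in>carrier A. \<forall>x\<in>L. r \<otimes>\<^bsub>A\<^esub> x \<in> L)"

definition right_ideal :: "('a, 'm) ring_scheme \<Rightarrow> 'a set \<Rightarrow> bool"
  where "right_ideal A L \<longleftrightarrow>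
    additive_subgroup L A \<and> (\<forall>r\<in>carrier A. \<forall>x\<in>L. x \<otimes>\<^bsub>A\<^esub> r \<in> L)"

text \<open>The library's locale \<open>noetherian_ring\<close> only constrains two-sided ideals,
  hence the following definition by ascending chains of one-sided ideals.\<close>

definition two_sided_noetherian :: "('a, 'm) ring_scheme \<Rightarrow> bool"
  where "two_sided_noetherian A \<longleftrightarrow>
    (\<forall>L :: nat \<Rightarrow> 'a set. (\<forall>n. left_ideal A (L n)) \<and> (\<forall>n. L n \<subseteq> L (Suc n))
       \<longrightarrow> (\<exists>N. \<forall>n\<ge>N. L n = L N)) \<and>
    (\<forall>L :: nat \<Rightarrow> 'a set. (\<forall>n. right_ideal A (L n)) \<and> (\<forall>n. L n \<subseteq> L (Suc n))
       \<longrightarrow> (\<exists>N. \<forall>n\<ge>N. L n = L N))"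

text \<open>The library's \<^locale>\<open>primeideal\<close> presupposes commutativity.  In a noncommutative ring
  primeness refers to products of ideals.\<close>

definition nc_prime_ideal :: "('a, 'm) ring_scheme \<Rightarrow> 'a set \<Rightarrow> bool"
  where "nc_prime_ideal A P \<longleftrightarrow>
    ideal P A \<and> P \<noteq> carrier A \<and>
    (\<forall>I J. ideal I A \<and> ideal J A \<and> I \<cdot>\<^bsub>A\<^esub> J \<subseteq> P \<longrightarrow> I \<subseteq> P \<or> J \<subseteq> P)"

primrec ideal_power :: "('a, 'm) ring_scheme \<Rightarrow> 'a set \<Rightarrow> nat \<Rightarrow> 'a set"
  where
    "ideal_power R I 0 = carrier R"
  | "ideal_power R I (Suc n) = I \<cdot>\<^bsub>R\<^esub> ideal_power R I n"


section \<open>The adic topology\<close>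

definition adic_tendsto :: "('a, 'm) ring_scheme \<Rightarrow> 'a set \<Rightarrow> (nat \<Rightarrow> 'a) \<Rightarrow> 'a \<Rightarrow> bool"
  where "adic_tendsto R I x l \<longleftrightarrow>
    (\<forall>n. \<exists>N. \<forall>k\<ge>N. x k \<ominus>\<^bsub>R\<^esub> l \<in> ideal_power R I n)"

definition adic_Cauchy :: "('a, 'm) ring_scheme \<Rightarrow> 'a set \<Rightarrow> (nat \<Rightarrow> 'a) \<Rightarrow> bool"
  where "adic_Cauchy R I x \<longleftrightarrow>
    (\<forall>n. \<exists>N. \<forall>k\<ge>N. \<forall>l\<ge>N. x k \<ominus>\<^bsub>R\<^esub> x l \<in> ideal_power R I n)"

definition adic_separated :: "('a, 'm) ring_scheme \<Rightarrow> 'a set \<Rightarrow> bool"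
  where "adic_separated R I \<longleftrightarrow> (\<Inter>n. ideal_power R I n) = {\<zero>\<^bsub>R\<^esub>}"

definition adic_complete :: "('a, 'm) ring_scheme \<Rightarrow> 'a set \<Rightarrow> bool"
  where "adic_complete R I \<longleftrightarrow>
    (\<forall>x. (\<forall>n. x n \<in> carrier R) \<and> adic_Cauchy R I x
       \<longrightarrow> (\<exists>l\<in>carrier R. adic_tendsto R I x l))"

text \<open>The limit is unique, and thus meaningful, when the topology is separated.\<close>

definition adic_lim :: "('a, 'm) ring_scheme \<Rightarrow> 'a set \<Rightarrow> (nat \<Rightarrow> 'a) \<Rightarrow> 'a"
  where "adic_lim R I x = (THE l. l \<in> carrier R \<and> adic_tendsto R I x l)"


section \<open>The associated graded ring\<close>

text \<open>
  An element of $\bigoplus_n I^n/I^{n+1}$ is a finitely supported family of cosets, the \<open>n\<close>-th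
  one being a coset of $I^{n+1}$ by an element of $I^n$.  Since
  $I^n/I^{n+1}$ is a subgroup of $R/I^{n+1}$, the sum of homogeneous
  products that forms the \<open>n\<close>-th component of a product is taken in the latter ring;
  \<^const>\<open>rcoset_mult\<close> with modulus $I^{n+1}$ is the multiplication
  $I^j/I^{j+1} \times I^{n-j}/I^{n-j+1} \to I^n/I^{n+1}$ induced by that of \<open>R\<close>.
\<close>

definition gr_ring :: "('a, 'm) ring_scheme \<Rightarrow> 'a set \<Rightarrow> (nat \<Rightarrow> 'a set) ring"
  where "gr_ring R I =
    \<lparr>carrier = {f. (\<forall>n. \<exists>a\<in>ideal_power R I n. f n = ideal_power R I (Suc n) +>\<^bsub>R\<^esub> a) \<and>
                   (\<exists>N. \<forall>n\<ge>N. f n = ideal_power R I (Suc n))},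
     mult = (\<lambda>f g n. finsum (R Quot ideal_power R I (Suc n))
                      (\<lambda>j. rcoset_mult R (ideal_power R I (Suc n)) (f j) (g (n - j))) {..n}),
     one = (\<lambda>n. if n = 0 then ideal_power R I (Suc 0) +>\<^bsub>R\<^esub> \<one>\<^bsub>R\<^esub>
                else ideal_power R I (Suc n)),
     zero = (\<lambda>n. ideal_power R I (Suc n)),
     add = (\<lambda>f g n. f n <+>\<^bsub>R\<^esub> g n)\<rparr>"

text \<open>
  The class of \<open>a\<close> in $I^m/I^{m+1}$, placed in degree \<open>m\<close>, where
  $a \in I^m \setminus I^{m+1}$.  The powers of \<open>I\<close> decrease, so there is at most
  one such \<open>m\<close>; there is none for \<open>a = 0\<close>, whose symbol is therefore zero.
\<close>

definition gr_symbol :: "('a, 'm) ring_scheme \<Rightarrow> 'a set \<Rightarrow> 'a \<Rightarrow> nat \<Rightarrow> 'a set"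
  where "gr_symbol R I a =
    (\<lambda>m. if a \<in> ideal_power R I m \<and> a \<notin> ideal_power R I (Suc m)
         then ideal_power R I (Suc m) +>\<^bsub>R\<^esub> a
         else ideal_power R I (Suc m))"


section \<open>Skew polynomials and skew power series\<close>

definition left_skew_derivation ::
    "('a, 'm) ring_scheme \<Rightarrow> ('a \<Rightarrow> 'a) \<Rightarrow> ('a \<Rightarrow> 'a) \<Rightarrow> bool"
  where "left_skew_derivation R \<tau> \<delta> \<longleftrightarrow>
    \<delta> \<in> carrier R \<rightarrow> carrier R \<and>
    (\<forall>a\<in>carrier R. \<forall>b\<in>carrier R. \<delta> (a \<oplus>\<^bsub>R\<^esub> b) = \<delta> a \<oplus>\<^bsub>R\<^esub> \<delta> b) \<and>
    (\<forall>a\<in>carrier R. \<forall>b\<in>carrier R.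
       \<delta> (a \<otimes>\<^bsub>R\<^esub> b) = \<tau> a \<otimes>\<^bsub>R\<^esub> \<delta> b \<oplus>\<^bsub>R\<^esub> \<delta> a \<otimes>\<^bsub>R\<^esub> b)"

definition const_series :: "('a, 'm) ring_scheme \<Rightarrow> 'a \<Rightarrow> nat \<Rightarrow> 'a"
  where "const_series R r = (\<lambda>k. if k = 0 then r else \<zero>\<^bsub>R\<^esub>)"

definition skew_var :: "('a, 'm) ring_scheme \<Rightarrow> nat \<Rightarrow> 'a"
  where "skew_var R = (\<lambda>k. if k = 1 then \<one>\<^bsub>R\<^esub> else \<zero>\<^bsub>R\<^esub>)"

text \<open>
  Left multiplication by \<open>y\<close> on polynomials:
  $y \sum_k q_k y^k = \sum_k (\tau(q_k) y^{k+1} + \delta(q_k) y^k)$, by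
  $y r = \tau(r) y + \delta(r)$.
\<close>

definition skew_shift ::
    "('a, 'm) ring_scheme \<Rightarrow> ('a \<Rightarrow> 'a) \<Rightarrow> ('a \<Rightarrow> 'a) \<Rightarrow> (nat \<Rightarrow> 'a) \<Rightarrow> nat \<Rightarrow> 'a"
  where "skew_shift R \<tau> \<delta> q =
    (\<lambda>k. (if k = 0 then \<zero>\<^bsub>R\<^esub> else \<tau> (q (k - 1))) \<oplus>\<^bsub>R\<^esub> \<delta> (q k))"

text \<open>
  The product is forced by $(\sum_i p_i y^i) q = \sum_i p_i (y^i q)$; the set
  \<^const>\<open>up\<close> consists of the finitely supported coefficient sequences.
\<close>

definition skew_poly_ring ::
    "('a, 'm) ring_scheme \<Rightarrow> ('a \<Rightarrow> 'a) \<Rightarrow> ('a \<Rightarrow> 'a) \<Rightarrow> (nat \<Rightarrow> 'a) ring"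
  where "skew_poly_ring R \<tau> \<delta> =
    \<lparr>carrier = up R,
     mult = (\<lambda>p q k. \<Oplus>\<^bsub>R\<^esub>i\<in>{i. p i \<noteq> \<zero>\<^bsub>R\<^esub>}. p i \<otimes>\<^bsub>R\<^esub> (skew_shift R \<tau> \<delta> ^^ i) q k),
     one = const_series R \<one>\<^bsub>R\<^esub>,
     zero = const_series R \<zero>\<^bsub>R\<^esub>,
     add = (\<lambda>p q k. p k \<oplus>\<^bsub>R\<^esub> q k)\<rparr>"

text \<open>\<open>skew_theta R \<tau> \<delta> i k r\<close> is the coefficient of $y^k$ in the polynomial $y^i r$.\<close>

definition skew_theta ::
    "('a, 'm) ring_scheme \<Rightarrow> ('a \<Rightarrow> 'a) \<Rightarrow> ('a \<Rightarrow> 'a) \<Rightarrow> nat \<Rightarrow> nat \<Rightarrow> 'a \<Rightarrow> 'a"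
  where "skew_theta R \<tau> \<delta> i k r =
    (skew_var R [^]\<^bsub>skew_poly_ring R \<tau> \<delta>\<^esub> i \<otimes>\<^bsub>skew_poly_ring R \<tau> \<delta>\<^esub> const_series R r) k"

definition skew_power_series_ring ::
    "('a, 'm) ring_scheme \<Rightarrow> 'a set \<Rightarrow> ('a \<Rightarrow> 'a) \<Rightarrow> ('a \<Rightarrow> 'a) \<Rightarrow> (nat \<Rightarrow> 'a) ring"
  where "skew_power_series_ring R I \<tau> \<delta> =
    \<lparr>carrier = UNIV \<rightarrow> carrier R,
     mult = (\<lambda>a b n. \<Oplus>\<^bsub>R\<^esub>j\<in>{..n}.
        adic_lim R I (\<lambda>N. \<Oplus>\<^bsub>R\<^esub>i\<in>{..<N}. a i \<otimes>\<^bsub>R\<^esub> skew_theta R \<tau> \<delta> i (n - j) (b j))),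
     one = const_series R \<one>\<^bsub>R\<^esub>,
     zero = const_series R \<zero>\<^bsub>R\<^esub>,
     add = (\<lambda>a b n. a n \<oplus>\<^bsub>R\<^esub> b n)\<rparr>"

definition series_contraction :: "('a, 'm) ring_scheme \<Rightarrow> (nat \<Rightarrow> 'a) set \<Rightarrow> 'a set"
  where "series_contraction R P = {r \<in> carrier R. const_series R r \<in> P}"


section \<open>\<open>\<tau>\<close>-prime ideals\<close>

definition tau_ideal :: "('a, 'm) ring_scheme \<Rightarrow> ('a \<Rightarrow> 'a) \<Rightarrow> 'a set \<Rightarrow> bool"
  where "tau_ideal A \<tau> I \<longleftrightarrow> ideal I A \<and> \<tau> ` I \<subseteq> I"

definition tau_prime_ring :: "('a, 'm) ring_scheme \<Rightarrow> ('a \<Rightarrow> 'a) \<Rightarrow> bool"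
  where "tau_prime_ring A \<tau> \<longleftrightarrow>
    ring A \<and> carrier A \<noteq> {\<zero>\<^bsub>A\<^esub>} \<and> \<tau> \<in> ring_iso A A \<and>
    (\<forall>I J. tau_ideal A \<tau> I \<and> tau_ideal A \<tau> J \<and> I \<noteq> {\<zero>\<^bsub>A\<^esub>} \<and> J \<noteq> {\<zero>\<^bsub>A\<^esub>}
       \<longrightarrow> I \<cdot>\<^bsub>A\<^esub> J \<noteq> {\<zero>\<^bsub>A\<^esub>})"

text \<open>The induced map $Q + a \mapsto Q + \tau(a)$ on cosets; the union has only one distinct
  member when \<open>Q\<close> is a \<open>\<tau>\<close>-ideal.\<close>

definition quot_map :: "('a, 'm) ring_scheme \<Rightarrow> 'a set \<Rightarrow> ('a \<Rightarrow> 'a) \<Rightarrow> 'a set \<Rightarrow> 'a set"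
  where "quot_map R Q \<tau> X = (\<Union>a\<in>X. Q +>\<^bsub>R\<^esub> \<tau> a)"

definition tau_prime_ideal :: "('a, 'm) ring_scheme \<Rightarrow> ('a \<Rightarrow> 'a) \<Rightarrow> 'a set \<Rightarrow> bool"
  where "tau_prime_ideal R \<tau> Q \<longleftrightarrow>
    tau_ideal R \<tau> Q \<and> Q \<noteq> carrier R \<and> tau_prime_ring (R Quot Q) (quot_map R Q \<tau>)"


section \<open>Consistency of the encoding\<close>

context
  fixes R (structure) and \<tau> \<delta>
  assumes R: "ring R" and tau: "\<tau> \<in> ring_hom R R" and delta: "left_skew_derivation R \<tau> \<delta>"
begin

interpretation ring R by (rule R)

lemma delta_zero: "\<delta> \<zero> = \<zero>"
proof -
  have c: "\<delta> \<zero> \<in> carrier R" and "\<delta> (\<zero> \<oplus> \<zero>) = \<delta> \<zero> \<oplus> \<delta> \<zero>"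
    using delta zero_closed unfolding left_skew_derivation_def by blast+
  then have "\<delta> \<zero> \<oplus> \<delta> \<zero> = \<delta> \<zero>" by (metis r_zero zero_closed)
  then show ?thesis using c by simp
qed

lemma delta_one: "\<delta> \<one> = \<zero>"
proof -
  have c: "\<delta> \<one> \<in> carrier R" and "\<delta> (\<one> \<otimes> \<one>) = \<tau> \<one> \<otimes> \<delta> \<one> \<oplus> \<delta> \<one> \<otimes> \<one>"
    using delta one_closed unfolding left_skew_derivation_def by blast+
  then have "\<delta> \<one> \<oplus> \<delta> \<one> = \<delta> \<one>"
    using c ring_hom_one[OF tau] by (metis l_one r_one one_closed)
  then show ?thesis using c by simp
qed

lemma tau_zero: "\<tau> \<zero> = \<zero>"
  using ring_hom_zero[OF tau R R] .

lemma skew_shift_closed: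
  assumes "q \<in> UNIV \<rightarrow> carrier R"
  shows "skew_shift R \<tau> \<delta> q \<in> UNIV \<rightarrow> carrier R"
proof -
  have t: "\<And>x. x \<in> carrier R \<Longrightarrow> \<tau> x \<in> carrier R" using ring_hom_closed[OF tau] .
  have d: "\<And>x. x \<in> carrier R \<Longrightarrow> \<delta> x \<in> carrier R"
    using delta by (auto simp: left_skew_derivation_def)
  show ?thesis using assms t d by (auto simp: skew_shift_def Pi_iff)
qed

lemma skew_shift_pow_closed:
  assumes "q \<in> UNIV \<rightarrow> carrier R"
  shows "(skew_shift R \<tau> \<delta> ^^ i) q \<in> UNIV \<rightarrow> carrier R"
  using assms skew_shift_closed by (induction i) auto

lemma skew_monom_mult:
  assumes "q \<in> UNIV \<rightarrow> carrier R"
  shows "(\<lambda>k. if k = i then \<one> else \<zero>) \<otimes>\<^bsub>skew_poly_ring R \<tau> \<delta>\<^esub> q = (skew_shift R \<tau> \<delta> ^^ i) q"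
proof (cases "\<one> = \<zero>")
  case True
  then have "carrier R = {\<zero>}" by (rule one_zeroD)
  then have "(skew_shift R \<tau> \<delta> ^^ i) q = (\<lambda>k. \<zero>)"
    using skew_shift_pow_closed[OF assms, of i] by (auto simp: Pi_iff)
  then show ?thesis using True by (auto simp: skew_poly_ring_def fun_eq_iff)
next
  case False
  then have s: "{j. (if j = i then \<one> else \<zero>) \<noteq> \<zero>} = {i}" by auto
  have "\<And>k. (skew_shift R \<tau> \<delta> ^^ i) q k \<in> carrier R"
    using skew_shift_pow_closed[OF assms, of i] by auto
  then show ?thesis by (simp add: skew_poly_ring_def s)
qed

lemma skew_shift_monom:
  "skew_shift R \<tau> \<delta> (\<lambda>k. if k = i then \<one> else \<zero>) = (\<lambda>k. if k = Suc i then \<one> else \<zero>)"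
  using ring_hom_one[OF tau] by (auto simp: skew_shift_def fun_eq_iff delta_zero delta_one tau_zero)

lemma skew_var_pow:
  "skew_var R [^]\<^bsub>skew_poly_ring R \<tau> \<delta>\<^esub> (i::nat) = (\<lambda>k. if k = i then \<one> else \<zero>)"
proof (induction i)
  case 0
  show ?case by (simp add: nat_pow_def skew_poly_ring_def const_series_def)
next
  case (Suc i)
  have "skew_var R [^]\<^bsub>skew_poly_ring R \<tau> \<delta>\<^esub> Suc i
      = (\<lambda>k. if k = i then \<one> else \<zero>) \<otimes>\<^bsub>skew_poly_ring R \<tau> \<delta>\<^esub> skew_var R"
    using Suc by (simp add: nat_pow_def)
  also have "\<dots> = (skew_shift R \<tau> \<delta> ^^ i) (skew_var R)"
    by (rule skew_monom_mult) (auto simp: skew_var_def)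
  also have "\<dots> = (\<lambda>k. if k = Suc i then \<one> else \<zero>)"
    by (induction i) (simp_all add: skew_var_def skew_shift_monom)
  finally show ?case .
qed

lemma skew_var_commute:
  assumes "r \<in> carrier R"
  shows "skew_var R \<otimes>\<^bsub>skew_poly_ring R \<tau> \<delta>\<^esub> const_series R r =
    (\<lambda>k. if k = 0 then \<delta> r else if k = 1 then \<tau> r else \<zero>)"
proof -
  have c: "\<delta> r \<in> carrier R" "\<tau> r \<in> carrier R"
    using assms delta ring_hom_closed[OF tau] by (auto simp: left_skew_derivation_def)
  have "skew_var R \<otimes>\<^bsub>skew_poly_ring R \<tau> \<delta>\<^esub> const_series R r
      = skew_shift R \<tau> \<delta> (const_series R r)"
    using skew_monom_mult[of "const_series R r" 1] assms
    by (simp add: skew_var_def const_series_def Pi_iff)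
  then show ?thesis
    using c by (auto simp: skew_shift_def const_series_def fun_eq_iff delta_zero tau_zero)
qed

lemma skew_theta_eq:
  assumes "r \<in> carrier R"
  shows "skew_theta R \<tau> \<delta> i k r = (skew_shift R \<tau> \<delta> ^^ i) (const_series R r) k"
  using assms skew_monom_mult[of "const_series R r" i]
  by (simp add: skew_theta_def skew_var_pow const_series_def Pi_iff)

end

end

theory Submission
  imports Defs
begin

text \<open>
  Write $\delta = \tau - \mathrm{id}$ as $(1+y)r = \tau(r)(1+y)$. As $1 + y$ is a unit of \<open>T\<close>,
  the contraction of every ideal of \<open>T\<close> is a \<open>\<tau>\<close>-ideal. Conversely, the series with
  coefficients in a \<open>\<tau>\<close>-ideal \<open>A\<close> form an ideal $A[[y]]$ of \<open>T\<close>, because \<open>A\<close> is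
  closed, and it is generated by \<open>A\<close>, because \<open>A\<close> is finitely generated; both properties
  are inherited from the associated graded ring by successive approximation. Hence for
  \<open>\<tau>\<close>-ideals with $AB \subseteq N = P \cap R$ one gets
  $A[[y]]\,B[[y]] \subseteq N[[y]] \subseteq P$, and primeness of \<open>P\<close> passes to
  \<open>\<tau>\<close>-primeness of \<open>N\<close>. In the other direction an ideal \<open>P\<close> maximal among those
  contracting to \<open>Q\<close> is prime. Associativity of \<open>T\<close> follows by writing left multiplication
  by \<open>a\<close> as $\sum_i a_i Y^i$ with \<open>Y\<close> the left multiplication by \<open>y\<close>.
\<close>

section \<open>Convergence in adic rings\<close>

text \<open>Two obstacles shape the proof. First, an ideal \<open>P\<close> of \<open>T\<close> is
  not known to be closed, so an infinite series with coefficients in the contraction does not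
  visibly lie in \<open>P\<close>; finite generation of the contraction turns it into a finite sum
  of products. Second, a prime of \<open>R\<close> whose \<open>\<tau>\<close>-core is the
  contraction might have an infinite orbit. Finiteness is obtained from a finite set of primes over
  the contraction such that every prime over it contains one of them: taking the preimage of a
  member under \<open>\<tau>\<close> and choosing a member below it gives a self-map of a finite
  set, and a cycle of that map supplies \<open>Q\<close> and \<open>n\<close>. The hypothesis on
  \<open>\<delta>\<close> enters twice: it makes conjugation by \<open>1 + y\<close> act as
  \<open>\<tau>\<close> on \<open>R\<close>, and it makes every \<open>\<tau>\<close>-ideal stable
  under \<open>\<delta>\<close>. Convergence is governed by one rate: moving a \<open>y\<close> past
  a coefficient either keeps the \<open>y\<close> or replaces it by a \<open>\<delta>\<close>, which
  raises the adic order by one.\<close>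

lemma (in ring) ideal_power_ideal:
  assumes "ideal I R" shows "ideal (ideal_power R I n) R"
  by (induction n) (simp_all add: oneideal ideal_prod_is_ideal assms)

lemma (in ring) finsum_lessThan_Suc:
  assumes "\<And>i. f i \<in> carrier R"
  shows "finsum R f {..<Suc n} = finsum R f {..<n} \<oplus> f n"
  using assms by (simp add: lessThan_Suc finsum_insert Pi_def a_comm)

lemma (in ring) finsum_additive:
  assumes "\<And>i. f i \<in> carrier R" "\<And>x. x \<in> carrier R \<Longrightarrow> \<phi> x \<in> carrier R" "\<phi> \<zero> = \<zero>"
    "\<And>x y. x \<in> carrier R \<Longrightarrow> y \<in> carrier R \<Longrightarrow> \<phi> (x \<oplus> y) = \<phi> x \<oplus> \<phi> y"
  shows "\<phi> (finsum R f {..<n::nat}) = finsum R (\<lambda>i. \<phi> (f i)) {..<n}"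
  by (induction n) (simp_all add: finsum_lessThan_Suc assms finsum_closed Pi_def)

lemma (in ring) finsum_swap:
  assumes "\<And>i j. g i j \<in> carrier R"
  shows "finsum R (\<lambda>i. finsum R (g i) {..<n::nat}) {..<m::nat}
    = finsum R (\<lambda>j. finsum R (\<lambda>i. g i j) {..<m}) {..<n}"
proof (induction m)
  case 0
  show ?case by (simp add: finsum_zero)
next
  case (Suc m)
  show ?case
    using Suc assms by (simp add: finsum_lessThan_Suc finsum_closed Pi_def finsum_addf)
qed

lemma (in ring) additive_finsum_mem:
  assumes "additive_subgroup L R" "\<And>i. i < n \<Longrightarrow> f i \<in> L"
  shows "finsum R f {..<n::nat} \<in> L"
  using assms(2)
proof (induction n)
  case 0
  show ?case using additive_subgroup.zero_closed[OF assms(1)] by simp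
next
  case (Suc n)
  have "\<And>i. i < Suc n \<Longrightarrow> f i \<in> carrier R"
    using Suc.prems additive_subgroup.a_Hcarr[OF assms(1)] by blast
  then have "finsum R f {..<Suc n} = f n \<oplus> finsum R f {..<n}"
    by (simp add: lessThan_Suc finsum_insert Pi_def)
  then show ?case
    using Suc additive_subgroup.a_closed[OF assms(1)] by simp
qed

locale adic_ring = ring R for R (structure) +
  fixes I :: "'a set"
  assumes ideal_I: "ideal I R"
    and separated: "adic_separated R I"
    and complete: "adic_complete R I"
begin

abbreviation pw :: "nat \<Rightarrow> 'a set"
  where "pw \<equiv> ideal_power R I"

lemma pw_ideal: "ideal (pw n) R"
  using ideal_power_ideal ideal_I .

lemma pw_sub: "additive_subgroup (pw n) R"
  using pw_ideal ideal.axioms(1) by blast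

lemma pw_carr: "x \<in> pw n \<Longrightarrow> x \<in> carrier R"
  using pw_ideal ideal.Icarr by metis

lemma pw_add: "x \<in> pw n \<Longrightarrow> y \<in> pw n \<Longrightarrow> x \<oplus> y \<in> pw n"
  using pw_sub additive_subgroup.a_closed by metis

lemma pw_uminus: "x \<in> pw n \<Longrightarrow> \<ominus> x \<in> pw n"
  using pw_ideal pw_sub additive_subgroup.a_inv_closed abelian_group_axioms by metis

lemma pw_zero [simp]: "\<zero> \<in> pw n"
  using pw_sub additive_subgroup.zero_closed by metis

lemma pw_lmult: "x \<in> pw n \<Longrightarrow> r \<in> carrier R \<Longrightarrow> r \<otimes> x \<in> pw n"
  using pw_ideal ideal.I_l_closed by metis

lemma pw_rmult: "x \<in> pw n \<Longrightarrow> r \<in> carrier R \<Longrightarrow> x \<otimes> r \<in> pw n"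
  using pw_ideal ideal.I_r_closed by metis

lemma pw_Suc_subset: "pw (Suc n) \<subseteq> pw n"
  using ideal_prod_inter[OF ideal_I pw_ideal] by auto

lemma pw_antimono: "m \<le> n \<Longrightarrow> pw n \<subseteq> pw m"
  by (rule lift_Suc_antimono_le[of pw]) (rule pw_Suc_subset)

lemma pw_weaken: "x \<in> pw n \<Longrightarrow> m \<le> n \<Longrightarrow> x \<in> pw m"
  using pw_antimono by blast

text \<open>Powers are built by multiplying with \<open>I\<close> on the left, so the outer
  induction strips factors from \<open>x\<close>; the inner one follows the generation of the ideal
  product by single products and sums.\<close>

lemma pw_mult:
  assumes "x \<in> pw a" "y \<in> pw b" shows "x \<otimes> y \<in> pw (a + b)"
  using assms(1)
proof (induction a arbitrary: x)
  case 0
  then show ?case using assms(2) pw_lmult by simp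
next
  case (Suc a)
  have "x \<in> I \<cdot> pw a" using Suc.prems by simp
  then show ?case
  proof (induction x rule: ideal_prod.induct)
    case (prod i j)
    have "i \<otimes> (j \<otimes> y) \<in> I \<cdot> pw (a + b)"
      using prod Suc.IH by (intro ideal_prod.prod)
    moreover have "i \<in> carrier R" "j \<in> carrier R" "y \<in> carrier R"
      using prod pw_carr assms(2) ideal.Icarr[OF ideal_I] by auto
    ultimately show ?case by (simp add: m_assoc)
  next
    case (sum s t)
    have "s \<in> carrier R" "t \<in> carrier R" "y \<in> carrier R"
      using sum.hyps ideal_prod_in_carrier[OF ideal_I pw_ideal] pw_carr assms(2) by auto
    then show ?case using sum.IH pw_add by (simp add: l_distr del: ideal_power.simps)
  qed
qed

text \<open>Membership in the carrier is part of the relation, so that a chain of congruences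
  carries the closure conditions along.\<close>

definition adic_cong :: "nat \<Rightarrow> 'a \<Rightarrow> 'a \<Rightarrow> bool"
  where "adic_cong m x y \<longleftrightarrow> x \<in> carrier R \<and> y \<in> carrier R \<and> x \<ominus> y \<in> pw m"

lemma adic_cong_refl: "x \<in> carrier R \<Longrightarrow> adic_cong m x x"
  by (simp add: adic_cong_def a_minus_def r_neg)

lemma adic_cong_sym: assumes "adic_cong m x y" shows "adic_cong m y x"
proof -
  have "y \<ominus> x = \<ominus> (x \<ominus> y)" using assms unfolding adic_cong_def by algebra
  then show ?thesis using assms pw_uminus unfolding adic_cong_def by auto
qed

lemma adic_cong_trans [trans]: assumes "adic_cong m x y" "adic_cong m y z" shows "adic_cong m x z"
proof -
  have "x \<ominus> z = (x \<ominus> y) \<oplus> (y \<ominus> z)" using assms unfolding adic_cong_def by algebra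
  then show ?thesis using assms pw_add unfolding adic_cong_def by auto
qed

lemma adic_cong_trans2: "adic_cong m x z \<Longrightarrow> adic_cong m y z \<Longrightarrow> adic_cong m x y"
  by (rule adic_cong_trans[OF _ adic_cong_sym])

lemma adic_cong_weaken: "adic_cong n x y \<Longrightarrow> m \<le> n \<Longrightarrow> adic_cong m x y"
  unfolding adic_cong_def using pw_weaken by blast

lemma adic_cong_add: assumes "adic_cong m x y" "adic_cong m u v" shows "adic_cong m (x \<oplus> u) (y \<oplus> v)"
proof -
  have "(x \<oplus> u) \<ominus> (y \<oplus> v) = (x \<ominus> y) \<oplus> (u \<ominus> v)" using assms unfolding adic_cong_def by algebra
  then show ?thesis using assms pw_add unfolding adic_cong_def by auto
qed

lemma adic_cong_zero: "adic_cong m x \<zero> \<longleftrightarrow> x \<in> pw m"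
  using pw_carr by (auto simp: adic_cong_def a_minus_def)

text \<open>This is where separatedness acts: equalities between limits are proved modulo every
  power of \<open>I\<close>.\<close>

lemma adic_cong_eqI:
  assumes "\<And>m. adic_cong m x y" shows "x = y"
proof -
  have "x \<ominus> y \<in> (\<Inter>m. pw m)" using assms unfolding adic_cong_def by blast
  then have "x \<ominus> y = \<zero>" using separated unfolding adic_separated_def by blast
  moreover have c: "x \<in> carrier R" "y \<in> carrier R" using assms[of 0] unfolding adic_cong_def by auto
  moreover have "x = (x \<ominus> y) \<oplus> y" using c by algebra
  ultimately show ?thesis by simp
qed

lemma adic_cong_finsum:
  assumes "\<And>i. adic_cong m (f i) (g i)"
  shows "adic_cong m (finsum R f {..<n::nat}) (finsum R g {..<n})"
proof -
  have "\<And>i. f i \<in> carrier R" "\<And>i. g i \<in> carrier R"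
    using assms unfolding adic_cong_def by auto
  then show ?thesis
    by (induction n) (simp_all add: adic_cong_refl finsum_lessThan_Suc adic_cong_add assms)
qed

text \<open>Additivity reduces the claim to the difference \<open>x \<ominus> y\<close>. The lemma
  is the continuity of one-sided multiplications, negation, \<open>\<tau>\<close> and
  \<open>\<delta>\<close>.\<close>

lemma adic_cong_additive:
  assumes "adic_cong m x y" "\<And>x. x \<in> carrier R \<Longrightarrow> \<phi> x \<in> carrier R"
    "\<And>x y. x \<in> carrier R \<Longrightarrow> y \<in> carrier R \<Longrightarrow> \<phi> (x \<oplus> y) = \<phi> x \<oplus> \<phi> y"
    "\<And>x. x \<in> pw m \<Longrightarrow> \<phi> x \<in> pw m"
  shows "adic_cong m (\<phi> x) (\<phi> y)"
proof -
  have c: "x \<in> carrier R" "y \<in> carrier R" "x \<ominus> y \<in> carrier R" "x \<ominus> y \<in> pw m"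
    using assms unfolding adic_cong_def by auto
  have "x = (x \<ominus> y) \<oplus> y" using c by algebra
  then have "\<phi> x = \<phi> (x \<ominus> y) \<oplus> \<phi> y" using assms(3) c by metis
  moreover have "\<phi> (x \<ominus> y) \<in> carrier R" "\<phi> y \<in> carrier R" using assms(2) c by auto
  ultimately have "\<phi> x \<ominus> \<phi> y = \<phi> (x \<ominus> y)" by algebra
  then show ?thesis using assms(2,4) c unfolding adic_cong_def by auto
qed

text \<open>A series whose \<open>i\<close>-th term lies in $I^{i-d}$ (truncated subtraction) converges
  with an explicit rate; all series in the product of \<open>T\<close> are of this kind.\<close>

definition adm :: "nat \<Rightarrow> (nat \<Rightarrow> 'a) \<Rightarrow> bool"
  where "adm d f \<longleftrightarrow> (\<forall>i. f i \<in> pw (i - d))"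

definition ssum :: "(nat \<Rightarrow> 'a) \<Rightarrow> 'a"
  where "ssum f = adic_lim R I (\<lambda>N. finsum R f {..<N})"

lemma adm_carr: "adm d f \<Longrightarrow> f i \<in> carrier R"
  unfolding adm_def using pw_carr by blast

lemma adm_psum_carr: "adm d f \<Longrightarrow> finsum R f {..<n} \<in> carrier R"
  by (simp add: adm_carr finsum_closed Pi_def)

lemma adm_cong_psum:
  assumes "adm d f" "m + d \<le> N"
  shows "adic_cong m (finsum R f {..<N}) (finsum R f {..<m + d})"
  using assms(2)
proof (induction N rule: dec_induct)
  case base
  show ?case using assms(1) by (simp add: adic_cong_refl adm_psum_carr)
next
  case (step N)
  have "f N \<in> pw m" using assms(1) step(1) pw_weaken[of "f N" "N - d" m] unfolding adm_def by auto
  then have "adic_cong m (finsum R f {..<N} \<oplus> f N) (finsum R f {..<m + d} \<oplus> \<zero>)"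
    using step adic_cong_add adic_cong_zero by blast
  then show ?case using assms(1) by (simp add: finsum_lessThan_Suc adm_carr adm_psum_carr)
qed

text \<open>From index \<open>m + d\<close> on all terms lie in \<open>pw m\<close>, so the partial
  sums are Cauchy. Completeness gives a limit, and separatedness makes it unique, as the description
  in \<open>adic_lim\<close> demands.\<close>

lemma ssum_props:
  assumes "adm d f"
  shows "ssum f \<in> carrier R" "m + d \<le> N \<Longrightarrow> adic_cong m (ssum f) (finsum R f {..<N})"
proof -
  let ?x = "\<lambda>N. finsum R f {..<N}"
  have c: "?x N \<in> carrier R" for N using adm_psum_carr[OF assms] .
  have cauchy: "adic_Cauchy R I ?x"
    unfolding adic_Cauchy_def
  proof (intro allI exI impI)
    fix m k l :: nat assume "m + d \<le> k" "m + d \<le> l"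
    then have "adic_cong m (?x k) (?x l)"
      by (intro adic_cong_trans2[OF adm_cong_psum[OF assms] adm_cong_psum[OF assms]])
    then show "?x k \<ominus> ?x l \<in> pw m" unfolding adic_cong_def by blast
  qed
  then obtain l where l: "l \<in> carrier R" "adic_tendsto R I ?x l"
    using complete[unfolded adic_complete_def, rule_format, of ?x] c cauchy by blast
  \<comment> \<open>Convergence only says that some late partial sum is close to the limit; that sum
    agrees with \<open>?x N\<close> modulo \<open>pw m\<close>, which recovers the explicit bound
    \<open>m + d\<close>.\<close>
  have lim: "adic_cong m l' (?x N)" if t: "l' \<in> carrier R" "adic_tendsto R I ?x l'" "m + d \<le> N" for m N l'
  proof -
    obtain K where "\<forall>k\<ge>K. ?x k \<ominus> l' \<in> pw m" using t unfolding adic_tendsto_def by blast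
    then have "adic_cong m (?x (max K N)) l'" using t c unfolding adic_cong_def by auto
    moreover have "adic_cong m (?x (max K N)) (?x N)"
      using t(3) by (intro adic_cong_trans2[OF adm_cong_psum[OF assms] adm_cong_psum[OF assms]]) auto
    ultimately show ?thesis by (rule adic_cong_trans[OF adic_cong_sym])
  qed
  have "l' = l" if "l' \<in> carrier R" "adic_tendsto R I ?x l'" for l'
    by (rule adic_cong_eqI, rule adic_cong_trans2[OF lim[OF that order.refl] lim[OF l order.refl]])
  then have "ssum f = l" unfolding ssum_def adic_lim_def using l by blast
  then show "ssum f \<in> carrier R" "m + d \<le> N \<Longrightarrow> adic_cong m (ssum f) (?x N)" using l lim by auto
qed

lemma ssum_eqI:
  assumes "adm d f" "\<And>m. adic_cong m x (finsum R f {..<m + d})"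
  shows "ssum f = x"
  by (rule adic_cong_eqI, rule adic_cong_trans2[OF ssum_props(2)[OF assms(1) order.refl] assms(2)])

lemma ssum_cong: "(\<And>i. f i = g i) \<Longrightarrow> ssum f = ssum g"
  by presburger

lemma adm_weaken: "adm d f \<Longrightarrow> d \<le> e \<Longrightarrow> adm e f"
  unfolding adm_def using pw_weaken diff_le_mono2 by blast

lemma adm_add: "adm d f \<Longrightarrow> adm d g \<Longrightarrow> adm d (\<lambda>i. f i \<oplus> g i)"
  unfolding adm_def using pw_add by blast

lemma ssum_add:
  assumes "adm d f" "adm d g"
  shows "ssum (\<lambda>i. f i \<oplus> g i) = ssum f \<oplus> ssum g"
proof (rule ssum_eqI[OF adm_add[OF assms]])
  fix m
  have "finsum R (\<lambda>i. f i \<oplus> g i) {..<m + d} = finsum R f {..<m + d} \<oplus> finsum R g {..<m + d}"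
    using assms by (simp add: finsum_addf adm_carr Pi_def)
  then show "adic_cong m (ssum f \<oplus> ssum g) (finsum R (\<lambda>i. f i \<oplus> g i) {..<m + d})"
    using assms by (simp add: adic_cong_add ssum_props)
qed

lemma ssum_additive:
  assumes "adm d f" "\<And>x. x \<in> carrier R \<Longrightarrow> \<phi> x \<in> carrier R" "\<phi> \<zero> = \<zero>"
    "\<And>x y. x \<in> carrier R \<Longrightarrow> y \<in> carrier R \<Longrightarrow> \<phi> (x \<oplus> y) = \<phi> x \<oplus> \<phi> y"
    "\<And>x m. x \<in> pw m \<Longrightarrow> \<phi> x \<in> pw m"
  shows "\<phi> (ssum f) = ssum (\<lambda>i. \<phi> (f i))"
proof (rule ssum_eqI[symmetric])
  show "adm d (\<lambda>i. \<phi> (f i))" using assms(1,5) unfolding adm_def by blast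
  fix m
  have "finsum R (\<lambda>i. \<phi> (f i)) {..<m + d} = \<phi> (finsum R f {..<m + d})"
    using finsum_additive[of f \<phi>] assms(2-4) adm_carr[OF assms(1)] by simp
  then show "adic_cong m (\<phi> (ssum f)) (finsum R (\<lambda>i. \<phi> (f i)) {..<m + d})"
    using adic_cong_additive[OF ssum_props(2)[OF assms(1) order.refl]] assms(2,4,5) by simp
qed

lemma ssum_lmult: "adm d f \<Longrightarrow> r \<in> carrier R \<Longrightarrow> r \<otimes> ssum f = ssum (\<lambda>i. r \<otimes> f i)"
  by (rule ssum_additive) (auto simp: r_distr pw_lmult)

lemma ssum_rmult: "adm d f \<Longrightarrow> r \<in> carrier R \<Longrightarrow> ssum f \<otimes> r = ssum (\<lambda>i. f i \<otimes> r)"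
  by (rule ssum_additive[where \<phi> = "\<lambda>x. x \<otimes> r"]) (auto simp: l_distr pw_rmult)

lemma ssum_single:
  assumes "f p \<in> carrier R" "\<And>i. i \<noteq> p \<Longrightarrow> f i = \<zero>"
  shows "ssum f = f p"
proof (rule ssum_eqI)
  have c: "\<And>i. f i \<in> carrier R" using assms by (metis zero_closed)
  \<comment> \<open>With \<open>d = Suc p\<close> the exponent \<open>i - d\<close> is 0 at
    \<open>i = p\<close>, where \<open>pw 0\<close> is the whole ring, and each partial sum over
    \<open>{..<m + d}\<close> already contains the term \<open>p\<close>.\<close>
  show "adm (Suc p) f"
    unfolding adm_def
  proof
    fix i show "f i \<in> pw (i - Suc p)" using assms by (cases "i = p") auto
  qed
  have "finsum R f {..<n} = (if p < n then f p else \<zero>)" for n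
    by (induction n) (auto simp: finsum_lessThan_Suc c assms less_Suc_eq)
  then show "adic_cong m (f p) (finsum R f {..<m + Suc p})" for m
    using assms adic_cong_refl by simp
qed

text \<open>Prepending a zero costs one in the rate and nothing in the limit. It reindexes the terms
  in which left multiplication by \<open>y\<close> raises the exponent of \<open>y\<close>.\<close>

lemma ssum_shift:
  assumes "adm d f"
  shows "ssum (\<lambda>i. if i = 0 then \<zero> else f (i - 1)) = ssum f"
proof (rule ssum_eqI)
  let ?g = "\<lambda>i. if i = 0 then \<zero> else f (i - 1)"
  have c: "?g i \<in> carrier R" for i using adm_carr[OF assms] by auto
  show "adm (Suc d) ?g"
    unfolding adm_def
  proof
    fix i show "?g i \<in> pw (i - Suc d)" using assms unfolding adm_def by (cases i) auto
  qed
  have "finsum R ?g {..<Suc n} = finsum R f {..<n}" for n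
  proof (induction n)
    case 0
    show ?case using finsum_lessThan_Suc[of ?g, OF c, of 0] by simp
  next
    case (Suc n)
    then show ?case
      using finsum_lessThan_Suc[of ?g, OF c, of "Suc n"] finsum_lessThan_Suc[of f, OF adm_carr[OF assms]]
      by simp
  qed
  then show "adic_cong m (ssum f) (finsum R ?g {..<m + Suc d})" for m
    using ssum_props(2)[OF assms order.refl] by simp
qed

section \<open>Closed sets and interchange of infinite sums\<close>

definition adic_closed :: "'a set \<Rightarrow> bool"
  where "adic_closed L \<longleftrightarrow> (\<forall>x\<in>carrier R. (\<forall>m. \<exists>l\<in>L. adic_cong m x l) \<longrightarrow> x \<in> L)"

lemma ssum_mem_closed:
  assumes "adm d f" "additive_subgroup L R" "adic_closed L" "\<And>i. f i \<in> L"
  shows "ssum f \<in> L"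
proof -
  have "\<forall>m. \<exists>l\<in>L. adic_cong m (ssum f) l"
    by (intro allI bexI) (rule ssum_props(2)[OF assms(1) order.refl], rule additive_finsum_mem[OF assms(2,4)])
  then show ?thesis
    using assms(3)[unfolded adic_closed_def, rule_format, of "ssum f"] ssum_props(1)[OF assms(1)] by simp
qed

lemma pw_closed: "adic_closed (pw n)"
  unfolding adic_closed_def
proof (intro ballI impI)
  fix x assume "\<forall>m. \<exists>l\<in>pw n. adic_cong m x l"
  then obtain l where "l \<in> pw n" "adic_cong n x l" by blast
  then show "x \<in> pw n" using adic_cong_trans[of n x l \<zero>] adic_cong_zero by simp
qed

lemma ssum_pw: "adm d f \<Longrightarrow> (\<And>i. f i \<in> pw n) \<Longrightarrow> ssum f \<in> pw n"
  using ssum_mem_closed pw_sub pw_closed by blast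

text \<open>Since the terms decay in each index uniformly in the other, both iterated sums agree
  modulo \<open>pw m\<close> with the same finite sum over the square of side
  \<open>m + d\<close>.\<close>

lemma ssum_swap:
  assumes "\<And>i j. g i j \<in> pw (i - d)" "\<And>i j. g i j \<in> pw (j - d)"
  shows "ssum (\<lambda>i. ssum (g i)) = ssum (\<lambda>j. ssum (\<lambda>i. g i j))"
proof -
  have c: "g i j \<in> carrier R" for i j using assms(1) pw_carr by blast
  have a1: "adm d (g i)" for i using assms(2) unfolding adm_def by blast
  have a2: "adm d (\<lambda>i. g i j)" for j using assms(1) unfolding adm_def by blast
  have b1: "adm d (\<lambda>i. ssum (g i))"
    using ssum_pw[OF a1] assms(1) by (subst adm_def) blast
  have b2: "adm d (\<lambda>j. ssum (\<lambda>i. g i j))"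
    using ssum_pw[OF a2] assms(2) by (subst adm_def) blast
  show ?thesis
  proof (rule ssum_eqI[OF b1])
    fix m
    have "adic_cong m (ssum (\<lambda>j. ssum (\<lambda>i. g i j))) (finsum R (\<lambda>j. ssum (\<lambda>i. g i j)) {..<m + d})"
      by (rule ssum_props(2)[OF b2]) simp
    also have "adic_cong m \<dots> (finsum R (\<lambda>j. finsum R (\<lambda>i. g i j) {..<m + d}) {..<m + d})"
      by (rule adic_cong_finsum, rule ssum_props(2)[OF a2]) simp
    also have "\<dots> = finsum R (\<lambda>i. finsum R (g i) {..<m + d}) {..<m + d}"
      using finsum_swap[of "\<lambda>i j. g j i"] c by simp
    also have "adic_cong m \<dots> (finsum R (\<lambda>i. ssum (g i)) {..<m + d})"
      by (rule adic_cong_finsum, rule adic_cong_sym, rule ssum_props(2)[OF a1]) simp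
    finally show "adic_cong m (ssum (\<lambda>j. ssum (\<lambda>i. g i j))) (finsum R (\<lambda>i. ssum (g i)) {..<m + d})" .
  qed
qed

end

section \<open>The skew power series ring\<close>

lemma (in adic_ring) adm_finsum: "(\<And>j. adm d (g j)) \<Longrightarrow> adm d (\<lambda>i. finsum R (\<lambda>j. g j i) {..<n::nat})"
  unfolding adm_def by (auto intro: additive_finsum_mem[OF pw_sub])

lemma (in adic_ring) ssum_finsum:
  assumes "\<And>j. adm d (g j)"
  shows "finsum R (\<lambda>j. ssum (g j)) {..<n::nat} = ssum (\<lambda>i. finsum R (\<lambda>j. g j i) {..<n})"
proof (induction n)
  case 0
  show ?case using ssum_single[of "\<lambda>i. \<zero>" 0] by simp
next
  case (Suc n)
  have "finsum R (\<lambda>j. ssum (g j)) {..<Suc n} = ssum (\<lambda>i. finsum R (\<lambda>j. g j i) {..<n} \<oplus> g n i)"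
    using Suc assms by (simp add: finsum_lessThan_Suc ssum_props(1)[OF assms] ssum_add[OF adm_finsum assms] assms)
  then show ?case
    using adm_carr[OF assms] by (simp add: finsum_lessThan_Suc)
qed

locale skew_series = adic_ring R I for R (structure) and I +
  fixes \<tau> \<delta> :: "'a \<Rightarrow> 'a"
  assumes tau_iso: "\<tau> \<in> ring_iso R R"
    and delta: "left_skew_derivation R \<tau> \<delta>"
    and tau_I: "\<tau> ` I = I"
    and delta_R: "\<delta> ` carrier R \<subseteq> I"
    and delta_I: "\<delta> ` I \<subseteq> pw 2"
begin

abbreviation Y where "Y \<equiv> skew_shift R \<tau> \<delta>"
abbreviation T where "T \<equiv> skew_power_series_ring R I \<tau> \<delta>"
abbreviation C where "C \<equiv> (UNIV :: nat set) \<rightarrow> carrier R"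

section \<open>The maps \<tau> and \<delta> on the adic filtration\<close>

lemma tau_hom: "\<tau> \<in> ring_hom R R"
  using tau_iso unfolding ring_iso_def by blast

lemma tau_closed [simp]: "x \<in> carrier R \<Longrightarrow> \<tau> x \<in> carrier R"
  using ring_hom_closed[OF tau_hom] .

lemma tau_add: "x \<in> carrier R \<Longrightarrow> y \<in> carrier R \<Longrightarrow> \<tau> (x \<oplus> y) = \<tau> x \<oplus> \<tau> y"
  using ring_hom_add[OF tau_hom] .

lemma tau_mult: "x \<in> carrier R \<Longrightarrow> y \<in> carrier R \<Longrightarrow> \<tau> (x \<otimes> y) = \<tau> x \<otimes> \<tau> y"
  using ring_hom_mult[OF tau_hom] .

lemma tau_one [simp]: "\<tau> \<one> = \<one>"
  using ring_hom_one[OF tau_hom] .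

lemma tau_0 [simp]: "\<tau> \<zero> = \<zero>"
  using tau_zero[OF ring_axioms tau_hom delta] .

lemma delta_closed [simp]: "x \<in> carrier R \<Longrightarrow> \<delta> x \<in> carrier R"
  using delta unfolding left_skew_derivation_def by blast

lemma delta_add: "x \<in> carrier R \<Longrightarrow> y \<in> carrier R \<Longrightarrow> \<delta> (x \<oplus> y) = \<delta> x \<oplus> \<delta> y"
  using delta unfolding left_skew_derivation_def by blast

lemma delta_mult:
  "x \<in> carrier R \<Longrightarrow> y \<in> carrier R \<Longrightarrow> \<delta> (x \<otimes> y) = \<tau> x \<otimes> \<delta> y \<oplus> \<delta> x \<otimes> y"
  using delta unfolding left_skew_derivation_def by blast

lemma delta_0 [simp]: "\<delta> \<zero> = \<zero>"
  using delta_zero[OF ring_axioms tau_hom delta] .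

lemma tau_pw: "x \<in> pw n \<Longrightarrow> \<tau> x \<in> pw n"
proof (induction n arbitrary: x)
  case 0
  then show ?case by simp
next
  case (Suc n)
  have "x \<in> I \<cdot> pw n" using Suc.prems by simp
  then have "\<tau> x \<in> I \<cdot> pw n"
  proof (induction x rule: ideal_prod.induct)
    case (prod i j)
    have "i \<in> carrier R" "j \<in> carrier R" using prod pw_carr ideal.Icarr[OF ideal_I] by auto
    moreover have "\<tau> i \<otimes> \<tau> j \<in> I \<cdot> pw n"
      using prod Suc.IH tau_I by (intro ideal_prod.prod) auto
    ultimately show ?case by (simp add: tau_mult)
  next
    case (sum s t)
    have "s \<in> carrier R" "t \<in> carrier R"
      using sum.hyps ideal_prod_in_carrier[OF ideal_I pw_ideal] by auto
    then show ?case using sum.IH ideal_prod.sum by (simp add: tau_add)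
  qed
  then show ?case by simp
qed

text \<open>By the skew Leibniz rule, in \<open>\<tau> i \<otimes> \<delta> j\<close> the extra
  power comes from the induction hypothesis for \<open>j\<close>, and in
  \<open>\<delta> i \<otimes> j\<close> from \<open>\<delta> i \<in> pw 2\<close>.\<close>

lemma delta_pw: "x \<in> pw n \<Longrightarrow> \<delta> x \<in> pw (Suc n)"
proof (induction n arbitrary: x)
  case 0
  \<comment> \<open>\<open>pw 1\<close> unfolds to the product of \<open>I\<close> with the whole
    ring, hence the factor \<open>\<one>\<close>.\<close>
  then have "\<delta> x \<otimes> \<one> \<in> I \<cdot> carrier R" using delta_R by (intro ideal_prod.prod) auto
  then show ?case using 0 by simp
next
  case (Suc n)
  have "x \<in> I \<cdot> pw n" using Suc.prems by simp
  then show ?case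
  proof (induction x rule: ideal_prod.induct)
    case (prod i j)
    have c: "i \<in> carrier R" "j \<in> carrier R" using prod pw_carr ideal.Icarr[OF ideal_I] by auto
    have "\<tau> i \<otimes> \<delta> j \<in> I \<cdot> pw (Suc n)"
      using prod Suc.IH tau_I by (intro ideal_prod.prod) auto
    moreover have "\<delta> i \<otimes> j \<in> pw (2 + n)"
      using prod delta_I by (intro pw_mult) auto
    ultimately show ?case using c pw_add[of "\<tau> i \<otimes> \<delta> j" "Suc (Suc n)"] by (simp add: delta_mult)
  next
    case (sum s t)
    have "s \<in> carrier R" "t \<in> carrier R"
      using sum.hyps ideal_prod_in_carrier[OF ideal_I pw_ideal] by auto
    then show ?case using sum.IH pw_add by (simp add: delta_add del: ideal_power.simps)
  qed
qed

lemma delta_pw': "x \<in> pw n \<Longrightarrow> \<delta> x \<in> pw n"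
  using delta_pw pw_weaken by (meson le_SucI order_refl)

section \<open>Left multiplication by y on coefficient sequences\<close>

lemma Y_apply: "Y q n = (if n = 0 then \<zero> else \<tau> (q (n - 1))) \<oplus> \<delta> (q n)"
  by (simp add: skew_shift_def)

lemma Ypow_Suc:
  "(Y ^^ Suc i) q n = (if n = 0 then \<zero> else \<tau> ((Y ^^ i) q (n - 1))) \<oplus> \<delta> ((Y ^^ i) q n)"
  using Y_apply[of "(Y ^^ i) q" n] by simp

lemma Ypow_C: "q \<in> C \<Longrightarrow> (Y ^^ i) q \<in> C"
  using skew_shift_pow_closed[OF ring_axioms tau_hom delta] .

lemma Ypow_carr: "q \<in> C \<Longrightarrow> (Y ^^ i) q n \<in> carrier R"
  using Ypow_C by blast

text \<open>Each of the \<open>i\<close> steps either shifts the index through \<open>\<tau>\<close>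
  or gains a power of \<open>I\<close> through \<open>\<delta>\<close>, and at most \<open>n\<close>
  shifts can end at index \<open>n\<close>. This is the origin of the rate \<open>adm n\<close> for
  the coefficient of \<open>y^n\<close> in a product.\<close>

lemma Ypow_pw: "q \<in> C \<Longrightarrow> (Y ^^ i) q n \<in> pw (i - n)"
proof (induction i arbitrary: n)
  case 0
  then show ?case by (auto simp: Pi_def)
next
  case (Suc i)
  have "\<delta> ((Y ^^ i) q n) \<in> pw (Suc i - n)"
    using delta_pw[OF Suc.IH[OF Suc.prems, of n]] by (rule pw_weaken) simp
  moreover have "(if n = 0 then \<zero> else \<tau> ((Y ^^ i) q (n - 1))) \<in> pw (Suc i - n)"
    using tau_pw[OF Suc.IH[OF Suc.prems, of "n - 1"]] by (cases n) (auto simp del: ideal_power.simps)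
  ultimately show ?case by (simp add: Ypow_Suc pw_add del: funpow.simps ideal_power.simps)
qed

lemma const_C: "r \<in> carrier R \<Longrightarrow> const_series R r \<in> C"
  by (auto simp: const_series_def)

text \<open>Left multiplication by \<open>y\<close> commutes with right multiplication by
  \<open>y^j\<close>, so \<open>y^i b\<close> is the sum of the series \<open>y^i b_j\<close>, each
  shifted by \<open>j\<close>. This links the coefficients \<open>skew_theta\<close> in the
  definition of \<open>T\<close> to powers of one operator on whole series.\<close>

lemma Ypow_eq_finsum:
  assumes b: "b \<in> C"
  shows "(Y ^^ i) b n = finsum R (\<lambda>j. (Y ^^ i) (const_series R (b j)) (n - j)) {..<Suc n}"
proof (induction i arbitrary: n)
  case 0
  have bc: "b j \<in> carrier R" for j using b by blast
  have "finsum R (\<lambda>j. const_series R (b j) (n - j)) {..<n} = finsum R (\<lambda>j. \<zero>) {..<n}"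
    by (rule finsum_cong') (auto simp: const_series_def)
  then have "finsum R (\<lambda>j. const_series R (b j) (n - j)) {..<Suc n} = b n"
    using bc by (subst finsum_lessThan_Suc) (auto simp: const_series_def)
  then show ?case by simp
next
  case (Suc i)
  let ?F = "\<lambda>n j. (Y ^^ i) (const_series R (b j)) (n - j)"
  let ?G = "\<lambda>n j. (Y ^^ Suc i) (const_series R (b j)) (n - j)"
  have F: "?F n j \<in> carrier R" for n j using b by (intro Ypow_carr const_C) blast
  have G: "?G n j \<in> carrier R" for n j using b by (intro Ypow_carr const_C) blast
  have S: "finsum R (?F n) {..<k} \<in> carrier R" for n k using F by (simp add: finsum_closed Pi_def)
  have tau: "\<tau> (finsum R (?F n) {..<k}) = finsum R (\<lambda>j. \<tau> (?F n j)) {..<k}" for n k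
    by (rule finsum_additive[OF F]) (auto simp: tau_add)
  have del: "\<delta> (finsum R (?F n) {..<k}) = finsum R (\<lambda>j. \<delta> (?F n j)) {..<k}" for n k
    by (rule finsum_additive[OF F]) (auto simp: delta_add)
  show ?case
  proof (cases n)
    case 0
    then show ?thesis
      using Suc.IH[of 0] F[of 0 0] by (simp add: Ypow_Suc lessThan_Suc del: funpow.simps)
  next
    case (Suc m)
    \<comment> \<open>The index \<open>j = n\<close> is kept apart: there \<open>n - j = 0\<close>,
      so \<open>?G n n\<close> has only a \<open>\<delta>\<close> part, while for
      \<open>j < n\<close> the difference \<open>n - j\<close> is a successor.\<close>
    have "finsum R (?G n) {..<Suc m} = finsum R (\<lambda>j. \<tau> (?F m j) \<oplus> \<delta> (?F n j)) {..<Suc m}"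
    proof (intro finsum_cong' refl)
      show "(\<lambda>j. \<tau> (?F m j) \<oplus> \<delta> (?F n j)) \<in> {..<Suc m} \<rightarrow> carrier R" using F by auto
      fix j assume "j \<in> {..<Suc m}"
      then have "n - j = Suc (m - j)" using Suc by auto
      then show "?G n j = \<tau> (?F m j) \<oplus> \<delta> (?F n j)" by (simp add: Ypow_Suc del: funpow.simps)
    qed
    also have "\<dots> = \<tau> (finsum R (?F m) {..<Suc m}) \<oplus> \<delta> (finsum R (?F n) {..<Suc m})"
      unfolding tau del using F by (intro finsum_addf) auto
    finally have "finsum R (?G n) {..<Suc n} =
      \<tau> (finsum R (?F m) {..<Suc m}) \<oplus> \<delta> (finsum R (?F n) {..<Suc m}) \<oplus> \<delta> (?F n n)"
      using finsum_lessThan_Suc[of "?G n", OF G, of n] F[of n n] by (simp add: Suc Ypow_Suc del: funpow.simps)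
    also have "\<dots> = \<tau> (finsum R (?F m) {..<Suc m}) \<oplus> \<delta> (finsum R (?F n) {..<Suc n})"
      using finsum_lessThan_Suc[of "?F n", OF F, of n] F[of n n] S[of n "Suc m"] S[of m "Suc m"]
      by (simp add: Suc delta_add a_assoc)
    also have "\<dots> = (Y ^^ Suc i) b n"
      using Suc.IH[of m] Suc.IH[of n] by (simp add: Ypow_Suc Suc del: funpow.simps)
    finally show ?thesis by simp
  qed
qed

text \<open>The product of \<open>T\<close> with the finite sum over \<open>j\<close> moved inside
  the limit, which leaves one convergent series per coefficient; \<open>T_mult\<close> identifies
  the two forms.\<close>

definition series_mult :: "(nat \<Rightarrow> 'a) \<Rightarrow> (nat \<Rightarrow> 'a) \<Rightarrow> nat \<Rightarrow> 'a"
  where "series_mult a b n = ssum (\<lambda>i. a i \<otimes> (Y ^^ i) b n)"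

lemma series_mult_adm: "a \<in> C \<Longrightarrow> b \<in> C \<Longrightarrow> adm n (\<lambda>i. a i \<otimes> (Y ^^ i) b n)"
  unfolding adm_def by (auto intro!: pw_lmult Ypow_pw)

lemma series_mult_C: "a \<in> C \<Longrightarrow> b \<in> C \<Longrightarrow> series_mult a b \<in> C"
  using ssum_props(1)[OF series_mult_adm] by (auto simp: series_mult_def)

lemma T_carrier: "carrier T = C"
  by (simp add: skew_power_series_ring_def)

lemma T_add: "a \<oplus>\<^bsub>T\<^esub> b = (\<lambda>n. a n \<oplus> b n)"
  by (simp add: skew_power_series_ring_def)

lemma T_one: "\<one>\<^bsub>T\<^esub> = const_series R \<one>"
  by (simp add: skew_power_series_ring_def)

lemma T_zero: "\<zero>\<^bsub>T\<^esub> = (\<lambda>n. \<zero>)"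
  by (simp add: skew_power_series_ring_def const_series_def)

lemma T_mult:
  assumes "a \<in> C" "b \<in> C"
  shows "a \<otimes>\<^bsub>T\<^esub> b = series_mult a b"
proof
  fix n
  let ?F = "\<lambda>j i. (Y ^^ i) (const_series R (b j)) (n - j)"
  have c: "a i \<in> carrier R" "b i \<in> carrier R" for i using assms by auto
  have F: "?F j i \<in> carrier R" for i j using c by (intro Ypow_carr const_C)
  \<comment> \<open>The series for \<open>j\<close> has the rate \<open>n - j\<close>; all are
    weakened to the common rate \<open>n\<close>, so that their finite sum is again a single series
    of this kind.\<close>
  have adm: "adm n (\<lambda>i. a i \<otimes> ?F j i)" for j
    using c by (intro adm_weaken[OF series_mult_adm[OF assms(1)], of _ "n - j"] const_C) auto
  have "(a \<otimes>\<^bsub>T\<^esub> b) n = finsum R (\<lambda>j. ssum (\<lambda>i. a i \<otimes> ?F j i)) {..<Suc n}"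
    using c by (simp add: skew_power_series_ring_def ssum_def lessThan_Suc_atMost
        skew_theta_eq[OF ring_axioms tau_hom delta])
  also have "\<dots> = ssum (\<lambda>i. finsum R (\<lambda>j. a i \<otimes> ?F j i) {..<Suc n})"
    by (rule ssum_finsum[OF adm])
  also have "\<dots> = ssum (\<lambda>i. a i \<otimes> finsum R (\<lambda>j. ?F j i) {..<Suc n})"
    by (intro ssum_cong finsum_additive[symmetric] F) (auto simp: c r_distr)
  also have "\<dots> = series_mult a b n"
    unfolding series_mult_def using Ypow_eq_finsum[OF assms(2)] by simp
  finally show "(a \<otimes>\<^bsub>T\<^esub> b) n = series_mult a b n" .
qed

section \<open>Distributivity, associativity and unit of the power series product\<close>

lemma Y_add: "p \<in> C \<Longrightarrow> q \<in> C \<Longrightarrow> Y (\<lambda>n. p n \<oplus> q n) = (\<lambda>n. Y p n \<oplus> Y q n)"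
proof
  fix n assume "p \<in> C" "q \<in> C"
  then have c: "p k \<in> carrier R" "q k \<in> carrier R" for k by auto
  show "Y (\<lambda>n. p n \<oplus> q n) n = Y p n \<oplus> Y q n"
    using c by (simp add: Y_apply tau_add delta_add a_ac)
qed

lemma Ypow_add: "p \<in> C \<Longrightarrow> q \<in> C \<Longrightarrow> (Y ^^ i) (\<lambda>n. p n \<oplus> q n) = (\<lambda>n. (Y ^^ i) p n \<oplus> (Y ^^ i) q n)"
  by (induction i) (simp_all add: Y_add Ypow_C)

lemma series_mult_add_left:
  assumes "a \<in> C" "b \<in> C" "c \<in> C"
  shows "series_mult (\<lambda>n. a n \<oplus> b n) c n = series_mult a c n \<oplus> series_mult b c n"
proof -
  have "series_mult (\<lambda>n. a n \<oplus> b n) c n = ssum (\<lambda>i. a i \<otimes> (Y ^^ i) c n \<oplus> b i \<otimes> (Y ^^ i) c n)"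
    unfolding series_mult_def using assms Ypow_carr[OF assms(3)]
    by (intro ssum_cong l_distr) auto
  then show ?thesis
    unfolding series_mult_def using ssum_add[OF series_mult_adm series_mult_adm] assms by simp
qed

lemma series_mult_add_right:
  assumes "a \<in> C" "b \<in> C" "c \<in> C"
  shows "series_mult a (\<lambda>n. b n \<oplus> c n) n = series_mult a b n \<oplus> series_mult a c n"
proof -
  have "series_mult a (\<lambda>n. b n \<oplus> c n) n = ssum (\<lambda>i. a i \<otimes> (Y ^^ i) b n \<oplus> a i \<otimes> (Y ^^ i) c n)"
    unfolding series_mult_def Ypow_add[OF assms(2,3)] using assms Ypow_carr
    by (intro ssum_cong r_distr) auto
  then show ?thesis
    unfolding series_mult_def using ssum_add[OF series_mult_adm series_mult_adm] assms by simp
qed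

text \<open>This is associativity for the left factor \<open>y\<close>. By induction it passes to
  powers of \<open>y\<close>, and general left factors are then handled by summation. The proof is
  the skew Leibniz rule applied under the limit, followed by a shift of the summation index.\<close>

lemma Y_series_mult:
  assumes b: "b \<in> C" and c: "c \<in> C"
  shows "Y (series_mult b c) = series_mult (Y b) c"
proof
  fix n
  let ?c = "\<lambda>i. (Y ^^ i) c"
  let ?pt = "if n = 0 then \<zero> else \<tau> (series_mult b c (n - 1))"
  \<comment> \<open>\<open>Y b\<close> is the coefficientwise sum of \<open>?pre\<close>, its
    shifted part, and of \<open>\<delta>\<close> applied to the coefficients of
    \<open>b\<close>.\<close>
  let ?pre = "\<lambda>i. if i = 0 then \<zero> else \<tau> (b (i - 1))"
  have carr [simp]: "b i \<in> carrier R" "?c i k \<in> carrier R" for i k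
    using b Ypow_carr[OF c] by auto
  have tb: "(\<lambda>i. \<tau> (b i)) \<in> C" and db: "(\<lambda>i. \<delta> (b i)) \<in> C" and pre: "?pre \<in> C" using b by auto
  have adm1: "adm n (\<lambda>i. if n = 0 then \<zero> else \<tau> (b i \<otimes> ?c i (n - 1)))"
    unfolding adm_def
  proof
    fix i
    have "b i \<otimes> ?c i (n - 1) \<in> pw (i - n)"
      using series_mult_adm[OF b c, of "n - 1", unfolded adm_def, THEN spec, of i] by (rule pw_weaken) simp
    then show "(if n = 0 then \<zero> else \<tau> (b i \<otimes> ?c i (n - 1))) \<in> pw (i - n)"
      by (simp add: tau_pw)
  qed
  have adm2: "adm n (\<lambda>i. \<delta> (b i \<otimes> ?c i n))"
    unfolding adm_def using series_mult_adm[OF b c, of n] delta_pw' by (auto simp: adm_def)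
  have adm3: "adm n (\<lambda>i. \<tau> (b i) \<otimes> ?c (Suc i) n)"
    unfolding adm_def
  proof
    fix i show "\<tau> (b i) \<otimes> ?c (Suc i) n \<in> pw (i - n)"
      using pw_weaken[OF Ypow_pw[OF c, of "Suc i" n], of "i - n"] by (intro pw_lmult) auto
  qed
  have "?pt = ssum (\<lambda>i. if n = 0 then \<zero> else \<tau> (b i \<otimes> ?c i (n - 1)))"
  proof (cases "n = 0")
    case True
    then show ?thesis using ssum_single[of "\<lambda>i. \<zero>" 0] by simp
  next
    case False
    then show ?thesis
      unfolding series_mult_def using ssum_additive[OF series_mult_adm[OF b c], of \<tau> "n - 1"] tau_pw
      by (simp add: tau_add)
  qed
  moreover have "\<delta> (series_mult b c n) = ssum (\<lambda>i. \<delta> (b i \<otimes> ?c i n))"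
    unfolding series_mult_def by (rule ssum_additive[OF series_mult_adm[OF b c]]) (auto simp: delta_add delta_pw')
  ultimately have "Y (series_mult b c) n =
      ssum (\<lambda>i. (if n = 0 then \<zero> else \<tau> (b i \<otimes> ?c i (n - 1))) \<oplus> \<delta> (b i \<otimes> ?c i n))"
    using ssum_add[OF adm1 adm2] Y_apply[of "series_mult b c" n] by simp
  \<comment> \<open>The two terms with the factor \<open>\<tau> (b i)\<close> combine, because
    \<open>\<tau> (?c i (n - 1)) \<oplus> \<delta> (?c i n)\<close> is \<open>?c (Suc i) n\<close>;
    for \<open>n = 0\<close> its first summand is absent.\<close>
  also have "\<dots> = ssum (\<lambda>i. \<tau> (b i) \<otimes> ?c (Suc i) n \<oplus> \<delta> (b i) \<otimes> ?c i n)"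
  proof (rule ssum_cong)
    fix i
    show "(if n = 0 then \<zero> else \<tau> (b i \<otimes> ?c i (n - 1))) \<oplus> \<delta> (b i \<otimes> ?c i n) =
      \<tau> (b i) \<otimes> ?c (Suc i) n \<oplus> \<delta> (b i) \<otimes> ?c i n"
      by (cases "n = 0") (simp_all add: Ypow_Suc tau_mult delta_mult r_distr a_assoc del: funpow.simps)
  qed
  also have "\<dots> = ssum (\<lambda>i. \<tau> (b i) \<otimes> ?c (Suc i) n) \<oplus> ssum (\<lambda>i. \<delta> (b i) \<otimes> ?c i n)"
    by (rule ssum_add[OF adm3 series_mult_adm[OF db c]])
  also have "ssum (\<lambda>i. \<tau> (b i) \<otimes> ?c (Suc i) n) = ssum (\<lambda>i. ?pre i \<otimes> ?c i n)"
  proof -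
    have "(if i = 0 then \<zero> else \<tau> (b (i - 1)) \<otimes> ?c (Suc (i - 1)) n) = ?pre i \<otimes> ?c i n" for i
      using carr(2)[of 0 n] by simp
    then show ?thesis unfolding ssum_shift[OF adm3, symmetric] by presburger
  qed
  also have "ssum (\<lambda>i. ?pre i \<otimes> ?c i n) \<oplus> ssum (\<lambda>i. \<delta> (b i) \<otimes> ?c i n) = series_mult (Y b) c n"
    using series_mult_add_left[OF pre db c, of n] Y_apply[of b, abs_def] unfolding series_mult_def by simp
  finally show "Y (series_mult b c) n = series_mult (Y b) c n" .
qed

lemma Ypow_series_mult: "b \<in> C \<Longrightarrow> c \<in> C \<Longrightarrow> (Y ^^ i) (series_mult b c) = series_mult ((Y ^^ i) b) c"
  by (induction i) (simp_all add: Y_series_mult Ypow_C)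

lemma series_mult_assoc:
  assumes a: "a \<in> C" and b: "b \<in> C" and c: "c \<in> C"
  shows "series_mult (series_mult a b) c = series_mult a (series_mult b c)"
proof
  fix n
  let ?b = "\<lambda>i. (Y ^^ i) b" and ?c = "\<lambda>i. (Y ^^ i) c"
  have carr [simp]: "a i \<in> carrier R" "?b i k \<in> carrier R" "?c i k \<in> carrier R" for i k
    using a Ypow_carr[OF b] Ypow_carr[OF c] by auto
  \<comment> \<open>The exponent \<open>(i - k) + (k - n)\<close> is at least \<open>i - n\<close>
    and at least \<open>k - n\<close>, so the double series decays in both indices with rate
    \<open>n\<close>, as \<open>ssum_swap\<close> requires.\<close>
  have pw: "?b i k \<otimes> ?c k n \<in> pw ((i - k) + (k - n))" for i k
    by (intro pw_mult Ypow_pw b c)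
  have "series_mult a (series_mult b c) n = ssum (\<lambda>i. ssum (\<lambda>k. a i \<otimes> (?b i k \<otimes> ?c k n)))"
    unfolding series_mult_def[of a] Ypow_series_mult[OF b c] unfolding series_mult_def
    by (intro ssum_cong ssum_lmult[OF series_mult_adm[OF Ypow_C[OF b] c]]) simp
  also have "\<dots> = ssum (\<lambda>k. ssum (\<lambda>i. a i \<otimes> (?b i k \<otimes> ?c k n)))"
    by (rule ssum_swap[of _ n]; rule pw_lmult[OF pw_weaken[OF pw]]) auto
  also have "\<dots> = ssum (\<lambda>k. ssum (\<lambda>i. a i \<otimes> ?b i k \<otimes> ?c k n))"
    by (simp add: m_assoc)
  also have "\<dots> = ssum (\<lambda>k. ssum (\<lambda>i. a i \<otimes> ?b i k) \<otimes> ?c k n)"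
    by (intro ssum_cong ssum_rmult[OF series_mult_adm[OF a b], symmetric]) simp
  finally show "series_mult (series_mult a b) c n = series_mult a (series_mult b c) n" unfolding series_mult_def by simp
qed

lemma series_mult_const_left:
  assumes "r \<in> carrier R" "b \<in> C"
  shows "series_mult (const_series R r) b = (\<lambda>n. r \<otimes> b n)"
proof
  fix n
  have "const_series R r i \<otimes> (Y ^^ i) b n = \<zero>" if "i \<noteq> 0" for i
    using that Ypow_carr[OF assms(2)] by (simp add: const_series_def)
  moreover have "b n \<in> carrier R" using assms by blast
  ultimately show "series_mult (const_series R r) b n = r \<otimes> b n"
    unfolding series_mult_def using assms by (subst ssum_single[of _ 0]) (auto simp: const_series_def)
qed

lemma Ypow_one: "(Y ^^ i) (const_series R \<one>) = (\<lambda>k. if k = i then \<one> else \<zero>)"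
  by (induction i)
    (simp_all add: const_series_def skew_shift_monom[OF ring_axioms tau_hom delta])

lemma series_mult_one_right:
  assumes "a \<in> C"
  shows "series_mult a (const_series R \<one>) = a"
proof
  fix n
  have "a i \<in> carrier R" for i using assms by blast
  then show "series_mult a (const_series R \<one>) n = a n"
    unfolding series_mult_def Ypow_one by (subst ssum_single[of _ n]) auto
qed

lemma ring_T: "ring T"
proof (rule ringI)
  show "abelian_group T"
  proof (rule abelian_groupI)
    fix x assume "x \<in> carrier T"
    then show "\<exists>y\<in>carrier T. y \<oplus>\<^bsub>T\<^esub> x = \<zero>\<^bsub>T\<^esub>"
      by (intro bexI[of _ "\<lambda>n. \<ominus> x n"]) (auto simp: T_carrier T_add T_zero Pi_iff l_neg)
  qed (auto simp: T_carrier T_add T_zero Pi_iff a_ac)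
  show "Group.monoid T"
  proof (rule Group.monoidI)
    show "\<one>\<^bsub>T\<^esub> \<in> carrier T" by (simp add: T_carrier T_one const_C)
    fix x y z assume c: "x \<in> carrier T" "y \<in> carrier T" "z \<in> carrier T"
    then show "x \<otimes>\<^bsub>T\<^esub> y \<in> carrier T" by (simp add: T_carrier T_mult series_mult_C)
    show "x \<otimes>\<^bsub>T\<^esub> y \<otimes>\<^bsub>T\<^esub> z = x \<otimes>\<^bsub>T\<^esub> (y \<otimes>\<^bsub>T\<^esub> z)"
      using c by (simp add: T_carrier T_mult series_mult_C series_mult_assoc)
  next
    fix x assume "x \<in> carrier T"
    then have x: "x \<in> C" "\<And>n. x n \<in> carrier R" by (auto simp: T_carrier)
    then show "\<one>\<^bsub>T\<^esub> \<otimes>\<^bsub>T\<^esub> x = x" "x \<otimes>\<^bsub>T\<^esub> \<one>\<^bsub>T\<^esub> = x"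
      by (simp_all add: T_mult T_one const_C series_mult_const_left series_mult_one_right)
  qed
  fix x y z assume "x \<in> carrier T" "y \<in> carrier T" "z \<in> carrier T"
  then have c: "x \<in> C" "y \<in> C" "z \<in> C" by (simp_all add: T_carrier)
  then have s: "(\<lambda>n. x n \<oplus> y n) \<in> C" by auto
  show "(x \<oplus>\<^bsub>T\<^esub> y) \<otimes>\<^bsub>T\<^esub> z = x \<otimes>\<^bsub>T\<^esub> z \<oplus>\<^bsub>T\<^esub> y \<otimes>\<^bsub>T\<^esub> z"
    unfolding T_add using c s by (simp add: T_mult series_mult_add_left fun_eq_iff)
  show "z \<otimes>\<^bsub>T\<^esub> (x \<oplus>\<^bsub>T\<^esub> y) = z \<otimes>\<^bsub>T\<^esub> x \<oplus>\<^bsub>T\<^esub> z \<otimes>\<^bsub>T\<^esub> y"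
    unfolding T_add using c s by (simp add: T_mult series_mult_add_right fun_eq_iff)
qed

end

section \<open>Noetherianity from the associated graded ring\<close>

text \<open>Without a maximal member above \<open>A\<close>, dependent choice builds a strictly
  increasing chain. Hence the chain condition can be taken in its weak form, asking for a single
  stationary step.\<close>

lemma acc_maximal:
  assumes acc: "\<forall>L :: nat \<Rightarrow> 'x set. (\<forall>n. L n \<in> X \<and> L n \<subseteq> L (Suc n)) \<longrightarrow> (\<exists>n. L (Suc n) = L n)"
    and A: "A \<in> X"
  shows "\<exists>M\<in>X. A \<subseteq> M \<and> (\<forall>K\<in>X. M \<subseteq> K \<longrightarrow> K = M)"
proof (rule ccontr)
  assume n: "\<not> ?thesis"
  have "\<exists>L. \<forall>n. (L n \<in> X \<and> A \<subseteq> L n) \<and> L n \<subset> L (Suc n)"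
  proof (rule dependent_nat_choice)
    show "\<exists>x. x \<in> X \<and> A \<subseteq> x" using A by blast
    fix x and n :: nat assume "x \<in> X \<and> A \<subseteq> x"
    then show "\<exists>y. (y \<in> X \<and> A \<subseteq> y) \<and> x \<subset> y" using n by (metis psubsetI subset_trans)
  qed
  then obtain L where "\<And>n. L n \<in> X" "\<And>n. L n \<subset> L (Suc n)" by blast
  then show False using acc by (metis psubsetE)
qed

declare ideal_power.simps(2) [simp del]

section \<open>The graded ring computed through representatives\<close>

context adic_ring
begin

definition gr_class :: "(nat \<Rightarrow> 'a) \<Rightarrow> nat \<Rightarrow> 'a set"
  where "gr_class a = (\<lambda>n. pw (Suc n) +> a n)"

text \<open>The class of \<open>a n\<close> is zero in degree \<open>n\<close> exactly when
  \<open>a n \<in> pw (Suc n)\<close>, so the second condition is finite support in the graded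
  ring.\<close>

definition gr_rep :: "(nat \<Rightarrow> 'a) set"
  where "gr_rep = {a. (\<forall>n. a n \<in> pw n) \<and> (\<exists>N. \<forall>n\<ge>N. a n \<in> pw (Suc n))}"

abbreviation "G \<equiv> gr_ring R I"

lemma pw_asub: "abelian_subgroup (pw n) R"
  using abelian_subgroupI3[OF pw_sub abelian_group_axioms] .

lemma coset_eq_iff: "a \<in> carrier R \<Longrightarrow> b \<in> carrier R \<Longrightarrow> pw n +> a = pw n +> b \<longleftrightarrow> adic_cong n a b"
  using abelian_subgroup.a_rcos_module_imp[OF pw_asub] abelian_subgroup.a_rcos_module_rev[OF pw_asub]
    a_repr_independence[OF _ _ additive_subgroup.a_subgroup[OF pw_sub]]
    abelian_subgroup.a_rcos_self[OF pw_asub]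
  by (metis a_minus_def adic_cong_def)

lemma coset_self_iff: "a \<in> carrier R \<Longrightarrow> pw n +> a = pw n \<longleftrightarrow> a \<in> pw n"
  using coset_eq_iff[of a \<zero> n] adic_cong_zero additive_subgroup.a_subset[OF pw_sub] by simp

lemma mem_coset_iff: "a \<in> carrier R \<Longrightarrow> x \<in> pw n +> a \<longleftrightarrow> adic_cong n x a"
proof -
  assume a: "a \<in> carrier R"
  have "x \<in> carrier R" if "x \<in> pw n +> a"
    using that a a_r_coset_subset_G additive_subgroup.a_subset[OF pw_sub] by blast
  then show ?thesis
    using a abelian_subgroup.a_rcos_module_imp[OF pw_asub a] abelian_subgroup.a_rcos_module_rev[OF pw_asub a]
    by (metis a_minus_def adic_cong_def)
qed

lemma gr_class_carr: "a \<in> gr_rep \<Longrightarrow> a n \<in> carrier R"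
  unfolding gr_rep_def using pw_carr by blast

lemma gr_carrier: "carrier G = gr_class ` gr_rep"
proof
  show "carrier G \<subseteq> gr_class ` gr_rep"
  proof
    fix f assume "f \<in> carrier G"
    then have "\<forall>n. \<exists>a. a \<in> pw n \<and> f n = pw (Suc n) +> a"
      and N: "\<exists>N. \<forall>n\<ge>N. f n = pw (Suc n)" by (auto simp: gr_ring_def)
    then obtain a where a: "\<And>n. a n \<in> pw n" "\<And>n. f n = pw (Suc n) +> a n" by metis
    then have "f n = pw (Suc n) \<longleftrightarrow> a n \<in> pw (Suc n)" for n
      using coset_self_iff pw_carr by metis
    then have "a \<in> gr_rep" using N a unfolding gr_rep_def by simp
    moreover have "f = gr_class a" using a unfolding gr_class_def by blast
    ultimately show "f \<in> gr_class ` gr_rep" by blast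
  qed
  show "gr_class ` gr_rep \<subseteq> carrier G"
  proof
    fix f assume "f \<in> gr_class ` gr_rep"
    then obtain a where a: "a \<in> gr_rep" "f = gr_class a" by blast
    then have "f n = pw (Suc n) \<longleftrightarrow> a n \<in> pw (Suc n)" for n
      using coset_self_iff gr_class_carr unfolding gr_class_def by metis
    then show "f \<in> carrier G" using a unfolding gr_rep_def by (auto simp: gr_ring_def gr_class_def)
  qed
qed

lemma gr_add: "a \<in> gr_rep \<Longrightarrow> b \<in> gr_rep \<Longrightarrow> gr_class a \<oplus>\<^bsub>G\<^esub> gr_class b = gr_class (\<lambda>n. a n \<oplus> b n)"
  using abelian_subgroup.a_rcos_sum[OF pw_asub] gr_class_carr
  by (simp add: gr_ring_def gr_class_def)

lemma gr_zero: "\<zero>\<^bsub>G\<^esub> = gr_class (\<lambda>n. \<zero>)"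
  using coset_self_iff[OF zero_closed] by (simp add: gr_ring_def gr_class_def)

lemma gr_rep_zero: "(\<lambda>n. \<zero>) \<in> gr_rep"
  unfolding gr_rep_def using pw_zero by blast

lemma gr_rep_add:
  assumes "a \<in> gr_rep" "b \<in> gr_rep" shows "(\<lambda>n. a n \<oplus> b n) \<in> gr_rep"
proof -
  obtain N M where "\<forall>n\<ge>N. a n \<in> pw (Suc n)" "\<forall>n\<ge>M. b n \<in> pw (Suc n)"
    using assms unfolding gr_rep_def by blast
  then have "\<forall>n\<ge>max N M. a n \<oplus> b n \<in> pw (Suc n)" using pw_add by simp
  then show ?thesis using assms pw_add unfolding gr_rep_def by blast
qed

lemma gr_rep_uminus: "a \<in> gr_rep \<Longrightarrow> (\<lambda>n. \<ominus> a n) \<in> gr_rep"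
  unfolding gr_rep_def using pw_uminus by blast

text \<open>A right ideal of \<open>G\<close> has to be a subgroup of its additive monoid, whose
  inverse is given by a description; the group laws allow \<open>gr_uminus\<close> to evaluate
  it.\<close>

lemma gr_group: "group (add_monoid G)"
proof (rule groupI)
  fix f g h assume fg: "f \<in> carrier (add_monoid G)" "g \<in> carrier (add_monoid G)"
  then obtain a b where ab: "a \<in> gr_rep" "f = gr_class a" "b \<in> gr_rep" "g = gr_class b"
    by (auto simp: gr_carrier)
  then show "f \<otimes>\<^bsub>add_monoid G\<^esub> g \<in> carrier (add_monoid G)"
    by (simp add: gr_carrier gr_add gr_rep_add)
  assume "h \<in> carrier (add_monoid G)"
  then obtain c where c: "c \<in> gr_rep" "h = gr_class c" by (auto simp: gr_carrier)
  show "f \<otimes>\<^bsub>add_monoid G\<^esub> g \<otimes>\<^bsub>add_monoid G\<^esub> h = f \<otimes>\<^bsub>add_monoid G\<^esub> (g \<otimes>\<^bsub>add_monoid G\<^esub> h)"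
    using ab c by (simp add: gr_add gr_rep_add a_assoc gr_class_carr)
next
  show "\<one>\<^bsub>add_monoid G\<^esub> \<in> carrier (add_monoid G)"
    by (simp add: gr_zero gr_carrier gr_rep_zero)
next
  fix f assume "f \<in> carrier (add_monoid G)"
  then obtain a where a: "a \<in> gr_rep" "f = gr_class a" by (auto simp: gr_carrier)
  show "\<one>\<^bsub>add_monoid G\<^esub> \<otimes>\<^bsub>add_monoid G\<^esub> f = f"
    using a by (simp add: gr_zero gr_add gr_rep_zero gr_class_carr)
  have "gr_class (\<lambda>n. \<ominus> a n) \<otimes>\<^bsub>add_monoid G\<^esub> f = \<one>\<^bsub>add_monoid G\<^esub>"
    using a by (simp add: gr_zero gr_add gr_rep_uminus gr_class_carr l_neg)
  then show "\<exists>g\<in>carrier (add_monoid G). g \<otimes>\<^bsub>add_monoid G\<^esub> f = \<one>\<^bsub>add_monoid G\<^esub>"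
    using a gr_rep_uminus by (auto simp: gr_carrier)
qed

lemma gr_uminus:
  assumes a: "a \<in> gr_rep" shows "inv\<^bsub>add_monoid G\<^esub> (gr_class a) = gr_class (\<lambda>n. \<ominus> a n)"
proof (rule group.inv_equality[OF gr_group])
  show "gr_class (\<lambda>n. \<ominus> a n) \<otimes>\<^bsub>add_monoid G\<^esub> gr_class a = \<one>\<^bsub>add_monoid G\<^esub>"
    using a by (simp add: gr_zero gr_add gr_rep_uminus gr_class_carr l_neg)
qed (use a gr_rep_uminus in \<open>auto simp: gr_carrier\<close>)

text \<open>In \<open>x \<otimes> y \<ominus> a \<otimes> b = (x \<ominus> a) \<otimes> y \<oplus> a
  \<otimes> (y \<ominus> b)\<close> each summand has one exponent raised by one, since
  \<open>y\<close> lies in \<open>pw k\<close> together with \<open>b\<close>. This makes the graded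
  product independent of representatives.\<close>

lemma adic_cong_mult_pw:
  assumes "adic_cong (Suc j) x a" "adic_cong (Suc k) y b" "a \<in> pw j" "b \<in> pw k"
  shows "adic_cong (Suc (j + k)) (x \<otimes> y) (a \<otimes> b)"
proof -
  have c: "x \<in> carrier R" "y \<in> carrier R" "a \<in> carrier R" "b \<in> carrier R"
    using assms unfolding adic_cong_def by auto
  have y: "y \<in> pw k"
    using adic_cong_trans[OF adic_cong_weaken[OF assms(2)]] assms(4) adic_cong_zero by (metis le_SucI order_refl)
  have "(x \<ominus> a) \<otimes> y \<in> pw (Suc j + k)" using assms(1) y unfolding adic_cong_def by (blast intro: pw_mult)
  moreover have "a \<otimes> (y \<ominus> b) \<in> pw (j + Suc k)" using assms(2,3) unfolding adic_cong_def by (blast intro: pw_mult)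
  moreover have "x \<otimes> y \<ominus> a \<otimes> b = (x \<ominus> a) \<otimes> y \<oplus> a \<otimes> (y \<ominus> b)" using c by algebra
  ultimately show ?thesis using c pw_add unfolding adic_cong_def by simp
qed

lemma adic_cong_lmult: "adic_cong m x y \<Longrightarrow> r \<in> carrier R \<Longrightarrow> adic_cong m (r \<otimes> x) (r \<otimes> y)"
  by (rule adic_cong_additive[where \<phi> = "\<lambda>x. r \<otimes> x"]) (auto simp: r_distr pw_lmult)

lemma gr_rcoset_mult:
  assumes "a \<in> pw j" "b \<in> pw k"
  shows "rcoset_mult R (pw (Suc (j + k))) (pw (Suc j) +> a) (pw (Suc k) +> b) = pw (Suc (j + k)) +> (a \<otimes> b)"
proof -
  have c: "a \<in> carrier R" "b \<in> carrier R" using assms pw_carr by auto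
  have "pw (Suc (j + k)) +> (x \<otimes> y) = pw (Suc (j + k)) +> (a \<otimes> b)"
    if "x \<in> pw (Suc j) +> a" "y \<in> pw (Suc k) +> b" for x y
  proof -
    have xy: "adic_cong (Suc j) x a" "adic_cong (Suc k) y b" using that c mem_coset_iff by auto
    then have "x \<in> carrier R" "y \<in> carrier R" unfolding adic_cong_def by auto
    then show ?thesis using adic_cong_mult_pw[OF xy assms] c coset_eq_iff by simp
  qed
  moreover have "a \<in> pw (Suc j) +> a" "b \<in> pw (Suc k) +> b"
    using c mem_coset_iff adic_cong_refl by auto
  ultimately show ?thesis unfolding rcoset_mult_def by blast
qed

lemma finsum_coset:
  assumes "\<And>j. c j \<in> carrier R"
  shows "finsum (R Quot pw n) (\<lambda>j. pw n +> c j) {..<m::nat} = pw n +> finsum R c {..<m}"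
proof (induction m)
  case 0
  show ?case
    using coset_self_iff[OF zero_closed] abelian_monoid.finsum_empty[OF ring.is_abelian_group[OF ideal.quotient_is_ring[OF pw_ideal], THEN abelian_group.axioms(1)]]
    by (simp add: FactRing_def)
next
  case (Suc m)
  interpret Q: ring "R Quot pw n" by (rule ideal.quotient_is_ring[OF pw_ideal])
  have "pw n +> c j \<in> carrier (R Quot pw n)" for j
    using assms a_rcosetsI additive_subgroup.a_subset[OF pw_sub] by (simp add: FactRing_def)
  then have "finsum (R Quot pw n) (\<lambda>j. pw n +> c j) {..<Suc m}
      = finsum (R Quot pw n) (\<lambda>j. pw n +> c j) {..<m} \<oplus>\<^bsub>R Quot pw n\<^esub> (pw n +> c m)"
    by (rule Q.finsum_lessThan_Suc)
  also have "\<dots> = (pw n +> finsum R c {..<m}) <+> (pw n +> c m)"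
    using Suc by (simp add: FactRing_def)
  also have "\<dots> = pw n +> (finsum R c {..<m} \<oplus> c m)"
    using assms by (intro abelian_subgroup.a_rcos_sum[OF pw_asub]) (auto simp: finsum_closed)
  finally show ?case using assms by (simp add: finsum_lessThan_Suc)
qed

lemma gr_mult:
  assumes "a \<in> gr_rep" "b \<in> gr_rep"
  shows "gr_class a \<otimes>\<^bsub>G\<^esub> gr_class b = gr_class (\<lambda>n. finsum R (\<lambda>j. a j \<otimes> b (n - j)) {..<Suc n})"
proof
  fix n
  interpret Q: ring "R Quot pw (Suc n)" by (rule ideal.quotient_is_ring[OF pw_ideal])
  have c: "a j \<in> carrier R" "b j \<in> carrier R" for j using assms gr_class_carr by auto
  have "finsum (R Quot pw (Suc n)) (\<lambda>j. rcoset_mult R (pw (Suc n)) (gr_class a j) (gr_class b (n - j))) {..<Suc n}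
      = finsum (R Quot pw (Suc n)) (\<lambda>j. pw (Suc n) +> (a j \<otimes> b (n - j))) {..<Suc n}"
  proof (rule Q.finsum_cong'[OF refl])
    show "(\<lambda>j. pw (Suc n) +> (a j \<otimes> b (n - j))) \<in> {..<Suc n} \<rightarrow> carrier (R Quot pw (Suc n))"
      using c a_rcosetsI additive_subgroup.a_subset[OF pw_sub] by (auto simp: FactRing_def)
    fix j assume "j \<in> {..<Suc n}"
    then have "j + (n - j) = n" by auto
    then show "rcoset_mult R (pw (Suc n)) (gr_class a j) (gr_class b (n - j)) = pw (Suc n) +> (a j \<otimes> b (n - j))"
      using gr_rcoset_mult[of "a j" j "b (n - j)" "n - j"] assms unfolding gr_rep_def gr_class_def by simp
  qed
  also have "\<dots> = pw (Suc n) +> finsum R (\<lambda>j. a j \<otimes> b (n - j)) {..<Suc n}"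
    using c by (intro finsum_coset) auto
  finally show "(gr_class a \<otimes>\<^bsub>G\<^esub> gr_class b) n = gr_class (\<lambda>n. finsum R (\<lambda>j. a j \<otimes> b (n - j)) {..<Suc n}) n"
    by (simp add: gr_ring_def lessThan_Suc_atMost gr_class_def)
qed

text \<open>A graded right ideal of \<open>G\<close> is encoded by the preimages in
  \<open>pw n\<close> of its homogeneous components; as \<open>S n\<close> contains
  \<open>pw (Suc n)\<close>, it is a union of cosets.\<close>

definition graded_right_ideal :: "(nat \<Rightarrow> 'a set) \<Rightarrow> bool"
  where "graded_right_ideal S \<longleftrightarrow> (\<forall>n. additive_subgroup (S n) R \<and> pw (Suc n) \<subseteq> S n \<and> S n \<subseteq> pw n \<and>
    (\<forall>m. \<forall>x\<in>S n. \<forall>r\<in>pw m. x \<otimes> r \<in> S (n + m)))"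

definition gr_set :: "(nat \<Rightarrow> 'a set) \<Rightarrow> (nat \<Rightarrow> 'a set) set"
  where "gr_set S = {f \<in> carrier G. \<forall>n. f n \<subseteq> S n}"

lemma gr_class_subset_iff:
  assumes "graded_right_ideal S" "a n \<in> carrier R"
  shows "gr_class a n \<subseteq> S n \<longleftrightarrow> a n \<in> S n"
proof
  have s: "additive_subgroup (S n) R" and p: "pw (Suc n) \<subseteq> S n"
    using assms unfolding graded_right_ideal_def by auto
  show "a n \<in> S n" if "gr_class a n \<subseteq> S n"
    using that mem_coset_iff[OF assms(2)] adic_cong_refl[OF assms(2)] unfolding gr_class_def by blast
  show "gr_class a n \<subseteq> S n" if a: "a n \<in> S n"
  proof
    fix x assume "x \<in> gr_class a n"
    then have x: "adic_cong (Suc n) x (a n)" using mem_coset_iff[OF assms(2)] unfolding gr_class_def by simp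
    then have "x \<ominus> a n \<in> S n" using p unfolding adic_cong_def by blast
    then have "(x \<ominus> a n) \<oplus> a n \<in> S n" using a additive_subgroup.a_closed[OF s] by blast
    moreover have "(x \<ominus> a n) \<oplus> a n = x" using x unfolding adic_cong_def by algebra
    ultimately show "x \<in> S n" by simp
  qed
qed

lemma gr_set_eq:
  assumes "graded_right_ideal S"
  shows "gr_set S = gr_class ` {a \<in> gr_rep. \<forall>n. a n \<in> S n}"
  unfolding gr_set_def gr_carrier using gr_class_subset_iff[OF assms] gr_class_carr by blast

lemma gr_set_right_ideal:
  assumes S: "graded_right_ideal S"
  shows "right_ideal G (gr_set S)"
proof -
  have s: "\<And>n. additive_subgroup (S n) R" using S unfolding graded_right_ideal_def by auto
  have "subgroup (gr_set S) (add_monoid G)"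
  proof
    show "gr_set S \<subseteq> carrier (add_monoid G)" unfolding gr_set_def by auto
    show "\<one>\<^bsub>add_monoid G\<^esub> \<in> gr_set S"
      using additive_subgroup.zero_closed[OF s] gr_rep_zero by (auto simp: gr_set_eq[OF S] gr_zero)
    fix x y assume "x \<in> gr_set S"
    then obtain a where a: "a \<in> gr_rep" "x = gr_class a" "\<And>n. a n \<in> S n" by (auto simp: gr_set_eq[OF S])
    have "\<And>n. \<ominus> a n \<in> S n" using a additive_subgroup.a_inv_closed[OF s] abelian_group_axioms by blast
    then show "inv\<^bsub>add_monoid G\<^esub> x \<in> gr_set S"
      unfolding a(2) gr_uminus[OF a(1)] gr_set_eq[OF S] using gr_rep_uminus[OF a(1)] by blast
    assume "y \<in> gr_set S"
    then obtain b where b: "b \<in> gr_rep" "y = gr_class b" "\<And>n. b n \<in> S n" by (auto simp: gr_set_eq[OF S])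
    show "x \<otimes>\<^bsub>add_monoid G\<^esub> y \<in> gr_set S"
      using a b gr_rep_add[OF a(1) b(1)] additive_subgroup.a_closed[OF s]
      by (auto simp: gr_set_eq[OF S] gr_add)
  qed
  moreover have "x \<otimes>\<^bsub>G\<^esub> r \<in> gr_set S" if x: "x \<in> gr_set S" and r: "r \<in> carrier G" for x r
  proof -
    obtain a where a: "a \<in> gr_rep" "x = gr_class a" "\<And>n. a n \<in> S n" using x by (auto simp: gr_set_eq[OF S])
    obtain b where b: "b \<in> gr_rep" "r = gr_class b" using r by (auto simp: gr_carrier)
    let ?c = "\<lambda>n. finsum R (\<lambda>j. a j \<otimes> b (n - j)) {..<Suc n}"
    have aj: "a j \<in> pw j" and bj: "b j \<in> pw j" for j using a b unfolding gr_rep_def by auto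
    have "a j \<otimes> b (n - j) \<in> S n" if "j < Suc n" for j n
    proof -
      have "a j \<otimes> b (n - j) \<in> S (j + (n - j))"
        using S a(3) bj unfolding graded_right_ideal_def by blast
      then show ?thesis using that by simp
    qed
    then have cS: "?c n \<in> S n" for n by (intro additive_finsum_mem s)
    then have cpw: "?c n \<in> pw n" for n using S unfolding graded_right_ideal_def by blast
    obtain N where N: "\<forall>n\<ge>N. a n \<in> pw (Suc n)" using a unfolding gr_rep_def by blast
    obtain M where M: "\<forall>n\<ge>M. b n \<in> pw (Suc n)" using b unfolding gr_rep_def by blast
    \<comment> \<open>For \<open>n \<ge> N + M\<close> every product has \<open>j \<ge> N\<close> or
      \<open>n - j \<ge> M\<close>, so one of its factors has a vanishing class; this bounds the
      support of the product.\<close>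
    have "?c n \<in> pw (Suc n)" if n: "n \<ge> N + M" for n
    proof (rule additive_finsum_mem[OF pw_sub])
      fix j assume j: "j < Suc n"
      show "a j \<otimes> b (n - j) \<in> pw (Suc n)"
      proof (cases "j \<ge> N")
        case True
        then have "a j \<otimes> b (n - j) \<in> pw (Suc j + (n - j))" using N bj by (intro pw_mult) auto
        then show ?thesis using j by simp
      next
        case False
        then have "a j \<otimes> b (n - j) \<in> pw (j + Suc (n - j))" using M aj n by (intro pw_mult) auto
        then show ?thesis using j by simp
      qed
    qed
    then have "?c \<in> gr_rep" using cpw unfolding gr_rep_def by blast
    then show ?thesis using cS a b by (auto simp: gr_set_eq[OF S] gr_mult)
  qed
  ultimately show ?thesis unfolding right_ideal_def by (simp add: additive_subgroupI)
qed

lemma gr_set_mono_iff: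
  assumes S: "graded_right_ideal S" and S': "graded_right_ideal S'"
  shows "gr_set S \<subseteq> gr_set S' \<longleftrightarrow> (\<forall>n. S n \<subseteq> S' n)"
proof
  assume sub: "gr_set S \<subseteq> gr_set S'"
  show "\<forall>n. S n \<subseteq> S' n"
  proof (intro allI subsetI)
    fix n x assume x: "x \<in> S n"
    \<comment> \<open>The homogeneous element of degree \<open>n\<close> represented by
      \<open>x\<close> detects the component \<open>S n\<close>.\<close>
    let ?a = "\<lambda>m. if m = n then x else \<zero>"
    have "\<And>n. \<zero> \<in> S n" using S unfolding graded_right_ideal_def by (simp add: additive_subgroup.zero_closed)
    then have "?a m \<in> S m" for m using x by auto
    moreover have "x \<in> pw n" using x S unfolding graded_right_ideal_def by blast
    then have "\<forall>m. ?a m \<in> pw m" "\<forall>m\<ge>Suc n. ?a m \<in> pw (Suc m)" by auto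
    then have "?a \<in> gr_rep" unfolding gr_rep_def by blast
    ultimately have "gr_class ?a \<in> gr_set S'" using sub unfolding gr_set_eq[OF S] by blast
    then have "gr_class ?a n \<subseteq> S' n" unfolding gr_set_def by blast
    then show "x \<in> S' n" using gr_class_subset_iff[OF S', of ?a n] \<open>x \<in> pw n\<close> pw_carr by simp
  qed
qed (unfold gr_set_def, blast)

end

section \<open>Finite generation, closedness and chain condition for right ideals\<close>

locale gr_noetherian_ring = adic_ring +
  assumes noetherian: "two_sided_noetherian (gr_ring R I)"
begin

text \<open>If \<open>a i \<in> pw (d i)\<close>, this is the component of degree \<open>n\<close>,
  lifted to \<open>pw n\<close>, of the right ideal of \<open>G\<close> generated by the classes of
  \<open>a i\<close> in degree \<open>d i\<close>, for \<open>i < k\<close>. The coefficient of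
  \<open>a i\<close> has degree \<open>n - d i\<close>; for \<open>d i > n\<close> it is set to
  zero, as truncated subtraction would wrongly allow all of \<open>pw 0\<close>.\<close>

definition gr_span :: "nat \<Rightarrow> (nat \<Rightarrow> 'a) \<Rightarrow> (nat \<Rightarrow> nat) \<Rightarrow> nat \<Rightarrow> 'a set"
  where "gr_span k a d n = {x \<in> pw n. \<exists>r. (\<forall>i. r i \<in> (if d i \<le> n then pw (n - d i) else {\<zero>})) \<and>
    adic_cong (Suc n) x (finsum R (\<lambda>i. a i \<otimes> r i) {..<k})}"

lemma gr_spanE:
  assumes "x \<in> gr_span k a d n"
  obtains r where "\<And>i. r i \<in> (if d i \<le> n then pw (n - d i) else {\<zero>})" "\<And>i. r i \<in> carrier R"
    "x \<in> pw n" "adic_cong (Suc n) x (finsum R (\<lambda>i. a i \<otimes> r i) {..<k})"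
proof -
  obtain r where r: "\<forall>i. r i \<in> (if d i \<le> n then pw (n - d i) else {\<zero>})"
    "x \<in> pw n" "adic_cong (Suc n) x (finsum R (\<lambda>i. a i \<otimes> r i) {..<k})"
    using assms unfolding gr_span_def by blast
  have "r i \<in> carrier R" for i using r(1)[THEN spec, of i] pw_carr by (auto split: if_splits)
  then show thesis using r that by blast
qed

lemma gr_spanI:
  assumes "\<And>i. r i \<in> (if d i \<le> n then pw (n - d i) else {\<zero>})" "x \<in> pw n"
    "adic_cong (Suc n) x (finsum R (\<lambda>i. a i \<otimes> r i) {..<k})"
  shows "x \<in> gr_span k a d n"
  unfolding gr_span_def using assms by blast

lemma gr_span_graded:
  assumes a: "\<And>i. a i \<in> carrier R"
  shows "graded_right_ideal (gr_span k a d)"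
  unfolding graded_right_ideal_def
proof (intro allI conjI)
  fix n
  have z: "\<zero> \<in> (if d i \<le> n then pw (n - d i) else {\<zero>})" for i by simp
  have sum0: "finsum R (\<lambda>i. a i \<otimes> \<zero>) {..<k} = \<zero>" using a by (simp add: finsum_zero)
  show p: "pw (Suc n) \<subseteq> gr_span k a d n"
  proof
    fix x assume x: "x \<in> pw (Suc n)"
    then show "x \<in> gr_span k a d n"
      using sum0 z adic_cong_zero pw_weaken[OF x, of n] by (intro gr_spanI[of "\<lambda>i. \<zero>"]) simp_all
  qed
  show "gr_span k a d n \<subseteq> pw n" unfolding gr_span_def by blast
  show "additive_subgroup (gr_span k a d n) R"
  proof (rule additive_subgroupI, rule subgroup.intro)
    show "gr_span k a d n \<subseteq> carrier (add_monoid R)" unfolding gr_span_def using pw_carr by auto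
    show "\<one>\<^bsub>add_monoid R\<^esub> \<in> gr_span k a d n" using p pw_zero by auto
    fix x y assume "x \<in> gr_span k a d n"
    then obtain r where r: "\<And>i. r i \<in> (if d i \<le> n then pw (n - d i) else {\<zero>})" "\<And>i. r i \<in> carrier R"
      "x \<in> pw n" "adic_cong (Suc n) x (finsum R (\<lambda>i. a i \<otimes> r i) {..<k})" using gr_spanE by blast
    have "\<ominus> r i \<in> (if d i \<le> n then pw (n - d i) else {\<zero>})" for i
      using r(1)[of i] pw_uminus by (auto split: if_splits)
    moreover have "\<ominus> finsum R (\<lambda>i. a i \<otimes> r i) {..<k} = finsum R (\<lambda>i. a i \<otimes> \<ominus> r i) {..<k}"
      using finsum_additive[of "\<lambda>i. a i \<otimes> r i" "\<lambda>x. \<ominus> x" k] a r(2) by (simp add: minus_add r_minus)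
    moreover have "adic_cong (Suc n) (\<ominus> x) (\<ominus> finsum R (\<lambda>i. a i \<otimes> r i) {..<k})"
      by (rule adic_cong_additive[OF r(4)]) (auto simp: minus_add pw_uminus)
    ultimately show "inv\<^bsub>add_monoid R\<^esub> x \<in> gr_span k a d n"
      unfolding a_inv_def[symmetric] using pw_uminus[OF r(3)]
      by (intro gr_spanI[of "\<lambda>i. \<ominus> r i"]) simp_all
    assume "y \<in> gr_span k a d n"
    then obtain s where s: "\<And>i. s i \<in> (if d i \<le> n then pw (n - d i) else {\<zero>})" "\<And>i. s i \<in> carrier R"
      "y \<in> pw n" "adic_cong (Suc n) y (finsum R (\<lambda>i. a i \<otimes> s i) {..<k})" using gr_spanE by blast
    have "r i \<oplus> s i \<in> (if d i \<le> n then pw (n - d i) else {\<zero>})" for i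
      using r(1)[of i] s(1)[of i] pw_add by (auto split: if_splits)
    moreover have "finsum R (\<lambda>i. a i \<otimes> r i) {..<k} \<oplus> finsum R (\<lambda>i. a i \<otimes> s i) {..<k}
        = finsum R (\<lambda>i. a i \<otimes> (r i \<oplus> s i)) {..<k}"
      using a r(2) s(2) by (simp add: r_distr finsum_addf)
    moreover note adic_cong_add[OF r(4) s(4)]
    ultimately show "x \<otimes>\<^bsub>add_monoid R\<^esub> y \<in> gr_span k a d n"
      using pw_add[OF r(3) s(3)] by (intro gr_spanI[of "\<lambda>i. r i \<oplus> s i"]) simp_all
  qed
  fix m
  show "\<forall>x\<in>gr_span k a d n. \<forall>s\<in>pw m. x \<otimes> s \<in> gr_span k a d (n + m)"
  proof (intro ballI)
    fix x s assume x: "x \<in> gr_span k a d n" and s: "s \<in> pw m"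
    then obtain r where r: "\<And>i. r i \<in> (if d i \<le> n then pw (n - d i) else {\<zero>})" "\<And>i. r i \<in> carrier R"
      "x \<in> pw n" "adic_cong (Suc n) x (finsum R (\<lambda>i. a i \<otimes> r i) {..<k})" using gr_spanE by blast
    let ?s = "finsum R (\<lambda>i. a i \<otimes> r i) {..<k}"
    have sc: "s \<in> carrier R" using s pw_carr by blast
    have "r i \<otimes> s \<in> (if d i \<le> n + m then pw (n + m - d i) else {\<zero>})" for i
    proof (cases "d i \<le> n")
      case True
      then have "r i \<otimes> s \<in> pw (n - d i + m)" using r(1)[of i] s by (intro pw_mult) auto
      then show ?thesis using True by simp
    next
      case False
      then show ?thesis using r(1)[of i] sc by simp
    qed
    moreover have "?s \<otimes> s = finsum R (\<lambda>i. a i \<otimes> (r i \<otimes> s)) {..<k}"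
      using finsum_additive[of "\<lambda>i. a i \<otimes> r i" "\<lambda>x. x \<otimes> s" k] a r(2) sc
      by (simp add: l_distr m_assoc)
    moreover have "adic_cong (Suc (n + m)) (x \<otimes> s) (?s \<otimes> s)"
    proof -
      have c: "x \<in> carrier R" "?s \<in> carrier R" "x \<ominus> ?s \<in> pw (Suc n)" using r(4) unfolding adic_cong_def by auto
      have "(x \<ominus> ?s) \<otimes> s \<in> pw (Suc n + m)" using c(3) s by (rule pw_mult)
      moreover have "(u \<ominus> v) \<otimes> s = u \<otimes> s \<ominus> v \<otimes> s" if "u \<in> carrier R" "v \<in> carrier R" for u v
        using that sc by algebra
      ultimately show ?thesis using c(1,2) sc unfolding adic_cong_def by simp
    qed
    moreover have "x \<otimes> s \<in> pw (n + m)" using r(3) s by (rule pw_mult)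
    ultimately show "x \<otimes> s \<in> gr_span k a d (n + m)"
      by (intro gr_spanI[of "\<lambda>i. r i \<otimes> s"]) simp_all
  qed
qed

text \<open>The new generator takes the index \<open>k\<close>, beyond the old range: the
  coefficient \<open>\<zero>\<close> recovers the old span, and the coefficient
  \<open>\<one>\<close>, of degree \<open>m - m = 0\<close>, gives \<open>x\<close>.\<close>

lemma gr_span_extend:
  assumes a: "\<And>i. a i \<in> carrier R" and x: "x \<in> pw m"
  shows "gr_span k a d n \<subseteq> gr_span (Suc k) (a(k := x)) (d(k := m)) n"
    "x \<in> gr_span (Suc k) (a(k := x)) (d(k := m)) m"
proof -
  let ?a = "a(k := x)" and ?d = "d(k := m)"
  have xc: "x \<in> carrier R" using x pw_carr by blast
  then have a': "?a i \<in> carrier R" for i using a by simp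
  show "gr_span k a d n \<subseteq> gr_span (Suc k) ?a ?d n"
  proof
    fix y assume "y \<in> gr_span k a d n"
    then obtain r where r: "\<And>i. r i \<in> (if d i \<le> n then pw (n - d i) else {\<zero>})" "\<And>i. r i \<in> carrier R"
      "y \<in> pw n" "adic_cong (Suc n) y (finsum R (\<lambda>i. a i \<otimes> r i) {..<k})" using gr_spanE by blast
    let ?r = "r(k := \<zero>)"
    have rc: "?r i \<in> carrier R" for i using r by simp
    have "finsum R (\<lambda>i. ?a i \<otimes> ?r i) {..<Suc k} = finsum R (\<lambda>i. ?a i \<otimes> ?r i) {..<k} \<oplus> x \<otimes> \<zero>"
      using finsum_lessThan_Suc[of "\<lambda>i. ?a i \<otimes> ?r i" k] a' rc by simp
    also have "finsum R (\<lambda>i. ?a i \<otimes> ?r i) {..<k} = finsum R (\<lambda>i. a i \<otimes> r i) {..<k}"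
      using a r(2) by (intro finsum_cong') auto
    finally have "finsum R (\<lambda>i. ?a i \<otimes> ?r i) {..<Suc k} = finsum R (\<lambda>i. a i \<otimes> r i) {..<k}"
      using a r(2) xc by (simp add: finsum_closed)
    moreover have "?r i \<in> (if ?d i \<le> n then pw (n - ?d i) else {\<zero>})" for i
      using r(1)[of i] by (cases "d i \<le> n") auto
    ultimately show "y \<in> gr_span (Suc k) ?a ?d n"
      using r(3,4) by (intro gr_spanI[of ?r]) simp_all
  qed
  let ?r = "(\<lambda>i. \<zero>)(k := \<one>)"
  have "finsum R (\<lambda>i. ?a i \<otimes> ?r i) {..<Suc k} = finsum R (\<lambda>i. ?a i \<otimes> ?r i) {..<k} \<oplus> x \<otimes> \<one>"
    using finsum_lessThan_Suc[of "\<lambda>i. ?a i \<otimes> ?r i" k] a' by simp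
  also have "finsum R (\<lambda>i. ?a i \<otimes> ?r i) {..<k} = finsum R (\<lambda>i. \<zero>) {..<k}"
    using a by (intro finsum_cong') auto
  finally have "finsum R (\<lambda>i. ?a i \<otimes> ?r i) {..<Suc k} = x" using xc by simp
  moreover have "?r i \<in> (if ?d i \<le> m then pw (m - ?d i) else {\<zero>})" for i by simp
  ultimately show "x \<in> gr_span (Suc k) ?a ?d m"
    using x adic_cong_refl[OF xc] by (intro gr_spanI[of ?r]) simp_all
qed

text \<open>Among the graded right ideals generated by classes of finitely many elements of
  \<open>L\<close>, a maximal one exists as \<open>G\<close> is noetherian. Adjoining the class of a
  further element of \<open>L\<close> cannot enlarge it, so it contains all of these
  classes.\<close>

lemma gr_generators:
  assumes L: "right_ideal R L"
  obtains k a d D where "\<And>i. a i \<in> L" "\<And>i. d i \<le> (D :: nat)" "\<And>n. L \<inter> pw n \<subseteq> gr_span k a d n"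
proof -
  \<comment> \<open>The bound on the degrees is kept because it later becomes a common rate of
    convergence for the lifted coefficients.\<close>
  let ?P = "\<lambda>a d. (\<forall>i. a i \<in> L \<inter> pw (d i)) \<and> (\<exists>D. \<forall>i. d i \<le> (D :: nat))"
  define X where "X = {gr_set (gr_span k a d) |k a d. ?P a d}"
  have L0: "\<zero> \<in> L" and LR: "\<And>x. x \<in> L \<Longrightarrow> x \<in> carrier R"
    using L unfolding right_ideal_def
    by (auto simp: additive_subgroup.zero_closed additive_subgroup.a_Hcarr)
  have X0: "gr_set (gr_span 0 (\<lambda>i. \<zero>) (\<lambda>i. 0)) \<in> X"
    unfolding X_def using L0 by (intro CollectI exI conjI) auto
  have ri: "right_ideal G J" if "J \<in> X" for J
    using that gr_set_right_ideal[OF gr_span_graded] LR unfolding X_def by blast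
  have acc: "\<forall>J :: nat \<Rightarrow> (nat \<Rightarrow> 'a set) set. (\<forall>n. J n \<in> X \<and> J n \<subseteq> J (Suc n)) \<longrightarrow> (\<exists>n. J (Suc n) = J n)"
  proof (intro allI impI)
    fix J :: "nat \<Rightarrow> (nat \<Rightarrow> 'a set) set" assume J: "\<forall>n. J n \<in> X \<and> J n \<subseteq> J (Suc n)"
    then have "\<forall>n. right_ideal G (J n)" using ri by blast
    then obtain N where "\<forall>n\<ge>N. J n = J N"
      using noetherian[unfolded two_sided_noetherian_def, THEN conjunct2, THEN spec, of J] J by blast
    then have "J (Suc N) = J N" by (meson le_SucI order_refl)
    then show "\<exists>n. J (Suc n) = J n" ..
  qed
  from acc_maximal[OF acc X0] obtain M where M0: "M \<in> X" "\<forall>K\<in>X. M \<subseteq> K \<longrightarrow> K = M"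
    by (elim bexE conjE)
  from M0(1) obtain k a d where kad: "M = gr_set (gr_span k a d)" "?P a d" unfolding X_def by blast
  then obtain D where D: "\<And>i. d i \<le> D" by blast
  have a: "\<And>i. a i \<in> carrier R" using kad LR by blast
  have "x \<in> gr_span k a d n" if x: "x \<in> L \<inter> pw n" for x n
  proof -
    let ?a = "a(k := x)" and ?d = "d(k := n)"
    let ?S = "gr_span (Suc k) ?a ?d"
    have a': "?a i \<in> carrier R" for i using a x LR by auto
    have ga: "graded_right_ideal (gr_span k a d)" by (rule gr_span_graded[OF a])
    have ga': "graded_right_ideal ?S" by (rule gr_span_graded[OF a'])
    have "?d i \<le> max D n" for i using D[of i] by auto
    then have "\<exists>D. \<forall>i. ?d i \<le> D" by blast
    then have "?P ?a ?d" using kad(2) x by auto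
    then have "gr_set ?S \<in> X" unfolding X_def by blast
    moreover have "gr_span k a d m \<subseteq> ?S m" for m
      by (rule gr_span_extend(1)[of a, OF a]) (use x in blast)
    then have "M \<subseteq> gr_set ?S"
      unfolding kad(1) using gr_set_mono_iff[OF ga ga'] by blast
    ultimately have "gr_set ?S \<subseteq> gr_set (gr_span k a d)" using M0(2) kad(1) by blast
    then have "?S n \<subseteq> gr_span k a d n"
      using gr_set_mono_iff[OF ga' ga] by blast
    then show ?thesis using gr_span_extend(2)[of a x n k d] a x by blast
  qed
  then show thesis using that[of a d D k] kad(2) D by blast
qed

text \<open>Generators of the graded ideal lift to \<open>L\<close>: the remainder of an element of the
  closure of \<open>L\<close> is pushed into higher and higher powers of \<open>I\<close>.\<close>

lemma right_ideal_closure_generators: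
  assumes L: "right_ideal R L"
  obtains k a where "\<And>i. a i \<in> L"
    "\<And>x. x \<in> carrier R \<Longrightarrow> \<forall>m. \<exists>l\<in>L. adic_cong m x l \<Longrightarrow>
      \<exists>r. (\<forall>i. r i \<in> carrier R) \<and> x = finsum R (\<lambda>i. a i \<otimes> r i) {..<(k::nat)}"
proof -
  obtain k a d D where aL: "\<And>i. a i \<in> L" and D: "\<And>i. d i \<le> (D :: nat)"
    and gen: "\<And>n. L \<inter> pw n \<subseteq> gr_span k a d n"
    by (rule gr_generators[OF L]) blast
  have Ls: "additive_subgroup L R" and Lr: "\<And>x r. x \<in> L \<Longrightarrow> r \<in> carrier R \<Longrightarrow> x \<otimes> r \<in> L"
    using L unfolding right_ideal_def by auto
  have a: "\<And>i. a i \<in> carrier R" using aL additive_subgroup.a_Hcarr[OF Ls] by blast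
  \<comment> \<open>The approximation runs in the closure of \<open>L\<close>, where the remainders
    stay; one argument thus yields both closedness and finite generation of
    \<open>L\<close>.\<close>
  define cl where "cl = {x \<in> carrier R. \<forall>m. \<exists>l\<in>L. adic_cong m x l}"
  let ?lc = "\<lambda>r. finsum R (\<lambda>i. a i \<otimes> r i) {..<k}"
  let ?Q = "\<lambda>n x r. (\<forall>i. r i \<in> pw (n - d i)) \<and> x \<ominus> ?lc r \<in> cl \<inter> pw (Suc n)"
  have step: "\<exists>r. ?Q n x r" if x: "x \<in> cl \<inter> pw n" for n x
  proof -
    \<comment> \<open>A limit point is replaced by an element of \<open>L\<close> modulo one power
      more than its own order, so that both have the same class in degree \<open>n\<close>.\<close>
    obtain l where l: "l \<in> L" "adic_cong (Suc n) x l" using x unfolding cl_def by blast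
    have "adic_cong n l \<zero>"
      using adic_cong_trans[OF adic_cong_sym[OF adic_cong_weaken[OF l(2)]]] x adic_cong_zero by (meson IntD2 le_SucI order_refl)
    then have "l \<in> gr_span k a d n" using gen l(1) adic_cong_zero by blast
    then obtain r where r: "\<And>i. r i \<in> (if d i \<le> n then pw (n - d i) else {\<zero>})" "\<And>i. r i \<in> carrier R"
      "adic_cong (Suc n) l (?lc r)" using gr_spanE by blast
    have "r i \<in> pw (n - d i)" for i using r(1)[of i] by (auto split: if_splits)
    moreover have "adic_cong (Suc n) x (?lc r)" using adic_cong_trans[OF l(2) r(3)] .
    moreover have lcL: "?lc r \<in> L" by (intro additive_finsum_mem[OF Ls] Lr aL r(2))
    have "x \<ominus> ?lc r \<in> cl"
      unfolding cl_def
    proof (intro CollectI conjI allI)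
      have xc: "x \<in> carrier R" and sc: "?lc r \<in> carrier R"
        using x lcL additive_subgroup.a_Hcarr[OF Ls] unfolding cl_def by auto
      then show "x \<ominus> ?lc r \<in> carrier R" by simp
      fix m obtain l' where l': "l' \<in> L" "adic_cong m x l'" using x unfolding cl_def by blast
      have "l' \<oplus> (\<ominus> ?lc r) \<in> L"
        using l'(1) lcL additive_subgroup.a_closed[OF Ls] additive_subgroup.a_inv_closed[OF Ls]
          abelian_group_axioms by blast
      moreover have "adic_cong m (x \<oplus> (\<ominus> ?lc r)) (l' \<oplus> (\<ominus> ?lc r))"
        using sc by (intro adic_cong_add l'(2) adic_cong_refl) simp
      ultimately show "\<exists>l\<in>L. adic_cong m (x \<ominus> ?lc r) l" unfolding a_minus_def by blast
    qed
    ultimately show ?thesis unfolding adic_cong_def by blast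
  qed
  have "\<exists>r. (\<forall>i. r i \<in> carrier R) \<and> x = ?lc r" if x: "x \<in> cl" for x
  proof -
    \<comment> \<open>\<open>s n\<close> is the remainder after \<open>n\<close> rounds of
      correction; the clause for \<open>n = 0\<close> makes the chosen sequence start at
      \<open>x\<close>.\<close>
    have "\<exists>s. \<forall>n. (s n \<in> cl \<inter> pw n \<and> (n = 0 \<longrightarrow> s n = x)) \<and> (\<exists>r. (\<forall>i. r i \<in> pw (n - d i)) \<and> s (Suc n) = s n \<ominus> ?lc r)"
    proof (rule dependent_nat_choice)
      show "\<exists>y. y \<in> cl \<inter> pw 0 \<and> (0 = (0::nat) \<longrightarrow> y = x)" using x unfolding cl_def by auto
      fix y n assume "y \<in> cl \<inter> pw n \<and> (n = 0 \<longrightarrow> y = x)"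
      then show "\<exists>z. (z \<in> cl \<inter> pw (Suc n) \<and> (Suc n = 0 \<longrightarrow> z = x)) \<and>
          (\<exists>r. (\<forall>i. r i \<in> pw (n - d i)) \<and> z = y \<ominus> ?lc r)"
        using step[of y n] by blast
    qed
    then obtain s where s: "\<And>n. s n \<in> pw n" "s 0 = x"
      "\<And>n. \<exists>r. (\<forall>i. r i \<in> pw (n - d i)) \<and> s (Suc n) = s n \<ominus> ?lc r" by blast
    from s(3) obtain r where r: "\<And>n i. r n i \<in> pw (n - d i)" "\<And>n. s (Suc n) = s n \<ominus> ?lc (r n)" by metis
    have rc: "r n i \<in> carrier R" for n i using r(1) pw_carr by blast
    have sc: "s n \<in> carrier R" for n using s(1) pw_carr by blast
    have lc: "?lc (r n) \<in> carrier R" for n using a rc by (simp add: finsum_closed)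
    have adm: "adm (d i) (\<lambda>n. r n i)" for i using r(1) unfolding adm_def by blast
    have aux: "(u \<ominus> v) \<oplus> (w \<oplus> v) = u \<oplus> w"
      if "u \<in> carrier R" "v \<in> carrier R" "w \<in> carrier R" for u v w
      using that by algebra
    have sum: "x = s N \<oplus> finsum R (\<lambda>n. ?lc (r n)) {..<N}" for N
    proof (induction N)
      case 0
      show ?case using s(2) sc[of 0] by simp
    next
      case (Suc N)
      have F: "finsum R (\<lambda>n. ?lc (r n)) {..<N} \<in> carrier R" using lc by (simp add: finsum_closed)
      have "s (Suc N) \<oplus> finsum R (\<lambda>n. ?lc (r n)) {..<Suc N}
        = (s N \<ominus> ?lc (r N)) \<oplus> (finsum R (\<lambda>n. ?lc (r n)) {..<N} \<oplus> ?lc (r N))"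
        unfolding r(2) using finsum_lessThan_Suc[of "\<lambda>n. ?lc (r n)", OF lc] by simp
      also have "\<dots> = s N \<oplus> finsum R (\<lambda>n. ?lc (r n)) {..<N}"
        using aux[OF sc lc F] .
      finally show ?case using Suc by simp
    qed
    \<comment> \<open>The \<open>i\<close>-th coefficient collects the corrections of all rounds;
      round \<open>n\<close> contributes an element of \<open>pw (n - d i)\<close>, so the sum
      converges.\<close>
    let ?t = "\<lambda>i. ssum (\<lambda>n. r n i)"
    have tc: "?t i \<in> carrier R" for i using ssum_props(1)[OF adm] .
    have x_eq: "x = ?lc ?t"
    proof (rule adic_cong_eqI)
      fix m
      let ?N = "m + D"
      have xc: "x \<in> carrier R" using sc[of 0] s(2) by simp
      have "s ?N \<in> pw m" using pw_weaken[OF s(1)] by simp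
      then have "adic_cong m (s ?N \<oplus> finsum R (\<lambda>n. ?lc (r n)) {..<?N}) (\<zero> \<oplus> finsum R (\<lambda>n. ?lc (r n)) {..<?N})"
        using lc by (intro adic_cong_add adic_cong_refl) (auto simp: adic_cong_zero finsum_closed)
      then have "adic_cong m x (finsum R (\<lambda>n. ?lc (r n)) {..<?N})"
        using sum[of ?N] lc by (simp add: finsum_closed)
      also have "finsum R (\<lambda>n. ?lc (r n)) {..<?N} = finsum R (\<lambda>i. finsum R (\<lambda>n. a i \<otimes> r n i) {..<?N}) {..<k}"
        using finsum_swap[of "\<lambda>n i. a i \<otimes> r n i"] a rc by simp
      also have "\<dots> = finsum R (\<lambda>i. a i \<otimes> finsum R (\<lambda>n. r n i) {..<?N}) {..<k}"
      proof -
        have "a i \<otimes> finsum R (\<lambda>n. r n i) {..<?N} = finsum R (\<lambda>n. a i \<otimes> r n i) {..<?N}" for i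
          using a rc by (intro finsum_additive) (auto simp: r_distr)
        then show ?thesis by simp
      qed
      also have "adic_cong m \<dots> (?lc ?t)"
      proof (rule adic_cong_finsum)
        fix i
        have "adic_cong m (?t i) (finsum R (\<lambda>n. r n i) {..<?N})"
          using ssum_props(2)[OF adm] D by simp
        then show "adic_cong m (a i \<otimes> finsum R (\<lambda>n. r n i) {..<?N}) (a i \<otimes> ?t i)"
          by (rule adic_cong_lmult[OF adic_cong_sym a])
      qed
      finally show "adic_cong m x (?lc ?t)" .
    qed
    show ?thesis by (intro exI[of _ ?t] conjI allI tc x_eq)
  qed
  then show thesis using that[of a k] aL unfolding cl_def by blast
qed

lemma right_ideal_closed:
  assumes L: "right_ideal R L"
  shows "adic_closed L"
proof -
  obtain k a where a: "\<And>i. a i \<in> L"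
    "\<And>x. x \<in> carrier R \<Longrightarrow> \<forall>m. \<exists>l\<in>L. adic_cong m x l \<Longrightarrow>
      \<exists>r. (\<forall>i. r i \<in> carrier R) \<and> x = finsum R (\<lambda>i. a i \<otimes> r i) {..<(k::nat)}"
    by (rule right_ideal_closure_generators[OF L]) blast
  show ?thesis
    unfolding adic_closed_def
  proof (intro ballI impI)
    fix x assume "x \<in> carrier R" "\<forall>m. \<exists>l\<in>L. adic_cong m x l"
    then obtain r where "\<And>i. r i \<in> carrier R" "x = finsum R (\<lambda>i. a i \<otimes> r i) {..<k}" using a(2) by blast
    then show "x \<in> L" using a(1) L unfolding right_ideal_def by (auto intro: additive_finsum_mem)
  qed
qed

lemma right_ideal_generators:
  assumes L: "right_ideal R L"
  obtains k a where "\<And>i. a i \<in> L"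
    "\<And>x. x \<in> L \<Longrightarrow> \<exists>r. (\<forall>i. r i \<in> carrier R) \<and> x = finsum R (\<lambda>i. a i \<otimes> r i) {..<(k::nat)}"
proof -
  have Ls: "additive_subgroup L R" using L unfolding right_ideal_def by blast
  have cl: "x \<in> carrier R" "\<forall>m. \<exists>l\<in>L. adic_cong m x l" if "x \<in> L" for x
  proof -
    show "x \<in> carrier R" using that by (rule additive_subgroup.a_Hcarr[OF Ls])
    then show "\<forall>m. \<exists>l\<in>L. adic_cong m x l" using that adic_cong_refl by blast
  qed
  obtain k a where a: "\<And>i. a i \<in> L"
    "\<And>x. x \<in> carrier R \<Longrightarrow> \<forall>m. \<exists>l\<in>L. adic_cong m x l \<Longrightarrow>
      \<exists>r. (\<forall>i. r i \<in> carrier R) \<and> x = finsum R (\<lambda>i. a i \<otimes> r i) {..<(k::nat)}"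
    by (rule right_ideal_closure_generators[OF L]) blast
  show thesis by (rule that[of a k, OF a(1) a(2)[OF cl]])
qed

lemma right_ideal_acc:
  assumes L: "\<And>n. right_ideal R (L n)" and inc: "\<And>n. L n \<subseteq> L (Suc n)"
  shows "\<exists>n :: nat. L (Suc n) = L n"
proof -
  define U where "U = (\<Union>n. L n)"
  have mono: "m \<le> n \<Longrightarrow> L m \<subseteq> L n" for m n using lift_Suc_mono_le[of L] inc by blast
  have s: "additive_subgroup (L n) R" for n using L unfolding right_ideal_def by blast
  have "right_ideal R U"
    unfolding right_ideal_def
  proof (intro conjI ballI additive_subgroupI subgroup.intro)
    show "U \<subseteq> carrier (add_monoid R)" unfolding U_def using additive_subgroup.a_subset[OF s] by auto
    show "\<one>\<^bsub>add_monoid R\<^esub> \<in> U" unfolding U_def using additive_subgroup.zero_closed[OF s] by auto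
    fix x assume "x \<in> U"
    then obtain n where n: "x \<in> L n" unfolding U_def by blast
    show "inv\<^bsub>add_monoid R\<^esub> x \<in> U"
      using n additive_subgroup.a_inv_closed[OF s] unfolding U_def a_inv_def by blast
    show "x \<otimes> r \<in> U" if "r \<in> carrier R" for r using L n that unfolding right_ideal_def U_def by blast
    fix y assume "y \<in> U"
    then obtain m where m: "y \<in> L m" unfolding U_def by blast
    have "x \<in> L (max m n)" "y \<in> L (max m n)" using m n mono[of n "max m n"] mono[of m "max m n"] by auto
    then have "x \<oplus> y \<in> U" using additive_subgroup.a_closed[OF s] unfolding U_def by blast
    then show "x \<otimes>\<^bsub>add_monoid R\<^esub> y \<in> U" by simp
  qed
  then have UI: "right_ideal R U" .
  obtain k a where a: "\<And>i. a i \<in> U"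
    "\<And>x. x \<in> U \<Longrightarrow> \<exists>r. (\<forall>i. r i \<in> carrier R) \<and> x = finsum R (\<lambda>i. a i \<otimes> r i) {..<(k::nat)}"
    by (rule right_ideal_generators[OF UI]) (rule that)
  have "\<forall>i. \<exists>n. a i \<in> L n" using a(1) unfolding U_def by blast
  then obtain N where N: "\<And>i. a i \<in> L (N i)" using choice[of "\<lambda>i n. a i \<in> L n"] by blast
  \<comment> \<open>The sum of the finitely many stages bounds each of them, so all generators of
    the union already lie in \<open>L M\<close>.\<close>
  define M where "M = sum N {..<k}"
  have aM: "a i \<in> L M" if "i < k" for i
    using N mono[of "N i" M] member_le_sum[of i "{..<k}" N] that unfolding M_def by auto
  have "U \<subseteq> L M"
  proof
    fix x assume "x \<in> U"
    then obtain r where r: "\<And>i. r i \<in> carrier R" "x = finsum R (\<lambda>i. a i \<otimes> r i) {..<k}" using a(2) by blast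
    then show "x \<in> L M" using aM L unfolding right_ideal_def by (auto intro!: additive_finsum_mem[OF s])
  qed
  then show ?thesis using inc[of M] unfolding U_def by blast
qed

end

section \<open>Prime and \<open>\<tau>\<close>-prime ideals\<close>

lemma ring_iso_closed: "f \<in> ring_iso A B \<Longrightarrow> x \<in> carrier A \<Longrightarrow> f x \<in> carrier B"
  unfolding ring_iso_def bij_betw_def by blast

lemma ring_iso_surj: "f \<in> ring_iso A B \<Longrightarrow> y \<in> carrier B \<Longrightarrow> \<exists>x\<in>carrier A. f x = y"
proof -
  assume "f \<in> ring_iso A B" "y \<in> carrier B"
  then have "y \<in> f ` carrier A" unfolding ring_iso_def bij_betw_def by simp
  then show ?thesis by blast
qed

lemma ring_iso_hom: "f \<in> ring_iso A B \<Longrightarrow> f \<in> ring_hom A B"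
  unfolding ring_iso_def by blast

lemma ring_iso_funpow: "f \<in> ring_iso A A \<Longrightarrow> (f ^^ n) \<in> ring_iso A A"
proof (induction n)
  case 0
  then show ?case using ring_iso_set_refl[of A] by (simp add: id_def)
next
  case (Suc n)
  then show ?case using ring_iso_set_trans[of "f ^^ n" A A f A] by (simp add: comp_def)
qed

lemma ideal_carrier: "ideal J A \<Longrightarrow> J \<subseteq> carrier A"
  using additive_subgroup.a_subset ideal.axioms(1) by blast

lemma (in ring) ideal_prod_subset:
  assumes "ideal P R" "\<And>i j. i \<in> I \<Longrightarrow> j \<in> J \<Longrightarrow> i \<otimes> j \<in> P"
  shows "I \<cdot> J \<subseteq> P"
proof
  fix x assume "x \<in> I \<cdot> J"
  then show "x \<in> P"
    using additive_subgroup.a_closed[OF ideal.axioms(1)[OF assms(1)]] assms(2)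
    by (induction x rule: ideal_prod.induct) auto
qed

lemma (in ring) add_ideal_supset:
  assumes "ideal I R" "ideal J R"
  shows "I \<subseteq> I <+>\<^bsub>R\<^esub> J" "J \<subseteq> I <+>\<^bsub>R\<^esub> J"
proof -
  have z: "\<zero> \<in> I" "\<zero> \<in> J" using assms by (auto intro: additive_subgroup.zero_closed ideal.axioms(1))
  show "I \<subseteq> I <+>\<^bsub>R\<^esub> J"
  proof
    fix x assume "x \<in> I"
    then have "x \<oplus> \<zero> \<in> I <+>\<^bsub>R\<^esub> J" using z unfolding set_add_def' by blast
    then show "x \<in> I <+>\<^bsub>R\<^esub> J" using \<open>x \<in> I\<close> ideal.Icarr[OF assms(1)] by simp
  qed
  show "J \<subseteq> I <+>\<^bsub>R\<^esub> J"
  proof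
    fix x assume "x \<in> J"
    then have "\<zero> \<oplus> x \<in> I <+>\<^bsub>R\<^esub> J" using z unfolding set_add_def' by blast
    then show "x \<in> I <+>\<^bsub>R\<^esub> J" using \<open>x \<in> J\<close> ideal.Icarr[OF assms(2)] by simp
  qed
qed

text \<open>Given \<open>I \<cdot> J \<subseteq> P\<close>, the product of \<open>P + I\<close> and
  \<open>P + J\<close> also lies in \<open>P\<close>. So only ideals strictly above \<open>P\<close>
  need testing, which suits an ideal chosen maximal for some property.\<close>

lemma (in ring) nc_prime_idealI:
  assumes P: "ideal P R" "P \<noteq> carrier R"
    and prime: "\<And>A B. ideal A R \<Longrightarrow> ideal B R \<Longrightarrow> P \<subset> A \<Longrightarrow> P \<subset> B \<Longrightarrow> \<not> A \<cdot> B \<subseteq> P"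
  shows "nc_prime_ideal R P"
proof -
  have "I \<subseteq> P \<or> J \<subseteq> P" if I: "ideal I R" and J: "ideal J R" and IJ: "I \<cdot> J \<subseteq> P" for I J
  proof (rule ccontr)
    assume n: "\<not> (I \<subseteq> P \<or> J \<subseteq> P)"
    have "(P <+>\<^bsub>R\<^esub> I) \<cdot> (P <+>\<^bsub>R\<^esub> J) \<subseteq> P"
    proof (rule ideal_prod_subset[OF P(1)])
      fix x y assume "x \<in> P <+>\<^bsub>R\<^esub> I" "y \<in> P <+>\<^bsub>R\<^esub> J"
      then obtain p i q j where x: "x = p \<oplus> i" "p \<in> P" "i \<in> I" and y: "y = q \<oplus> j" "q \<in> P" "j \<in> J"
        unfolding set_add_def' by blast
      have c: "p \<in> carrier R" "i \<in> carrier R" "q \<in> carrier R" "j \<in> carrier R"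
        using x y P I J ideal.Icarr by metis+
      have "p \<otimes> y \<in> P" "i \<otimes> q \<in> P" using x y c by (auto intro: ideal.I_l_closed[OF P(1)] ideal.I_r_closed[OF P(1)])
      moreover have "i \<otimes> j \<in> P" using ideal_prod.prod[of i I j J R] x y IJ by blast
      moreover have "x \<otimes> y = p \<otimes> y \<oplus> (i \<otimes> q \<oplus> i \<otimes> j)" unfolding x(1) y(1) using c by (simp add: l_distr r_distr a_ac)
      ultimately show "x \<otimes> y \<in> P" using additive_subgroup.a_closed[OF ideal.axioms(1)[OF P(1)]] by simp
    qed
    moreover have "P \<subset> P <+>\<^bsub>R\<^esub> I" "P \<subset> P <+>\<^bsub>R\<^esub> J"
      using n add_ideal_supset[OF P(1) I] add_ideal_supset[OF P(1) J] by auto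
    ultimately show False using prime[OF add_ideals[OF P(1) I] add_ideals[OF P(1) J]] by blast
  qed
  then show ?thesis unfolding nc_prime_ideal_def using P by blast
qed

lemma (in ring) ideal_preimage:
  assumes "f \<in> ring_hom R R" "ideal J R"
  shows "ideal {x \<in> carrier R. f x \<in> J} R"
  by (rule ring_hom_ring.ideal_vimage[OF ring_hom_ringI2[OF ring_axioms ring_axioms assms(1)] assms(2)])

lemma (in ring) ideal_iso_image:
  assumes f: "f \<in> ring_iso R R" and J: "ideal J R"
  shows "ideal (f ` J) R"
proof -
  let ?g = "inv_into (carrier R) f"
  have inj: "inj_on f (carrier R)" and im: "f ` carrier R = carrier R"
    using f unfolding ring_iso_def bij_betw_def by auto
  have "f ` J = {x \<in> carrier R. ?g x \<in> J}"
  proof (intro equalityI subsetI)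
    fix y assume "y \<in> f ` J"
    then show "y \<in> {x \<in> carrier R. ?g x \<in> J}"
      using ideal_carrier[OF J] inj im by (auto simp: inv_into_f_f subset_iff)
  next
    fix y assume y: "y \<in> {x \<in> carrier R. ?g x \<in> J}"
    then have "f (?g y) = y" using im by (auto intro: f_inv_into_f)
    then show "y \<in> f ` J" using y by force
  qed
  then show ?thesis
    using ideal_preimage[OF ring_iso_hom[OF ring_iso_set_sym[OF ring_axioms f]] J] by simp
qed

lemma (in ring) nc_prime_preimage:
  assumes f: "f \<in> ring_iso R R" and P: "nc_prime_ideal R P"
  shows "nc_prime_ideal R {x \<in> carrier R. f x \<in> P}"
  unfolding nc_prime_ideal_def
proof (intro conjI allI impI)
  have Pi: "ideal P R" "P \<noteq> carrier R" using P unfolding nc_prime_ideal_def by auto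
  show "ideal {x \<in> carrier R. f x \<in> P} R" using ideal_preimage[OF ring_iso_hom[OF f] Pi(1)] .
  have "f \<one> = \<one>" using ring_hom_one[OF ring_iso_hom[OF f]] .
  moreover have "\<one> \<notin> P" using ideal.one_imp_carrier[OF Pi(1)] Pi(2) by blast
  ultimately show "{x \<in> carrier R. f x \<in> P} \<noteq> carrier R" by (metis (mono_tags) mem_Collect_eq one_closed)
  fix A B assume AB: "ideal A R \<and> ideal B R \<and> A \<cdot> B \<subseteq> {x \<in> carrier R. f x \<in> P}"
  have c: "x \<in> carrier R" if "x \<in> A \<or> x \<in> B" for x using that AB ideal.Icarr by metis
  have "f ` A \<cdot> f ` B \<subseteq> P"
  proof (rule ideal_prod_subset[OF Pi(1)])
    fix x y assume "x \<in> f ` A" "y \<in> f ` B"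
    then obtain a b where ab: "a \<in> A" "x = f a" "b \<in> B" "y = f b" by blast
    then have "f (a \<otimes> b) \<in> P" using AB ideal_prod.prod[of a A b B R] by blast
    then show "x \<otimes> y \<in> P" using ab c ring_hom_mult[OF ring_iso_hom[OF f]] by simp
  qed
  then have "f ` A \<subseteq> P \<or> f ` B \<subseteq> P"
    using P ideal_iso_image[OF f] AB unfolding nc_prime_ideal_def by blast
  then show "A \<subseteq> {x \<in> carrier R. f x \<in> P} \<or> B \<subseteq> {x \<in> carrier R. f x \<in> P}" using c by blast
qed

section \<open>Primes and \<tau>-stable ideals under the ascending chain condition\<close>

locale acc_automorphism_ring = ring R for R (structure) +
  fixes \<tau> :: "'a \<Rightarrow> 'a"
  assumes iso: "\<tau> \<in> ring_iso R R"
    and ideal_acc: "\<forall>L. (\<forall>n. ideal (L n) R \<and> L n \<subseteq> L (Suc n)) \<longrightarrow> (\<exists>n :: nat. L (Suc n) = L n)"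
begin

lemma ideal_maximal:
  assumes "\<And>A. A \<in> X \<Longrightarrow> ideal A R" "A \<in> X"
  obtains M where "M \<in> X" "\<forall>K\<in>X. M \<subseteq> K \<longrightarrow> K = M"
proof -
  have "\<forall>L :: nat \<Rightarrow> 'a set. (\<forall>n. L n \<in> X \<and> L n \<subseteq> L (Suc n)) \<longrightarrow> (\<exists>n. L (Suc n) = L n)"
    using ideal_acc assms(1) by simp
  from acc_maximal[OF this assms(2)] show thesis using that by (elim bexE conjE)
qed

lemma funpow_iso: "(\<tau> ^^ n) \<in> ring_iso R R"
  using ring_iso_funpow[OF iso] .

lemma funpow_closed: "x \<in> carrier R \<Longrightarrow> (\<tau> ^^ n) x \<in> carrier R"
  using ring_iso_closed[OF funpow_iso] .

text \<open>The preimages of \<open>J\<close> under the powers of \<open>f\<close> ascend, hence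
  repeat at some \<open>n\<close>. Writing \<open>x\<close> as the image of \<open>y\<close> under
  the \<open>n\<close>-th power, \<open>y\<close> lies in the preimage for \<open>n + 1\<close>, and
  so in that for \<open>n\<close>.\<close>

lemma stable_preimage:
  assumes f: "f \<in> ring_iso R R" and J: "ideal J R" and fJ: "\<And>x. x \<in> J \<Longrightarrow> f x \<in> J"
    and x: "x \<in> carrier R" "f x \<in> J"
  shows "x \<in> J"
proof -
  let ?L = "\<lambda>n. {x \<in> carrier R. (f ^^ n) x \<in> J}"
  have "ideal (?L n) R" for n
    by (rule ideal_preimage[OF ring_iso_hom[OF ring_iso_funpow[OF f]] J])
  moreover have "?L n \<subseteq> ?L (Suc n)" for n using fJ by auto
  ultimately obtain n where n: "?L (Suc n) = ?L n" using ideal_acc[THEN spec, of ?L] by blast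
  obtain y where y: "y \<in> carrier R" "(f ^^ n) y = x" using ring_iso_surj[OF ring_iso_funpow[OF f] x(1)] by blast
  then have "y \<in> ?L (Suc n)" using x by simp
  then show ?thesis using n y by blast
qed

text \<open>For an ideal \<open>A\<close> this is the largest \<open>\<tau>\<close>-ideal inside it,
  by \<open>tau_core_subset\<close>, \<open>tau_core_tau_ideal\<close> and
  \<open>tau_core_mono\<close>.\<close>

definition tau_core :: "'a set \<Rightarrow> 'a set"
  where "tau_core A = {x \<in> carrier R. \<forall>k. (\<tau> ^^ k) x \<in> A}"

lemma tau_core_subset: "tau_core A \<subseteq> A"
proof
  fix x assume "x \<in> tau_core A"
  then have "(\<tau> ^^ 0) x \<in> A" unfolding tau_core_def by blast
  then show "x \<in> A" by simp
qed

lemma tau_core_tau_ideal: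
  assumes "ideal A R"
  shows "tau_ideal R \<tau> (tau_core A)"
  unfolding tau_ideal_def
proof
  have "tau_core A = (\<Inter>k. {x \<in> carrier R. (\<tau> ^^ k) x \<in> A})" unfolding tau_core_def by blast
  moreover have "ideal (\<Inter>k. {x \<in> carrier R. (\<tau> ^^ k) x \<in> A}) R"
    using ideal_preimage[OF ring_iso_hom[OF funpow_iso] assms] by (intro i_Intersect) auto
  ultimately show "ideal (tau_core A) R" by simp
  show "\<tau> ` tau_core A \<subseteq> tau_core A"
  proof
    fix y assume "y \<in> \<tau> ` tau_core A"
    then obtain x where x: "x \<in> carrier R" "\<And>k. (\<tau> ^^ k) x \<in> A" "y = \<tau> x" unfolding tau_core_def by blast
    have "(\<tau> ^^ k) y \<in> A" for k using x(2)[of "Suc k"] x(3) by (simp add: funpow_swap1)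
    then show "y \<in> tau_core A" using x ring_iso_closed[OF iso] unfolding tau_core_def by blast
  qed
qed

text \<open>The product condition for \<open>\<tau>\<close>-primeness of the quotient by
  \<open>N\<close>, pulled back to \<open>\<tau>\<close>-ideals of \<open>R\<close> above
  \<open>N\<close>; \<open>tau_prime_ideal_iff\<close> makes the link and adds properness.\<close>

definition tau_prime_mod :: "'a set \<Rightarrow> bool"
  where "tau_prime_mod N \<longleftrightarrow> (\<forall>A B. tau_ideal R \<tau> A \<and> tau_ideal R \<tau> B \<and> N \<subseteq> A \<and> N \<subseteq> B \<and> A \<cdot> B \<subseteq> N
    \<longrightarrow> A \<subseteq> N \<or> B \<subseteq> N)"

lemma tau_ideal_funpow: "tau_ideal R \<tau> N \<Longrightarrow> x \<in> N \<Longrightarrow> (\<tau> ^^ k) x \<in> N"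
  by (induction k) (auto simp: tau_ideal_def)

lemma tau_core_mono: "tau_ideal R \<tau> N \<Longrightarrow> N \<subseteq> A \<Longrightarrow> N \<subseteq> tau_core A"
proof
  fix x assume N: "tau_ideal R \<tau> N" "N \<subseteq> A" and x: "x \<in> N"
  have "x \<in> carrier R" using N x ideal.Icarr unfolding tau_ideal_def by metis
  then show "x \<in> tau_core A" using tau_ideal_funpow[OF N(1) x] N(2) unfolding tau_core_def by blast
qed

text \<open>Take \<open>Q\<close> maximal among the ideals above \<open>N\<close> with core inside
  \<open>N\<close>. If larger ideals \<open>A\<close> and \<open>B\<close> had product in
  \<open>Q\<close>, their cores would multiply into the core of \<open>Q\<close>, hence into
  \<open>N\<close>; \<open>\<tau>\<close>-primeness then puts one core into \<open>N\<close>,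
  against maximality.\<close>

lemma prime_with_core:
  assumes N: "tau_ideal R \<tau> N" "N \<noteq> carrier R" "tau_prime_mod N"
  obtains Q where "nc_prime_ideal R Q" "N \<subseteq> Q" "tau_core Q \<subseteq> N"
proof -
  let ?X = "{A. ideal A R \<and> N \<subseteq> A \<and> tau_core A \<subseteq> N}"
  have "N \<in> ?X" using N tau_core_subset unfolding tau_ideal_def by blast
  then obtain Q where Q: "Q \<in> ?X" "\<forall>K\<in>?X. Q \<subseteq> K \<longrightarrow> K = Q"
    by (rule ideal_maximal[rotated]) blast+
  have "nc_prime_ideal R Q"
  proof (rule nc_prime_idealI)
    show "ideal Q R" using Q by blast
    have "tau_core (carrier R) = carrier R" unfolding tau_core_def using funpow_closed by blast
    moreover have "N \<subseteq> carrier R" using N ideal_carrier unfolding tau_ideal_def by blast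
    ultimately show "Q \<noteq> carrier R" using Q N(2) by auto
    fix A B assume A: "ideal A R" "Q \<subset> A" and B: "ideal B R" "Q \<subset> B"
    show "\<not> A \<cdot> B \<subseteq> Q"
    proof
      assume AB: "A \<cdot> B \<subseteq> Q"
      have Ni: "ideal N R" using N unfolding tau_ideal_def by blast
      have "tau_core A \<cdot> tau_core B \<subseteq> N"
      proof (rule ideal_prod_subset[OF Ni])
        fix x y assume x: "x \<in> tau_core A" and y: "y \<in> tau_core B"
        then have c: "x \<in> carrier R" "y \<in> carrier R" unfolding tau_core_def by auto
        have "(\<tau> ^^ k) (x \<otimes> y) \<in> Q" for k
        proof -
          have "(\<tau> ^^ k) x \<otimes> (\<tau> ^^ k) y \<in> A \<cdot> B"
            using x y unfolding tau_core_def by (intro ideal_prod.prod) auto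
          then show ?thesis using AB ring_hom_mult[OF ring_iso_hom[OF funpow_iso] c] by auto
        qed
        then have "x \<otimes> y \<in> tau_core Q" using c unfolding tau_core_def by blast
        then show "x \<otimes> y \<in> N" using Q by blast
      qed
      moreover have "N \<subseteq> A" "N \<subseteq> B" using Q(1) A(2) B(2) by auto
      then have "N \<subseteq> tau_core A" "N \<subseteq> tau_core B"
        using tau_core_mono[OF N(1)] by auto
      ultimately have "tau_core A \<subseteq> N \<or> tau_core B \<subseteq> N"
        using N(3) tau_core_tau_ideal[OF A(1)] tau_core_tau_ideal[OF B(1)] unfolding tau_prime_mod_def by blast
      then have "A \<in> ?X \<or> B \<in> ?X" using A B Q by blast
      then show False using A B Q by blast
    qed
  qed
  then show thesis using that Q by blast
qed

text \<open>Noetherian induction: a maximal counterexample is proper and not prime, so it contains a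
  product of two larger ideals. A prime over it contains one of these, and the union of their finite
  sets works. The members of \<open>F\<close> need not be minimal primes.\<close>

lemma finite_primes_over:
  assumes "ideal A R"
  obtains F where "finite F" "\<And>M. M \<in> F \<Longrightarrow> nc_prime_ideal R M \<and> A \<subseteq> M"
    "\<And>P. nc_prime_ideal R P \<Longrightarrow> A \<subseteq> P \<Longrightarrow> \<exists>M\<in>F. M \<subseteq> P"
proof -
  define good where "good A F \<longleftrightarrow> finite F \<and> (\<forall>M\<in>F. nc_prime_ideal R M \<and> A \<subseteq> M) \<and>
    (\<forall>P. nc_prime_ideal R P \<and> A \<subseteq> P \<longrightarrow> (\<exists>M\<in>F. M \<subseteq> P))" for A F
  let ?X = "{A. ideal A R \<and> (\<nexists>F. good A F)}"
  have "A \<notin> ?X"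
  proof
    assume "A \<in> ?X"
    then obtain M where M: "M \<in> ?X" "\<forall>K\<in>?X. M \<subseteq> K \<longrightarrow> K = M"
      by (rule ideal_maximal[rotated]) blast+
    have Mi: "ideal M R" using M by blast
    have "M \<noteq> carrier R"
    proof
      assume "M = carrier R"
      have "P \<subseteq> carrier R \<and> P \<noteq> carrier R" if "nc_prime_ideal R P" for P
        using that ideal_carrier[of P R] unfolding nc_prime_ideal_def by blast
      then have "good M {}" unfolding good_def \<open>M = carrier R\<close> by auto
      then show False using M by blast
    qed
    have "\<not> nc_prime_ideal R M"
    proof
      assume "nc_prime_ideal R M"
      then have "good M {M}" unfolding good_def by blast
      then show False using M by blast
    qed
    then have "\<exists>B C. ideal B R \<and> ideal C R \<and> M \<subset> B \<and> M \<subset> C \<and> B \<cdot> C \<subseteq> M"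
    proof (rule contrapos_np)
      assume "\<nexists>B C. ideal B R \<and> ideal C R \<and> M \<subset> B \<and> M \<subset> C \<and> B \<cdot> C \<subseteq> M"
      then show "nc_prime_ideal R M"
        by (intro nc_prime_idealI[OF Mi \<open>M \<noteq> carrier R\<close>]) simp
    qed
    then obtain B C where BC: "ideal B R" "ideal C R" "M \<subset> B" "M \<subset> C" "B \<cdot> C \<subseteq> M"
      by (elim exE conjE)
    have larger: "\<exists>F. good K F" if K: "ideal K R" "M \<subset> K" for K
    proof (rule ccontr)
      assume "\<nexists>F. good K F"
      then have "K \<in> ?X" using K(1) by simp
      then have "K = M" using M(2) K(2) by (meson psubset_imp_subset)
      then show False using K(2) by simp
    qed
    obtain F where F: "good B F" using larger[OF BC(1,3)] ..
    obtain H where H: "good C H" using larger[OF BC(2,4)] ..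
    have "good M (F \<union> H)"
      unfolding good_def
    proof (intro conjI allI impI)
      have fin: "finite F" "finite H" and FB: "\<forall>K\<in>F. nc_prime_ideal R K \<and> B \<subseteq> K"
        and HC: "\<forall>K\<in>H. nc_prime_ideal R K \<and> C \<subseteq> K"
        using F H unfolding good_def by simp_all
      show "finite (F \<union> H)" using fin by simp
      have "M \<subseteq> B" "M \<subseteq> C" using BC(3,4) by auto
      then show "\<forall>K\<in>F \<union> H. nc_prime_ideal R K \<and> M \<subseteq> K" using FB HC by blast
      fix P assume P: "nc_prime_ideal R P \<and> M \<subseteq> P"
      then have "B \<cdot> C \<subseteq> P" using BC(5) by blast
      then have "B \<subseteq> P \<or> C \<subseteq> P" using P BC(1,2) unfolding nc_prime_ideal_def by blast
      then have "(\<exists>K\<in>F. K \<subseteq> P) \<or> (\<exists>K\<in>H. K \<subseteq> P)" using F H P unfolding good_def by blast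
      then show "\<exists>K\<in>F \<union> H. K \<subseteq> P" by blast
    qed
    then show False using M by blast
  qed
  then obtain F where "good A F" using assms by blast
  then show thesis using that[of F] unfolding good_def by blast
qed

text \<open>For \<open>M\<close> in the finite set \<open>F\<close>, the preimage of
  \<open>M\<close> under \<open>\<tau>\<close> is a prime over \<open>N\<close>, hence contains some
  \<open>s M\<close> in \<open>F\<close>. Iterating \<open>s\<close> from a member below
  \<open>Q0\<close> reaches a cycle of some length \<open>n\<close>. A prime \<open>Q\<close> on it
  is mapped into itself by \<open>\<tau> ^^ n\<close>, and then onto itself by
  \<open>stable_preimage\<close>; the images under the first \<open>n\<close> powers meet in the
  core of \<open>Q\<close>, which is \<open>N\<close>.\<close>

lemma tau_prime_decomposition:
  assumes N: "tau_ideal R \<tau> N" "N \<noteq> carrier R" "tau_prime_mod N"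
  shows "\<exists>Q n. nc_prime_ideal R Q \<and> n > 0 \<and> (\<tau> ^^ n) ` Q = Q \<and> N = (\<Inter>k\<in>{..<n}. (\<tau> ^^ k) ` Q)"
proof -
  have Ni: "ideal N R" using N unfolding tau_ideal_def by blast
  have Nback: "x \<in> N" if "x \<in> carrier R" "(\<tau> ^^ k) x \<in> N" for x k
    using stable_preimage[OF funpow_iso Ni tau_ideal_funpow[OF N(1)]] that by blast
  obtain Q0 where Q0: "nc_prime_ideal R Q0" "N \<subseteq> Q0" "tau_core Q0 \<subseteq> N"
    by (rule prime_with_core[OF N])
  obtain F where F: "finite F" "\<And>M. M \<in> F \<Longrightarrow> nc_prime_ideal R M \<and> N \<subseteq> M"
    "\<And>P. nc_prime_ideal R P \<Longrightarrow> N \<subseteq> P \<Longrightarrow> \<exists>M\<in>F. M \<subseteq> P"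
    by (rule finite_primes_over[OF Ni]) blast
  have "\<exists>K\<in>F. K \<subseteq> {x \<in> carrier R. \<tau> x \<in> M}" if "M \<in> F" for M
  proof (rule F(3))
    show "nc_prime_ideal R {x \<in> carrier R. \<tau> x \<in> M}" using nc_prime_preimage[OF iso] F(2)[OF that] by blast
    show "N \<subseteq> {x \<in> carrier R. \<tau> x \<in> M}"
      using F(2)[OF that] N ideal_carrier[OF Ni] unfolding tau_ideal_def by blast
  qed
  then have "\<forall>M. \<exists>K. M \<in> F \<longrightarrow> K \<in> F \<and> K \<subseteq> {x \<in> carrier R. \<tau> x \<in> M}" by blast
  then obtain s where s: "\<And>M. M \<in> F \<Longrightarrow> s M \<in> F" "\<And>M x. M \<in> F \<Longrightarrow> x \<in> s M \<Longrightarrow> \<tau> x \<in> M"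
    using choice[of "\<lambda>M K. M \<in> F \<longrightarrow> K \<in> F \<and> K \<subseteq> {x \<in> carrier R. \<tau> x \<in> M}"] by blast
  have sF: "(s ^^ j) M \<in> F" if "M \<in> F" for j M using that s(1) by (induction j) auto
  have st: "(\<tau> ^^ j) x \<in> M" if "M \<in> F" "x \<in> (s ^^ j) M" for j x M
    using that(2)
  proof (induction j arbitrary: x)
    case (Suc j)
    have "\<tau> x \<in> (s ^^ j) M" using s(2)[OF sF[OF that(1)]] Suc.prems by simp
    then have "(\<tau> ^^ j) (\<tau> x) \<in> M" by (rule Suc.IH)
    then show ?case by (simp add: funpow_swap1)
  qed simp
  obtain M where M: "M \<in> F" "M \<subseteq> Q0" using F(3) Q0 by blast
  have "\<not> inj (\<lambda>j. (s ^^ j) M)"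
    using sF[OF M(1)] F(1) by (metis finite_subset image_subsetI infinite_UNIV_nat finite_imageD)
  then obtain a b where ab: "a < b" "(s ^^ a) M = (s ^^ b) M"
    unfolding inj_def by (metis linorder_neqE_nat)
  define Q where "Q = (s ^^ a) M"
  define n where "n = b - a"
  have QF: "Q \<in> F" unfolding Q_def using sF[OF M(1)] .
  have Qp: "nc_prime_ideal R Q" "N \<subseteq> Q" using F(2)[OF QF] by auto
  then have Qi: "ideal Q R" unfolding nc_prime_ideal_def by blast
  have "(s ^^ n) Q = Q"
    using ab unfolding Q_def n_def by (metis add_diff_inverse_nat add.commute comp_apply funpow_add less_imp_not_less)
  then have Qn: "(\<tau> ^^ n) x \<in> Q" if "x \<in> Q" for x using st[OF QF, of x n] that by simp
  have Qnb: "x \<in> Q" if "x \<in> carrier R" "(\<tau> ^^ n) x \<in> Q" for x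
    using stable_preimage[OF funpow_iso Qi Qn that] .
  have image: "(\<tau> ^^ n) ` Q = Q"
  proof
    show "Q \<subseteq> (\<tau> ^^ n) ` Q"
    proof
      fix y assume y: "y \<in> Q"
      then obtain x where "x \<in> carrier R" "(\<tau> ^^ n) x = y"
        using ring_iso_surj[OF funpow_iso] ideal_carrier[OF Qi] by blast
      then show "y \<in> (\<tau> ^^ n) ` Q" using Qnb y by blast
    qed
  qed (use Qn in blast)
  have Qmult: "(\<tau> ^^ (m * n)) x \<in> Q" if "x \<in> Q" for x m
    using that Qn by (induction m) (simp_all add: funpow_add)
  \<comment> \<open>\<open>\<tau> ^^ a\<close> maps \<open>Q\<close> into
    \<open>M \<subseteq> Q0\<close>, so it moves the core of \<open>Q\<close> into the core of
    \<open>Q0\<close>, which lies in \<open>N\<close>; \<open>Nback\<close> then undoes the power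
    \<open>a\<close>.\<close>
  have core: "tau_core Q \<subseteq> N"
  proof
    fix x assume x: "x \<in> tau_core Q"
    then have xc: "x \<in> carrier R" unfolding tau_core_def by blast
    have "(\<tau> ^^ k) ((\<tau> ^^ a) x) \<in> Q0" for k
    proof -
      have "(\<tau> ^^ k) x \<in> (s ^^ a) M" using x unfolding tau_core_def Q_def by blast
      then have "(\<tau> ^^ a) ((\<tau> ^^ k) x) \<in> M" by (rule st[OF M(1)])
      moreover have "(\<tau> ^^ a) ((\<tau> ^^ k) x) = (\<tau> ^^ k) ((\<tau> ^^ a) x)"
        by (metis add.commute comp_apply funpow_add)
      ultimately show ?thesis using M(2) by auto
    qed
    then have "(\<tau> ^^ a) x \<in> tau_core Q0" using funpow_closed[OF xc] unfolding tau_core_def by blast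
    then show "x \<in> N" using Nback[OF xc] Q0(3) by blast
  qed
  have n0: "n > 0" using ab unfolding n_def by simp
  have "N = (\<Inter>k\<in>{..<n}. (\<tau> ^^ k) ` Q)"
  proof
    show "N \<subseteq> (\<Inter>k\<in>{..<n}. (\<tau> ^^ k) ` Q)"
    proof
      fix x assume x: "x \<in> N"
      have "x \<in> (\<tau> ^^ k) ` Q" for k
      proof -
        obtain y where y: "y \<in> carrier R" "(\<tau> ^^ k) y = x"
          using ring_iso_surj[OF funpow_iso] x ideal_carrier[OF Ni] by blast
        then have "y \<in> Q" using Nback x Qp(2) by blast
        then show ?thesis using y by blast
      qed
      then show "x \<in> (\<Inter>k\<in>{..<n}. (\<tau> ^^ k) ` Q)" by blast
    qed
    show "(\<Inter>k\<in>{..<n}. (\<tau> ^^ k) ` Q) \<subseteq> N"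
    proof
      fix x assume x: "x \<in> (\<Inter>k\<in>{..<n}. (\<tau> ^^ k) ` Q)"
      have "x \<in> (\<tau> ^^ 0) ` Q" using x n0 by blast
      then have xc: "x \<in> carrier R" using ideal_carrier[OF Qi] by auto
      have "(\<tau> ^^ j) x \<in> Q" for j
      proof -
        \<comment> \<open>\<open>k < n\<close> is chosen so that \<open>n\<close> divides
          \<open>j + k\<close>; if \<open>x\<close> is the image of \<open>y \<in> Q\<close> under
          \<open>\<tau> ^^ k\<close>, then \<open>(\<tau> ^^ j) x\<close> arises from
          \<open>y\<close> by a power of \<open>\<tau> ^^ n\<close>. The outer \<open>mod\<close>
          covers the case where \<open>n\<close> divides \<open>j\<close>.\<close>
        define k where "k = (n - j mod n) mod n"
        have "k < n" unfolding k_def using n0 by simp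
        then obtain y where y: "y \<in> Q" "x = (\<tau> ^^ k) y" using x by blast
        have "(j + k) mod n = 0"
        proof -
          have "(j + k) mod n = (j mod n + (n - j mod n)) mod n"
            unfolding k_def by (metis mod_add_eq mod_mod_trivial)
          also have "\<dots> = 0" using n0 by (simp add: less_imp_le_nat)
          finally show ?thesis .
        qed
        then have "j + k = ((j + k) div n) * n" by auto
        moreover have "(\<tau> ^^ (((j + k) div n) * n)) y \<in> Q" by (rule Qmult[OF y(1)])
        ultimately show ?thesis using y(2) by (metis comp_apply funpow_add)
      qed
      then show "x \<in> N" using core xc unfolding tau_core_def by blast
    qed
  qed
  then show ?thesis using Qp(1) n0 image by blast
qed

section \<open>The quotient by a \<tau>-ideal\<close>

context
  fixes Q assumes Q: "tau_ideal R \<tau> Q"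
begin

lemma Q_ideal: "ideal Q R"
  using Q unfolding tau_ideal_def by blast

lemma Q_tau: "x \<in> Q \<Longrightarrow> \<tau> x \<in> Q"
  using Q unfolding tau_ideal_def by blast

lemma quot_carrier: "carrier (R Quot Q) = (\<lambda>a. Q +> a) ` carrier R"
  unfolding FactRing_def A_RCOSETS_def' by auto

lemma quot_coset_eq: "a \<in> carrier R \<Longrightarrow> b \<in> carrier R \<Longrightarrow> Q +> a = Q +> b \<longleftrightarrow> a \<ominus> b \<in> Q"
  using quotient_eq_iff_same_a_r_cos[OF Q_ideal] by blast

lemma quot_coset_zero: "a \<in> carrier R \<Longrightarrow> Q +> a = Q \<longleftrightarrow> a \<in> Q"
  using quot_coset_eq[of a \<zero>] ideal_carrier[OF Q_ideal] by (simp add: a_minus_def)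

lemma quot_zero: "\<zero>\<^bsub>R Quot Q\<^esub> = Q"
  by (simp add: FactRing_def)

lemma quot_mult: "a \<in> carrier R \<Longrightarrow> b \<in> carrier R \<Longrightarrow> (Q +> a) \<otimes>\<^bsub>R Quot Q\<^esub> (Q +> b) = Q +> (a \<otimes> b)"
  by (simp add: FactRing_def ideal.rcoset_mult_add[OF Q_ideal])

lemma quot_add: "a \<in> carrier R \<Longrightarrow> b \<in> carrier R \<Longrightarrow> (Q +> a) \<oplus>\<^bsub>R Quot Q\<^esub> (Q +> b) = Q +> (a \<oplus> b)"
  using ring_hom_add[OF ideal.rcos_ring_hom[OF Q_ideal]] by simp

lemma quot_one: "\<one>\<^bsub>R Quot Q\<^esub> = Q +> \<one>"
  by (simp add: FactRing_def)

lemma tau_minus: "a \<in> carrier R \<Longrightarrow> b \<in> carrier R \<Longrightarrow> \<tau> (a \<ominus> b) = \<tau> a \<ominus> \<tau> b"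
proof -
  assume ab: "a \<in> carrier R" "b \<in> carrier R"
  interpret h: ring_hom_ring R R \<tau>
    by (rule ring_hom_ringI2[OF ring_axioms ring_axioms ring_iso_hom[OF iso]])
  show ?thesis using ab by (simp add: a_minus_def)
qed

lemma quot_map_coset:
  assumes a: "a \<in> carrier R" shows "quot_map R Q \<tau> (Q +> a) = Q +> \<tau> a"
proof -
  have "Q +> \<tau> x = Q +> \<tau> a" if x: "x \<in> Q +> a" for x
  proof -
    have xc: "x \<in> carrier R" using x a a_r_coset_subset_G[OF ideal_carrier[OF Q_ideal]] by blast
    have "Q +> a = Q +> x" using a_repr_independence[OF x a] additive_subgroup.a_subgroup ideal.axioms(1)[OF Q_ideal] by blast
    then have "x \<ominus> a \<in> Q" using quot_coset_eq[OF xc a] by simp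
    then have "\<tau> x \<ominus> \<tau> a \<in> Q" using Q_tau[of "x \<ominus> a"] tau_minus[OF xc a] by simp
    then show ?thesis using quot_coset_eq ring_iso_closed[OF iso] xc a by blast
  qed
  moreover have "a \<in> Q +> a"
    using abelian_subgroup.a_rcos_self[OF abelian_subgroupI3[OF ideal.axioms(1)[OF Q_ideal] abelian_group_axioms] a] .
  ultimately show ?thesis unfolding quot_map_def by blast
qed

lemma quot_map_iso: "quot_map R Q \<tau> \<in> ring_iso (R Quot Q) (R Quot Q)"
proof (rule ring_iso_memI)
  note c = ring_iso_closed[OF iso] and h = ring_iso_hom[OF iso]
  show "quot_map R Q \<tau> x \<in> carrier (R Quot Q)" if "x \<in> carrier (R Quot Q)" for x
    using that c by (auto simp: quot_carrier quot_map_coset)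
  fix x y assume "x \<in> carrier (R Quot Q)" "y \<in> carrier (R Quot Q)"
  then obtain a b where ab: "a \<in> carrier R" "x = Q +> a" "b \<in> carrier R" "y = Q +> b"
    by (auto simp: quot_carrier)
  show "quot_map R Q \<tau> (x \<otimes>\<^bsub>R Quot Q\<^esub> y) = quot_map R Q \<tau> x \<otimes>\<^bsub>R Quot Q\<^esub> quot_map R Q \<tau> y"
    using ab c by (simp add: quot_mult quot_map_coset ring_hom_mult[OF h])
  show "quot_map R Q \<tau> (x \<oplus>\<^bsub>R Quot Q\<^esub> y) = quot_map R Q \<tau> x \<oplus>\<^bsub>R Quot Q\<^esub> quot_map R Q \<tau> y"
    using ab c by (simp add: quot_add quot_map_coset ring_hom_add[OF h])
next
  note c = ring_iso_closed[OF iso] and h = ring_iso_hom[OF iso]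
  show "quot_map R Q \<tau> \<one>\<^bsub>R Quot Q\<^esub> = \<one>\<^bsub>R Quot Q\<^esub>"
    by (simp add: quot_one quot_map_coset ring_hom_one[OF h])
  show "bij_betw (quot_map R Q \<tau>) (carrier (R Quot Q)) (carrier (R Quot Q))"
    unfolding bij_betw_def
  proof
    show "inj_on (quot_map R Q \<tau>) (carrier (R Quot Q))"
    proof (rule inj_onI)
      fix x y assume xy: "x \<in> carrier (R Quot Q)" "y \<in> carrier (R Quot Q)" "quot_map R Q \<tau> x = quot_map R Q \<tau> y"
      then obtain a b where ab: "a \<in> carrier R" "x = Q +> a" "b \<in> carrier R" "y = Q +> b"
        by (auto simp: quot_carrier)
      then have "\<tau> (a \<ominus> b) \<in> Q" using xy(3) c by (simp add: quot_map_coset quot_coset_eq tau_minus)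
      \<comment> \<open>Injectivity of the induced map needs \<open>Q\<close> to be stable under
        preimages of \<open>\<tau>\<close> as well, which the chain condition provides.\<close>
      then have "a \<ominus> b \<in> Q" using stable_preimage[OF iso Q_ideal Q_tau] ab by blast
      then show "x = y" using ab quot_coset_eq by simp
    qed
    have "\<exists>x\<in>carrier (R Quot Q). quot_map R Q \<tau> x = y" if y: "y \<in> carrier (R Quot Q)" for y
    proof -
      obtain b where b: "b \<in> carrier R" "y = Q +> b" using y by (auto simp: quot_carrier)
      then obtain a where "a \<in> carrier R" "\<tau> a = b" using ring_iso_surj[OF iso] by blast
      then show ?thesis using b by (intro bexI[of _ "Q +> a"]) (auto simp: quot_carrier quot_map_coset)
    qed
    moreover have "quot_map R Q \<tau> x \<in> carrier (R Quot Q)" if "x \<in> carrier (R Quot Q)" for x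
      using that c by (auto simp: quot_carrier quot_map_coset)
    ultimately show "quot_map R Q \<tau> ` carrier (R Quot Q) = carrier (R Quot Q)" by blast
  qed
qed

lemma tau_ideal_quot_image:
  assumes A: "tau_ideal R \<tau> A"
  shows "tau_ideal (R Quot Q) (quot_map R Q \<tau>) ((\<lambda>a. Q +> a) ` A)"
  unfolding tau_ideal_def
proof
  have Ai: "ideal A R" and At: "\<And>a. a \<in> A \<Longrightarrow> \<tau> a \<in> A" using A unfolding tau_ideal_def by auto
  show "ideal ((\<lambda>a. Q +> a) ` A) (R Quot Q)"
    using ring_ideal_imp_quot_ideal[OF Q_ideal Ai] .
  show "quot_map R Q \<tau> ` (\<lambda>a. Q +> a) ` A \<subseteq> (\<lambda>a. Q +> a) ` A"
    using At ideal.Icarr[OF Ai] by (auto simp: quot_map_coset)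
qed

lemma tau_ideal_quot_preimage:
  assumes J: "tau_ideal (R Quot Q) (quot_map R Q \<tau>) J"
  shows "tau_ideal R \<tau> {a \<in> carrier R. Q +> a \<in> J}"
  unfolding tau_ideal_def
proof
  have Ji: "ideal J (R Quot Q)" using J unfolding tau_ideal_def by blast
  show "ideal {a \<in> carrier R. Q +> a \<in> J} R"
    using ring_hom_ring.ideal_vimage[OF ideal.rcos_ring_hom_ring[OF Q_ideal] Ji] .
  show "\<tau> ` {a \<in> carrier R. Q +> a \<in> J} \<subseteq> {a \<in> carrier R. Q +> a \<in> J}"
  proof
    fix y assume "y \<in> \<tau> ` {a \<in> carrier R. Q +> a \<in> J}"
    then obtain a where a: "a \<in> carrier R" "Q +> a \<in> J" "y = \<tau> a" by blast
    have "quot_map R Q \<tau> (Q +> a) \<in> J" using a(2) J unfolding tau_ideal_def by blast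
    then show "y \<in> {a \<in> carrier R. Q +> a \<in> J}"
      using a ring_iso_closed[OF iso] by (simp add: quot_map_coset)
  qed
qed

text \<open>Images and preimages under the projection carry \<open>\<tau>\<close>-ideals above
  \<open>Q\<close> to \<open>\<tau>\<close>-ideals of the quotient and back; a product lies in
  \<open>Q\<close> exactly when the product of the images is zero.\<close>

lemma tau_prime_ideal_iff: "tau_prime_ideal R \<tau> Q \<longleftrightarrow> Q \<noteq> carrier R \<and> tau_prime_mod Q"
proof
  assume "tau_prime_ideal R \<tau> Q"
  then have proper: "Q \<noteq> carrier R" and pr: "tau_prime_ring (R Quot Q) (quot_map R Q \<tau>)"
    unfolding tau_prime_ideal_def by auto
  have "tau_prime_mod Q"
    unfolding tau_prime_mod_def
  proof (intro allI impI)
    fix A B assume AB: "tau_ideal R \<tau> A \<and> tau_ideal R \<tau> B \<and> Q \<subseteq> A \<and> Q \<subseteq> B \<and> A \<cdot> B \<subseteq> Q"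
    let ?A = "(\<lambda>a. Q +> a) ` A" and ?B = "(\<lambda>a. Q +> a) ` B"
    have t: "tau_ideal (R Quot Q) (quot_map R Q \<tau>) ?A" "tau_ideal (R Quot Q) (quot_map R Q \<tau>) ?B"
      using tau_ideal_quot_image AB by auto
    have Ac: "A \<subseteq> carrier R" and Bc: "B \<subseteq> carrier R"
      using AB ideal_carrier unfolding tau_ideal_def by blast+
    have i: "ideal ?A (R Quot Q)" "ideal ?B (R Quot Q)" using t unfolding tau_ideal_def by auto
    interpret QR: ring "R Quot Q" by (rule ideal.quotient_is_ring[OF Q_ideal])
    have "?A \<cdot>\<^bsub>R Quot Q\<^esub> ?B \<subseteq> {\<zero>\<^bsub>R Quot Q\<^esub>}"
    proof (rule QR.ideal_prod_subset[OF QR.zeroideal])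
      fix x y assume "x \<in> ?A" "y \<in> ?B"
      then obtain a b where ab: "a \<in> A" "x = Q +> a" "b \<in> B" "y = Q +> b" by blast
      then have "a \<otimes> b \<in> Q" using AB ideal_prod.prod[of a A b B R] by blast
      then have "Q +> (a \<otimes> b) = Q" using quot_coset_zero ab Ac Bc by blast
      then show "x \<otimes>\<^bsub>R Quot Q\<^esub> y \<in> {\<zero>\<^bsub>R Quot Q\<^esub>}"
        using ab Ac Bc quot_mult[of a b] by (auto simp: quot_zero)
    qed
    moreover have "\<zero>\<^bsub>R Quot Q\<^esub> \<in> ?A \<cdot>\<^bsub>R Quot Q\<^esub> ?B"
      using QR.ideal_prod_is_ideal[OF i] ideal.axioms(1) additive_subgroup.zero_closed by blast
    ultimately have "?A \<cdot>\<^bsub>R Quot Q\<^esub> ?B = {\<zero>\<^bsub>R Quot Q\<^esub>}" by blast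
    then have "?A = {\<zero>\<^bsub>R Quot Q\<^esub>} \<or> ?B = {\<zero>\<^bsub>R Quot Q\<^esub>}" using pr t unfolding tau_prime_ring_def by blast
    moreover have "C \<subseteq> Q" if "(\<lambda>a. Q +> a) ` C = {\<zero>\<^bsub>R Quot Q\<^esub>}" "C \<subseteq> carrier R" for C
    proof
      fix a assume "a \<in> C"
      then have "Q +> a = Q" "a \<in> carrier R" using that quot_zero by auto
      then show "a \<in> Q" using quot_coset_zero by blast
    qed
    ultimately show "A \<subseteq> Q \<or> B \<subseteq> Q" using Ac Bc by blast
  qed
  then show "Q \<noteq> carrier R \<and> tau_prime_mod Q" using proper by blast
next
  assume H: "Q \<noteq> carrier R \<and> tau_prime_mod Q"
  interpret QR: ring "R Quot Q" by (rule ideal.quotient_is_ring[OF Q_ideal])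
  have "tau_prime_ring (R Quot Q) (quot_map R Q \<tau>)"
    unfolding tau_prime_ring_def
  proof (intro conjI allI impI)
    show "ring (R Quot Q)" by (rule QR.ring_axioms)
    show "quot_map R Q \<tau> \<in> ring_iso (R Quot Q) (R Quot Q)" by (rule quot_map_iso)
    have "\<one> \<notin> Q" using H ideal.one_imp_carrier[OF Q_ideal] by blast
    then have "Q +> \<one> \<noteq> Q" using quot_coset_zero by blast
    then show "carrier (R Quot Q) \<noteq> {\<zero>\<^bsub>R Quot Q\<^esub>}" using QR.one_closed quot_one quot_zero by (metis singletonD)
    fix J K assume JK: "tau_ideal (R Quot Q) (quot_map R Q \<tau>) J \<and> tau_ideal (R Quot Q) (quot_map R Q \<tau>) K \<and>
      J \<noteq> {\<zero>\<^bsub>R Quot Q\<^esub>} \<and> K \<noteq> {\<zero>\<^bsub>R Quot Q\<^esub>}"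
    let ?A = "{a \<in> carrier R. Q +> a \<in> J}" and ?B = "{a \<in> carrier R. Q +> a \<in> K}"
    have i: "ideal J (R Quot Q)" "ideal K (R Quot Q)" using JK unfolding tau_ideal_def by auto
    have z: "Q \<in> J" "Q \<in> K" using i ideal.axioms(1) additive_subgroup.zero_closed quot_zero by metis+
    show "J \<cdot>\<^bsub>R Quot Q\<^esub> K \<noteq> {\<zero>\<^bsub>R Quot Q\<^esub>}"
    proof
      assume JK0: "J \<cdot>\<^bsub>R Quot Q\<^esub> K = {\<zero>\<^bsub>R Quot Q\<^esub>}"
      have "?A \<cdot> ?B \<subseteq> Q"
      proof (rule ideal_prod_subset[OF Q_ideal])
        fix a b assume ab: "a \<in> ?A" "b \<in> ?B"
        then have "(Q +> a) \<otimes>\<^bsub>R Quot Q\<^esub> (Q +> b) \<in> J \<cdot>\<^bsub>R Quot Q\<^esub> K" by (intro ideal_prod.prod) auto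
        then have "Q +> (a \<otimes> b) = Q" using ab JK0 by (simp add: quot_mult quot_zero)
        then show "a \<otimes> b \<in> Q" using ab quot_coset_zero by blast
      qed
      moreover have "a \<in> carrier R \<and> Q +> a = Q" if "a \<in> Q" for a
        using that quot_coset_zero ideal.Icarr[OF Q_ideal] by blast
      then have "Q \<subseteq> ?A" "Q \<subseteq> ?B" using z by auto
      moreover have "tau_ideal R \<tau> ?A" "tau_ideal R \<tau> ?B" using tau_ideal_quot_preimage JK by auto
      ultimately have AB: "?A \<subseteq> Q \<or> ?B \<subseteq> Q" using H unfolding tau_prime_mod_def by blast
      have zero: "L = {\<zero>\<^bsub>R Quot Q\<^esub>}"
        if L: "ideal L (R Quot Q)" "Q \<in> L" "{a \<in> carrier R. Q +> a \<in> L} \<subseteq> Q" for L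
      proof -
        have "x = Q" if x: "x \<in> L" for x
        proof -
          obtain a where a: "a \<in> carrier R" "x = Q +> a"
            using x ideal_carrier[OF L(1)] unfolding quot_carrier by blast
          then show ?thesis using L(3) x quot_coset_zero by blast
        qed
        then have "L = {Q}" using L(2) by blast
        then show ?thesis by (simp add: quot_zero)
      qed
      from AB show False
      proof
        assume "?A \<subseteq> Q"
        then show False using zero[OF i(1) z(1)] JK by simp
      next
        assume "?B \<subseteq> Q"
        then show False using zero[OF i(2) z(2)] JK by simp
      qed
    qed
  qed
  then show "tau_prime_ideal R \<tau> Q" unfolding tau_prime_ideal_def using Q H by blast
qed

end

end

section \<open>Contraction to and extension from \<open>R\<close>\<close>

lemma (in ring) chain_Union_ideal:
  assumes "\<C> \<noteq> {}" "subset.chain \<A> \<C>" "\<And>J. J \<in> \<A> \<Longrightarrow> ideal J R"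
  shows "ideal (\<Union>\<C>) R"
proof (rule idealI[OF ring_axioms])
  have id: "ideal J R" if "J \<in> \<C>" for J
    using that assms(2,3) unfolding subset.chain_def by blast
  have s: "additive_subgroup J R" if "J \<in> \<C>" for J using id[OF that] ideal.axioms(1) by blast
  show "subgroup (\<Union>\<C>) (add_monoid R)"
  proof
    show "\<Union>\<C> \<subseteq> carrier (add_monoid R)" using ideal_carrier[OF id] by auto
    obtain J where "J \<in> \<C>" using assms(1) by blast
    then show "\<one>\<^bsub>add_monoid R\<^esub> \<in> \<Union>\<C>" using additive_subgroup.zero_closed[OF s] by auto
    fix x y assume "x \<in> \<Union>\<C>"
    then obtain J where J: "J \<in> \<C>" "x \<in> J" by blast
    show "inv\<^bsub>add_monoid R\<^esub> x \<in> \<Union>\<C>"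
      using additive_subgroup.a_inv_closed[OF s[OF J(1)] J(2)] J(1) unfolding a_inv_def by blast
    assume "y \<in> \<Union>\<C>"
    then obtain K where K: "K \<in> \<C>" "y \<in> K" by blast
    have "J \<subseteq> K \<or> K \<subseteq> J" using assms(2) J(1) K(1) unfolding subset.chain_def by blast
    then obtain L where "L \<in> \<C>" "x \<in> L" "y \<in> L" using J K by blast
    then show "x \<otimes>\<^bsub>add_monoid R\<^esub> y \<in> \<Union>\<C>" using additive_subgroup.a_closed[OF s] by auto
  qed
  fix a x assume "a \<in> \<Union>\<C>" "x \<in> carrier R"
  then obtain J where J: "J \<in> \<C>" "a \<in> J" "x \<in> carrier R" by blast
  show "x \<otimes> a \<in> \<Union>\<C>" using J(1) by (rule UnionI) (rule ideal.I_l_closed[OF id[OF J(1)] J(2,3)])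
  show "a \<otimes> x \<in> \<Union>\<C>" using J(1) by (rule UnionI) (rule ideal.I_r_closed[OF id[OF J(1)] J(2,3)])
qed

lemma (in ring) ideal_right_ideal: "ideal J R \<Longrightarrow> right_ideal R J"
  unfolding right_ideal_def by (auto intro: ideal.axioms(1) ideal.I_r_closed)

locale skew_series_tau_minus_id = skew_series R I \<tau> \<delta> + gr_noetherian_ring R I
  for R (structure) and I \<tau> \<delta> +
  assumes delta_eq: "r \<in> carrier R \<Longrightarrow> \<delta> r = \<tau> r \<ominus> r"
begin

text \<open>Two-sided ideals are right ideals, so the chain condition lifted from the graded ring
  makes the results on \<open>\<tau>\<close>-primes available for \<open>R\<close>.\<close>

sublocale acc_automorphism_ring R \<tau>
proof
  show "\<tau> \<in> ring_iso R R" by (rule tau_iso)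
  show "\<forall>L. (\<forall>n. ideal (L n) R \<and> L n \<subseteq> L (Suc n)) \<longrightarrow> (\<exists>n :: nat. L (Suc n) = L n)"
    using right_ideal_acc ideal_right_ideal by metis
qed

abbreviation K where "K \<equiv> const_series R"
abbreviation contr where "contr \<equiv> series_contraction R"

lemma K_mult: "r \<in> carrier R \<Longrightarrow> s \<in> carrier R \<Longrightarrow> K r \<otimes>\<^bsub>T\<^esub> K s = K (r \<otimes> s)"
  by (simp add: T_mult const_C series_mult_const_left) (auto simp: const_series_def)

lemma K_hom: "K \<in> ring_hom R T"
proof (rule ring_hom_memI)
  fix r s assume c: "r \<in> carrier R" "s \<in> carrier R"
  then show "K r \<in> carrier T" by (simp add: T_carrier const_C)
  show "K (r \<otimes> s) = K r \<otimes>\<^bsub>T\<^esub> K s" using c by (simp add: K_mult)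
  show "K (r \<oplus> s) = K r \<oplus>\<^bsub>T\<^esub> K s" using c by (auto simp: T_add const_series_def)
qed (simp add: T_one)

lemma T_finsum: "(\<And>i. f i \<in> C) \<Longrightarrow> finsum T f {..<k::nat} = (\<lambda>n. finsum R (\<lambda>i. f i n) {..<k})"
proof (induction k)
  case 0
  show ?case using abelian_monoid.finsum_empty[OF abelian_group.axioms(1)[OF ring.is_abelian_group[OF ring_T]]]
    by (simp add: T_zero)
next
  case (Suc k)
  have "finsum T f {..<Suc k} = finsum T f {..<k} \<oplus>\<^bsub>T\<^esub> f k"
    using Suc.prems by (intro ring.finsum_lessThan_Suc[OF ring_T]) (simp add: T_carrier)
  also have "\<dots> = (\<lambda>n. finsum R (\<lambda>i. f i n) {..<k} \<oplus> f k n)" using Suc by (simp add: T_add)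
  also have "\<dots> = (\<lambda>n. finsum R (\<lambda>i. f i n) {..<Suc k})"
  proof
    fix n
    have "f i n \<in> carrier R" for i using Suc.prems[of i] by blast
    then show "finsum R (\<lambda>i. f i n) {..<k} \<oplus> f k n = finsum R (\<lambda>i. f i n) {..<Suc k}"
      by (simp add: finsum_lessThan_Suc)
  qed
  finally show ?case .
qed

section \<open>The unit 1 + y and contraction\<close>

definition one_plus_y :: "nat \<Rightarrow> 'a"
  where "one_plus_y = (\<lambda>n. K \<one> n \<oplus> skew_var R n)"

text \<open>The geometric series with coefficients \<open>(-1)^n\<close>. It behaves as for a
  commuting variable, because \<open>\<tau>\<close> fixes \<open>\<one>\<close> and
  \<open>\<ominus> \<one>\<close> and \<open>\<delta>\<close> kills them.\<close>

definition one_plus_y_inv :: "nat \<Rightarrow> 'a"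
  where "one_plus_y_inv = (\<lambda>n. if even n then \<one> else \<ominus> \<one>)"

lemma skew_var_C: "skew_var R \<in> C"
  by (auto simp: skew_var_def)

lemma one_plus_y_C: "one_plus_y \<in> C"
  by (auto simp: skew_var_def const_series_def one_plus_y_def)

lemma one_plus_y_inv_C: "one_plus_y_inv \<in> C"
  by (auto simp: one_plus_y_inv_def)

lemma series_mult_skew_var:
  assumes b: "b \<in> C"
  shows "series_mult (skew_var R) b = Y b"
proof
  fix n
  have c: "(Y ^^ i) b n \<in> carrier R" for i by (rule Ypow_carr[OF b])
  have "ssum (\<lambda>i. skew_var R i \<otimes> (Y ^^ i) b n) = skew_var R 1 \<otimes> (Y ^^ 1) b n"
    using c c[of 1] by (intro ssum_single) (auto simp: skew_var_def)
  then show "series_mult (skew_var R) b n = Y b n" using c[of 1] by (simp add: series_mult_def skew_var_def)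
qed

lemma series_mult_one_plus_y:
  assumes b: "b \<in> C"
  shows "series_mult one_plus_y b n = b n \<oplus> Y b n"
proof -
  have "b n \<in> carrier R" using b by blast
  then show ?thesis
    unfolding one_plus_y_def
    using b by (simp add: series_mult_add_left const_C skew_var_C series_mult_const_left series_mult_skew_var)
qed

lemma tau_eq: "r \<in> carrier R \<Longrightarrow> \<tau> r = r \<oplus> \<delta> r"
proof -
  assume r: "r \<in> carrier R"
  have "u = r \<oplus> (u \<ominus> r)" if "u \<in> carrier R" for u using that r by algebra
  then show ?thesis using r delta_eq[OF r] by simp
qed

text \<open>The constant coefficient on the left is \<open>r \<oplus> \<delta> r\<close>, which
  equals \<open>\<tau> r\<close> by the hypothesis on \<open>\<delta>\<close>; the coefficient of
  \<open>y\<close> is \<open>\<tau> r\<close> in any case.\<close>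

lemma one_plus_y_commute:
  assumes r: "r \<in> carrier R"
  shows "one_plus_y \<otimes>\<^bsub>T\<^esub> K r = K (\<tau> r) \<otimes>\<^bsub>T\<^esub> one_plus_y"
proof
  fix n
  have "r \<oplus> (\<zero> \<oplus> \<delta> r) = \<tau> r" using r tau_eq[OF r] by simp
  then show "(one_plus_y \<otimes>\<^bsub>T\<^esub> K r) n = (K (\<tau> r) \<otimes>\<^bsub>T\<^esub> one_plus_y) n"
    using r by (simp add: T_mult one_plus_y_C const_C series_mult_one_plus_y series_mult_const_left)
      (auto simp: Y_apply const_series_def one_plus_y_def skew_var_def)
qed

lemma one_plus_y_right_inv: "one_plus_y \<otimes>\<^bsub>T\<^esub> one_plus_y_inv = \<one>\<^bsub>T\<^esub>"
proof
  fix n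
  interpret h: ring_hom_ring R R \<tau>
    by (rule ring_hom_ringI2[OF ring_axioms ring_axioms tau_hom])
  have "\<delta> \<one> = \<zero>" using delta_eq[of \<one>] by (simp add: a_minus_def r_neg)
  moreover have "\<delta> (\<ominus> \<one>) = \<zero>" using delta_eq[of "\<ominus> \<one>"] by (simp add: a_minus_def l_neg)
  ultimately show "(one_plus_y \<otimes>\<^bsub>T\<^esub> one_plus_y_inv) n = \<one>\<^bsub>T\<^esub> n"
    by (simp add: T_mult one_plus_y_C one_plus_y_inv_C series_mult_one_plus_y T_one)
      (auto simp: Y_apply const_series_def one_plus_y_inv_def l_neg r_neg elim!: oddE)
qed

lemma contr_tau_ideal:
  assumes P: "ideal P T"
  shows "tau_ideal R \<tau> (contr P)"
  unfolding tau_ideal_def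
proof
  interpret TR: ring T by (rule ring_T)
  show "ideal (contr P) R"
    unfolding series_contraction_def
    by (rule ring_hom_ring.ideal_vimage[OF ring_hom_ringI2[OF ring_axioms ring_T K_hom] P])
  show "\<tau> ` contr P \<subseteq> contr P"
  proof
    fix s assume "s \<in> \<tau> ` contr P"
    then obtain r where r: "r \<in> carrier R" "K r \<in> P" "s = \<tau> r" unfolding series_contraction_def by blast
    have c: "K (\<tau> r) \<in> carrier T" "one_plus_y \<in> carrier T" "one_plus_y_inv \<in> carrier T"
      using r one_plus_y_C one_plus_y_inv_C by (simp_all add: T_carrier const_C)
    have "one_plus_y \<otimes>\<^bsub>T\<^esub> K r \<in> P" by (rule ideal.I_l_closed[OF P r(2) c(2)])
    then have "(K (\<tau> r) \<otimes>\<^bsub>T\<^esub> one_plus_y) \<otimes>\<^bsub>T\<^esub> one_plus_y_inv \<in> P"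
      unfolding one_plus_y_commute[OF r(1)] using ideal.I_r_closed[OF P] c by blast
    then have "K (\<tau> r) \<in> P" using c by (simp add: TR.m_assoc one_plus_y_right_inv)
    then show "s \<in> contr P" using r unfolding series_contraction_def by simp
  qed
qed

lemma contr_proper:
  assumes "ideal P T" "P \<noteq> carrier T"
  shows "contr P \<noteq> carrier R"
proof
  assume "contr P = carrier R"
  then have "\<one>\<^bsub>T\<^esub> \<in> P" unfolding T_one series_contraction_def by blast
  then show False using ideal.one_imp_carrier[OF assms(1)] assms(2) by blast
qed

section \<open>Extension of \<tau>-ideals and transfer of primeness\<close>

definition ext :: "'a set \<Rightarrow> (nat \<Rightarrow> 'a) set"
  where "ext A = {a \<in> C. \<forall>n. a n \<in> A}"

text \<open>A \<open>\<tau>\<close>-ideal is also stable under \<open>\<delta>\<close>, as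
  \<open>\<delta> x\<close> is \<open>\<tau> x \<ominus> x\<close>, and \<open>Y\<close> is
  assembled from these two maps.\<close>

lemma Ypow_ext:
  assumes B: "tau_ideal R \<tau> B" and b: "b \<in> ext B"
  shows "(Y ^^ i) b n \<in> B"
proof (induction i arbitrary: n)
  case 0
  then show ?case using b unfolding ext_def by simp
next
  case (Suc i)
  have Bi: "ideal B R" and Bt: "\<And>x. x \<in> B \<Longrightarrow> \<tau> x \<in> B" using B unfolding tau_ideal_def by auto
  have s: "additive_subgroup B R" using Bi ideal.axioms(1) by blast
  have "\<delta> x \<in> B" if x: "x \<in> B" for x
    using delta_eq[OF ideal.Icarr[OF Bi x]] Bt[OF x] x additive_subgroup.a_closed[OF s]
      additive_subgroup.a_inv_closed[OF s] unfolding a_minus_def by auto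
  then show ?case
    using Suc Bt additive_subgroup.a_closed[OF s] additive_subgroup.zero_closed[OF s]
    by (simp add: Ypow_Suc del: funpow.simps)
qed

text \<open>Every term of the coefficient series lies in \<open>N\<close>, and so does its limit
  since \<open>N\<close> is closed. With \<open>A\<close> or \<open>B\<close> the whole ring this
  makes \<open>ext\<close> produce ideals; with \<open>N\<close> a contraction it transfers products
  of \<open>\<tau>\<close>-ideals to \<open>T\<close>.\<close>

lemma series_mult_ext:
  assumes B: "tau_ideal R \<tau> B" and N: "ideal N R"
    and AB: "\<And>x y. x \<in> A \<Longrightarrow> y \<in> B \<Longrightarrow> x \<otimes> y \<in> N"
    and a: "a \<in> ext A" and b: "b \<in> ext B"
  shows "series_mult a b \<in> ext N"
proof -
  have c: "a \<in> C" "b \<in> C" using a b unfolding ext_def by auto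
  have s: "additive_subgroup N R" using N ideal.axioms(1) by blast
  have "series_mult a b n \<in> N" for n
    unfolding series_mult_def
  proof (rule ssum_mem_closed[OF series_mult_adm[OF c] s right_ideal_closed[OF ideal_right_ideal[OF N]]])
    fix i show "a i \<otimes> (Y ^^ i) b n \<in> N"
      using AB Ypow_ext[OF B b] a unfolding ext_def by blast
  qed
  then show ?thesis using series_mult_C[OF c] unfolding ext_def by blast
qed

lemma tau_ideal_carrier: "tau_ideal R \<tau> (carrier R)"
  unfolding tau_ideal_def using oneideal by auto

lemma ext_carrier: "carrier T = ext (carrier R)"
  unfolding ext_def T_carrier by blast

lemma ext_ideal:
  assumes A: "tau_ideal R \<tau> A"
  shows "ideal (ext A) T"
proof (rule idealI[OF ring_T])
  have Ai: "ideal A R" using A unfolding tau_ideal_def by blast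
  have s: "additive_subgroup A R" using Ai ideal.axioms(1) by blast
  interpret TR: ring T by (rule ring_T)
  show "subgroup (ext A) (add_monoid T)"
  proof
    show "ext A \<subseteq> carrier (add_monoid T)" unfolding ext_def by (auto simp: T_carrier)
    show "\<one>\<^bsub>add_monoid T\<^esub> \<in> ext A"
      using additive_subgroup.zero_closed[OF s] by (auto simp: ext_def T_zero)
    fix x y assume x: "x \<in> ext A"
    then have xA: "x n \<in> A" "x n \<in> carrier R" for n unfolding ext_def by auto
    have "\<ominus>\<^bsub>T\<^esub> x = (\<lambda>n. \<ominus> x n)"
      using xA by (intro TR.minus_equality) (auto simp: T_carrier T_add T_zero l_neg)
    then have "\<ominus>\<^bsub>T\<^esub> x \<in> ext A"
      using xA additive_subgroup.a_inv_closed[OF s] unfolding ext_def by auto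
    then show "inv\<^bsub>add_monoid T\<^esub> x \<in> ext A" unfolding a_inv_def .
    assume "y \<in> ext A"
    then show "x \<otimes>\<^bsub>add_monoid T\<^esub> y \<in> ext A"
      using x additive_subgroup.a_closed[OF s] by (auto simp: ext_def T_add Pi_iff)
  qed
  fix a x assume a: "a \<in> ext A" and x: "x \<in> carrier T"
  have c: "a \<in> C" "x \<in> C" using a x unfolding ext_def T_carrier by auto
  have x': "x \<in> ext (carrier R)" using x ext_carrier by simp
  show "x \<otimes>\<^bsub>T\<^esub> a \<in> ext A"
    using series_mult_ext[OF A Ai _ x' a] ideal.I_l_closed[OF Ai] by (simp add: T_mult c)
  show "a \<otimes>\<^bsub>T\<^esub> x \<in> ext A"
    using series_mult_ext[OF tau_ideal_carrier Ai _ a x'] ideal.I_r_closed[OF Ai] by (simp add: T_mult c)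
qed

lemma K_ext: "tau_ideal R \<tau> A \<Longrightarrow> r \<in> A \<Longrightarrow> K r \<in> ext A"
proof -
  assume A: "tau_ideal R \<tau> A" and r: "r \<in> A"
  have Ai: "ideal A R" using A unfolding tau_ideal_def by blast
  have "\<zero> \<in> A" using Ai ideal.axioms(1) additive_subgroup.zero_closed by blast
  then show ?thesis using r ideal.Icarr[OF Ai] unfolding ext_def const_series_def by auto
qed

text \<open>Let finitely many \<open>a i\<close> generate the contraction as a right ideal, and
  write the \<open>n\<close>-th coefficient of \<open>x\<close> as the sum of the
  \<open>a i \<otimes> r n i\<close>. Then \<open>x\<close> is the finite sum of the products of the
  constants \<open>a i\<close> with the series of coefficients \<open>r n i\<close>; the
  \<open>a i\<close> stand on the left, where constants multiply coefficientwise.\<close>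

lemma ext_contr_subset:
  assumes P: "ideal P T"
  shows "ext (contr P) \<subseteq> P"
proof
  fix x assume x: "x \<in> ext (contr P)"
  have Ni: "ideal (contr P) R" using contr_tau_ideal[OF P] unfolding tau_ideal_def by blast
  obtain k a where a: "\<And>i. a i \<in> contr P"
    "\<And>x. x \<in> contr P \<Longrightarrow> \<exists>r. (\<forall>i. r i \<in> carrier R) \<and> x = finsum R (\<lambda>i. a i \<otimes> r i) {..<(k::nat)}"
    by (rule right_ideal_generators[OF ideal_right_ideal[OF Ni]]) (rule that)
  have ac: "a i \<in> carrier R" "K (a i) \<in> P" for i using a(1)[of i] unfolding series_contraction_def by auto
  have "\<forall>n. \<exists>r. (\<forall>i. r i \<in> carrier R) \<and> x n = finsum R (\<lambda>i. a i \<otimes> r i) {..<k}"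
    using a(2) x unfolding ext_def by blast
  then obtain r where r: "\<And>n i. r n i \<in> carrier R" "\<And>n. x n = finsum R (\<lambda>i. a i \<otimes> r n i) {..<k}"
    using choice[of "\<lambda>n r. (\<forall>i. r i \<in> carrier R) \<and> x n = finsum R (\<lambda>i. a i \<otimes> r i) {..<k}"] by blast
  have rC: "(\<lambda>n. r n i) \<in> C" for i using r(1) by blast
  let ?f = "\<lambda>i. K (a i) \<otimes>\<^bsub>T\<^esub> (\<lambda>n. r n i)"
  have f: "?f i = (\<lambda>n. a i \<otimes> r n i)" for i
    using T_mult[OF const_C[OF ac(1)] rC] series_mult_const_left[OF ac(1) rC] by simp
  have "?f i \<in> C" for i unfolding f using ac(1) r(1) by auto
  then have "finsum T ?f {..<k} = (\<lambda>n. finsum R (\<lambda>i. ?f i n) {..<k})" by (rule T_finsum)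
  then have "x = finsum T ?f {..<k}" unfolding f using r(2) by auto
  moreover have "finsum T ?f {..<k} \<in> P"
  proof (rule ring.additive_finsum_mem[OF ring_T ideal.axioms(1)[OF P]])
    fix i show "?f i \<in> P" using ideal.I_r_closed[OF P ac(2)] rC by (simp add: T_carrier)
  qed
  ultimately show "x \<in> P" by simp
qed

lemma contr_tau_prime:
  assumes P: "nc_prime_ideal T P"
  shows "tau_prime_mod (contr P)"
  unfolding tau_prime_mod_def
proof (intro allI impI)
  interpret TR: ring T by (rule ring_T)
  have Pi: "ideal P T" using P unfolding nc_prime_ideal_def by blast
  have Ni: "ideal (contr P) R" using contr_tau_ideal[OF Pi] unfolding tau_ideal_def by blast
  fix A B assume AB: "tau_ideal R \<tau> A \<and> tau_ideal R \<tau> B \<and> contr P \<subseteq> A \<and> contr P \<subseteq> B \<and> A \<cdot> B \<subseteq> contr P"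
  have "ext A \<cdot>\<^bsub>T\<^esub> ext B \<subseteq> P"
  proof (rule TR.ideal_prod_subset[OF Pi])
    fix a b assume ab: "a \<in> ext A" "b \<in> ext B"
    have "series_mult a b \<in> ext (contr P)"
    proof (rule series_mult_ext[OF _ Ni _ ab])
      show "tau_ideal R \<tau> B" using AB by blast
      show "x \<otimes> y \<in> contr P" if "x \<in> A" "y \<in> B" for x y
        using ideal_prod.prod[of x A y B R] that AB by blast
    qed
    moreover have "a \<in> C" "b \<in> C" using ab unfolding ext_def by auto
    ultimately show "a \<otimes>\<^bsub>T\<^esub> b \<in> P" using T_mult ext_contr_subset[OF Pi] by auto
  qed
  then have "ext A \<subseteq> P \<or> ext B \<subseteq> P"
    using P ext_ideal AB unfolding nc_prime_ideal_def by blast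
  moreover have "D \<subseteq> contr P" if D: "tau_ideal R \<tau> D" "ext D \<subseteq> P" for D
  proof
    fix r assume r: "r \<in> D"
    have "r \<in> carrier R" using D(1) r ideal.Icarr unfolding tau_ideal_def by metis
    then show "r \<in> contr P" using K_ext[OF D(1) r] D(2) unfolding series_contraction_def by blast
  qed
  ultimately show "A \<subseteq> contr P \<or> B \<subseteq> contr P" using AB by blast
qed

lemma contr_ext:
  assumes Q: "tau_ideal R \<tau> Q"
  shows "contr (ext Q) = Q"
proof
  show "contr (ext Q) \<subseteq> Q"
  proof
    fix r assume "r \<in> contr (ext Q)"
    then have "K r 0 \<in> Q" unfolding series_contraction_def ext_def by blast
    then show "r \<in> Q" by (simp add: const_series_def)
  qed
  show "Q \<subseteq> contr (ext Q)"
    using K_ext[OF Q] Q ideal_carrier unfolding tau_ideal_def series_contraction_def by blast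
qed

text \<open>Contraction commutes with unions of chains, and \<open>ext Q\<close> contracts to
  \<open>Q\<close>, so Zorn's lemma gives an ideal \<open>P\<close> of \<open>T\<close> maximal with
  contraction \<open>Q\<close>. Two larger ideals with product in \<open>P\<close> would contract to
  \<open>\<tau>\<close>-ideals with product in \<open>Q\<close>, and one of these would have to
  equal \<open>Q\<close>.\<close>

lemma prime_over_tau_prime:
  assumes Q: "tau_ideal R \<tau> Q" "Q \<noteq> carrier R" "tau_prime_mod Q"
  shows "\<exists>P. nc_prime_ideal T P \<and> contr P = Q"
proof -
  interpret TR: ring T by (rule ring_T)
  let ?S = "{P. ideal P T \<and> contr P = Q}"
  have "ext Q \<in> ?S" using ext_ideal contr_ext Q(1) by blast
  then have "?S \<noteq> {}" by blast
  moreover have "\<Union>\<C> \<in> ?S" if C: "\<C> \<noteq> {}" "subset.chain ?S \<C>" for \<C>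
  proof -
    have "ideal (\<Union>\<C>) T" by (rule TR.chain_Union_ideal[OF C]) simp
    moreover have "contr J = Q" if "J \<in> \<C>" for J using that C(2) unfolding subset.chain_def by blast
    then have "contr (\<Union>\<C>) = Q" using C(1) unfolding series_contraction_def by blast
    ultimately show ?thesis by simp
  qed
  ultimately have "\<exists>P\<in>?S. \<forall>J\<in>?S. P \<subseteq> J \<longrightarrow> J = P" by (rule subset_Zorn_nonempty)
  then obtain P where P: "ideal P T" "contr P = Q" "\<And>J. ideal J T \<Longrightarrow> contr J = Q \<Longrightarrow> P \<subseteq> J \<Longrightarrow> J = P"
    by auto
  have "nc_prime_ideal T P"
  proof (rule TR.nc_prime_idealI[OF P(1)])
    show "P \<noteq> carrier T"
    proof
      assume "P = carrier T"
      then have "K r \<in> P" if "r \<in> carrier R" for r using const_C[OF that] by (simp add: T_carrier)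
      then have "contr P = carrier R" unfolding series_contraction_def by blast
      then show False using P(2) Q(2) by simp
    qed
    fix A B assume A: "ideal A T" "P \<subset> A" and B: "ideal B T" "P \<subset> B"
    show "\<not> A \<cdot>\<^bsub>T\<^esub> B \<subseteq> P"
    proof
      assume AB: "A \<cdot>\<^bsub>T\<^esub> B \<subseteq> P"
      \<comment> \<open>Contraction is monotone, and equality of the contractions would contradict
        the maximality of \<open>P\<close>.\<close>
      have larger: "Q \<subseteq> contr J \<and> contr J \<noteq> Q" if "ideal J T" "P \<subset> J" for J
        using that P(2) P(3)[OF that(1)] unfolding series_contraction_def by blast
      have "contr A \<cdot> contr B \<subseteq> Q"
      proof (rule ideal_prod_subset)
        show "ideal Q R" using Q(1) unfolding tau_ideal_def by blast
        fix x y assume "x \<in> contr A" "y \<in> contr B"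
        then have xy: "x \<in> carrier R" "y \<in> carrier R" "K x \<in> A" "K y \<in> B"
          unfolding series_contraction_def by auto
        then have "K x \<otimes>\<^bsub>T\<^esub> K y \<in> P" using AB ideal_prod.prod[of "K x" A "K y" B T] by blast
        then have "x \<otimes> y \<in> contr P" using xy unfolding series_contraction_def by (simp add: K_mult)
        then show "x \<otimes> y \<in> Q" using P(2) by simp
      qed
      then have "contr A \<subseteq> Q \<or> contr B \<subseteq> Q"
        using Q(3) contr_tau_ideal[OF A(1)] contr_tau_ideal[OF B(1)] larger[OF A] larger[OF B]
        unfolding tau_prime_mod_def by blast
      then show False using larger[OF A] larger[OF B] by blast
    qed
  qed
  then show ?thesis using P(2) by blast
qed

end

theorem theorem3p18:
  fixes R :: "('a, 'm) ring_scheme" (structure)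
    and I :: "'a set" and \<tau> \<delta> :: "'a \<Rightarrow> 'a"
  assumes "ring R" and "carrier R \<noteq> {\<zero>}"
    and "ideal I R" and "I \<noteq> carrier R"
    and "adic_separated R I" and "adic_complete R I"
    and "two_sided_noetherian (gr_ring R I)"
    and "\<tau> \<in> ring_iso R R" and "left_skew_derivation R \<tau> \<delta>"
    and "\<tau> ` I = I"
    and "\<exists>\<tau>'\<in>ring_iso (gr_ring R I) (gr_ring R I).
           \<forall>a\<in>carrier R. \<tau>' (gr_symbol R I a) = gr_symbol R I (\<tau> a)"
    and "\<delta> ` carrier R \<subseteq> I" and "\<delta> ` I \<subseteq> ideal_power R I 2"
    and "\<forall>r\<in>carrier R. \<delta> r = \<tau> r \<ominus> r"
  defines "T \<equiv> skew_power_series_ring R I \<tau> \<delta>"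
  shows "(\<forall>P. nc_prime_ideal T P \<longrightarrow>
            tau_prime_ideal R \<tau> (series_contraction R P) \<and>
            (\<exists>Q n. nc_prime_ideal R Q \<and> n > 0 \<and> (\<tau> ^^ n) ` Q = Q \<and>
               series_contraction R P = (\<Inter>k\<in>{..<n}. (\<tau> ^^ k) ` Q))) \<and>
         (\<forall>Q. tau_prime_ideal R \<tau> Q \<longrightarrow>
            (\<exists>P. nc_prime_ideal T P \<and> series_contraction R P = Q))"
proof -
  interpret S: skew_series_tau_minus_id R I \<tau> \<delta>
    using assms(1,3,5-10,12-14)
    by (simp add: skew_series_tau_minus_id_def skew_series_def skew_series_axioms_def adic_ring_def
        adic_ring_axioms_def gr_noetherian_ring_def gr_noetherian_ring_axioms_def
        skew_series_tau_minus_id_axioms_def)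
  show ?thesis
    unfolding T_def
  proof (intro conjI allI impI)
    fix P assume P: "nc_prime_ideal S.T P"
    then have N: "tau_ideal R \<tau> (S.contr P)" "S.contr P \<noteq> carrier R"
      using S.contr_tau_ideal S.contr_proper unfolding nc_prime_ideal_def by blast+
    note pr = S.contr_tau_prime[OF P]
    show "tau_prime_ideal R \<tau> (S.contr P)" using S.tau_prime_ideal_iff[OF N(1)] N(2) pr by blast
    show "\<exists>Q n. nc_prime_ideal R Q \<and> n > 0 \<and> (\<tau> ^^ n) ` Q = Q \<and> S.contr P = (\<Inter>k\<in>{..<n}. (\<tau> ^^ k) ` Q)"
      by (rule S.tau_prime_decomposition[OF N pr])
  next
    fix Q assume Q: "tau_prime_ideal R \<tau> Q"
    then have "tau_ideal R \<tau> Q" unfolding tau_prime_ideal_def by blast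
    then show "\<exists>P. nc_prime_ideal S.T P \<and> S.contr P = Q"
      using S.prime_over_tau_prime S.tau_prime_ideal_iff Q by blast
  qed
qed

end
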